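(* Let $1 \le p \le \infty$. Let $(k_j)_{j\ge0}$, $(\ell_j)_{j\ge0}$ be base sequences. Let $\mathfrak{M}$ be a totally ordered family of weight sequences. Assume, in the Roumieu case $[\cdot]=\{\cdot\}$, that $$\text{for all } M \in \mathfrak{M} \text{ there is } M' \in \mathfrak{M} \text{ such that } m_{k_{j+1}}/ m'_{k_j} \text{ is bounded in } j,$$ and, in the Beurling case $[\cdot]=(\cdot)$, that $$\text{for all } M \in \mathfrak{M} \text{ there is } M' \in \mathfrak{M} \text{ such that } m'_{k_{j+1}}/ m_{k_j} \text{ is bounded in } j.$$ Then (in each of the two cases): (a) $\mathcal{B}^{[\mathfrak{M}]}_{L^p,(k_j)}(\mathbb{R}^n)= \mathcal{B}^{[\mathfrak{M}]}_{L^p}(\mathbb{R}^n)$. (b) $\mathcal{D}^{[\mathfrak{M}]}_{(k_j)}(\mathbb{R}^n)= \mathcal{D}^{[\mathfrak{M}]}(\mathbb{R}^n)$. Assume additionally that, for all $M \in \mathfrak{M}$, $j/m_j$ is bounded, in the Roumieu case, and tends to zero as $j\to\infty$, in the Beurling case. Then: (c) $\mathcal{E}^{[\mathfrak{M}]}_{L^p,(k_j)}(U)= \mathcal{E}^{[\mathfrak{M}]}_{L^p}(U)$ for all open $U \subseteq \mathbb{R}^n$, provided that $(k_j)$ is a special base sequence. (d) $\mathcal{S}^{[\mathfrak{M}]}_{(k_j),(\ell_j)}(\mathbb{R}^n)= \mathcal{S}^{[\mathfrak{M}]}(\mathbb{R}^n)$, provided that $\mathfrak{M}$ has [moderate gr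owth].
   Context: A base sequence is a strictly increasing infinite sequence $0 = k_0 < k_1 < k_2 < \cdots$ of integers; it is called special if $k_{j+1}/k_j$, $j \ge 1$, is bounded. A weight sequence is a positive sequence $M=(M_k)_{k\ge 0}$ with $M_0=1\le M_1 \le \mu_2 \le \mu_3 \le \cdots$, where $\mu_k:= M_k/M_{k-1}$. We put $m_k:= M_k^{1/k}$ for $k\ge 1$ and $m_0:=1$ (so that $(\rho m_k)^k=\rho^k M_k$ for all $k \ge 0$); for $M'\in\mathfrak{M}$ we write $m'_k := (M'_k)^{1/k}$ accordingly. A family $\mathfrak{M}$ of weight sequences is totally ordered if for all $M,M'\in\mathfrak{M}$ either $M_j \le M'_j$ for all $j$ or $M'_j \le M_j$ for all $j$. $\mathfrak{M}$ has [moderate growth] if, in the Roumieu case, for all $M\in\mathfrak{M}$ there are $M'\in\mathfrak{M}$ and $C>0$ with $M_{j+k}\le C^{j+k}M'_jM'_k$ for all $j,k\ge 0$, and, in the Beurling case, for all $M\in\mathfrak{M}$ there are $M'\in\mathfrak{M}$ and $C>0$ with $M'_{j+k}\le C^{j+k}M_jM_k$ for all $j,k\ge 0$. Function classes. The symbol $[\cdot]$ stands for $\{\cdot\}$ (Roumieu) or $(\cdot)$ (Beurling). $\mathcal{E}^{\{\mathfrak{M}\}}_{L^p}(U)$: all $f\in C^\infty(U)$ such that for every open relatively compact $\Omega\Subset U$ there exist $M\in\mathfrak{M}$ and $C,\rho>0$ with $\max_{|\alpha|=k}\|\partial^\alpha f\|_{L^p(\Omega)}\le C(\rho m_k)^k$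 for all $k\ge0$. $\mathcal{E}^{(\mathfrak{M})}_{L^p}(U)$: all $f\in C^\infty(U)$ such that for every such $\Omega$, every $M\in\mathfrak{M}$ and every $\rho>0$ there is $C>0$ such that the same estimates hold. $\mathcal{B}^{\{\mathfrak{M}\}}_{L^p}(\mathbb{R}^n)$ (resp. $\mathcal{B}^{(\mathfrak{M})}_{L^p}(\mathbb{R}^n)$): all $f\in C^\infty(\mathbb{R}^n)$ such that there exist $M\in\mathfrak{M}$ and $C,\rho>0$ (resp. for all $M\in\mathfrak{M}$ and $\rho>0$ there is $C>0$) with $\|\partial^\alpha f\|_{L^p(\mathbb{R}^n)}\le C(\rho m_{|\alpha|})^{|\alpha|}$ for all $\alpha \in \mathbb{N}^n$. $\mathcal{D}^{[\mathfrak{M}]}(\mathbb{R}^n):=\mathcal{B}^{[\mathfrak{M}]}_{L^\infty}(\mathbb{R}^n)\cap C_c^\infty(\mathbb{R}^n)$. $\mathcal{E}^{[\mathfrak{M}]}_{L^p,(k_j)}(U)$, $\mathcal{B}^{[\mathfrak{M}]}_{L^p,(k_j)}(\mathbb{R}^n)$, $\mathcal{D}^{[\mathfrak{M}]}_{(k_j)}(\mathbb{R}^n)$: the sets of $C^\infty$ functions (with compact support for $\mathcal{D}$) satisfying the respective defining estimates only for multiindices with $|\alpha|\in\{k_j: j\ge 0\}$. $\mathcal{S}^{\{\mathfrak{M}\}}(\mathbb{R}^n)$ (resp. $\mathcal{S}^{(\mathfrak{M})}(\mathbb{R}^n)$): all $f\in C^\infty(\mathbb{R}^n)$ such that there exist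 $M\in\mathfrak{M}$ and $\rho,\sigma>0$ such that (resp. for all $M\in\mathfrak{M}$ and $\rho,\sigma>0$) $$\sup_{\alpha,\beta\in\mathbb{N}^n}\sup_{x\in\mathbb{R}^n}\frac{|x^\alpha\partial^\beta f(x)|}{(\rho m_{|\alpha|})^{|\alpha|}(\sigma m_{|\beta|})^{|\beta|}}<\infty.$$ $\mathcal{S}^{\{\mathfrak{M}\}}_{(k_j),(\ell_j)}(\mathbb{R}^n)$ (resp. $\mathcal{S}^{(\mathfrak{M})}_{(k_j),(\ell_j)}(\mathbb{R}^n)$): all $f\in C^\infty(\mathbb{R}^n)$ such that there exist $M\in\mathfrak{M}$ and $C,\rho,\sigma>0$ (resp. for all $M\in\mathfrak{M}$ and $\rho,\sigma>0$ there is $C>0$) such that for all $j\ge 0$: $\max_{|\alpha|=k_j}\sup_x|x^\alpha f(x)|\le C(\rho m_{k_j})^{k_j}$ and $\max_{|\beta|=\ell_j}\sup_x|\partial^\beta f(x)|\le C(\sigma m_{\ell_j})^{\ell_j}$.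
   Formalization: In (d) the growth condition assumed for (k_j) is also assumed for (ℓ_j); without it (d) fails, e.g. for the single weight M_j=(j!)^2, k_j=j and very rapidly growing ℓ_j in the Roumieu case. *)

theory Defs
  imports "HOL-Probability.Essential_Supremum"
begin

section \<open>Partial derivatives and smooth functions\<close>

text \<open>Functions on an open set \<open>U\<close> are total functions considered on \<open>U\<close> only; all notions below
  evaluated on an open set \<open>U\<close> depend only on the values on \<open>U\<close>.\<close>

definition partial_deriv :: "'n::finite \<Rightarrow> (real^'n \<Rightarrow> complex) \<Rightarrow> real^'n \<Rightarrow> complex" where
  "partial_deriv i f x = vector_derivative (\<lambda>t. f (x + t *\<^sub>R axis i 1)) (at 0)"

fun Ck_on :: "nat \<Rightarrow> (real^'n::finite) set \<Rightarrow> (real^'n \<Rightarrow> complex) \<Rightarrow> bool" where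
  "Ck_on 0 U f \<longleftrightarrow> continuous_on U f"
| "Ck_on (Suc r) U f \<longleftrightarrow> f differentiable_on U \<and> (\<forall>i. Ck_on r U (partial_deriv i f))"

definition smooth_on :: "(real^'n::finite) set \<Rightarrow> (real^'n \<Rightarrow> complex) \<Rightarrow> bool" where
  "smooth_on U f \<longleftrightarrow> (\<forall>r. Ck_on r U f)"

definition mi_order :: "('n::finite \<Rightarrow> nat) \<Rightarrow> nat" where
  "mi_order \<alpha> = (\<Sum>i\<in>UNIV. \<alpha> i)"

definition monomial :: "('n::finite \<Rightarrow> nat) \<Rightarrow> real^'n \<Rightarrow> real" where
  "monomial \<alpha> x = (\<Prod>i\<in>UNIV. (x $ i) ^ \<alpha> i)"

text \<open>The index type carries no order, so a fixed enumeration of the coordinates determines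
  the order in which the derivatives are taken; for smooth functions it does not matter.\<close>

definition coord_list :: "'n::finite list" where
  "coord_list = (SOME is. distinct is \<and> set is = UNIV)"

definition mderiv :: "('n::finite \<Rightarrow> nat) \<Rightarrow> (real^'n \<Rightarrow> complex) \<Rightarrow> real^'n \<Rightarrow> complex" where
  "mderiv \<alpha> f = foldr (\<lambda>i g. (partial_deriv i ^^ \<alpha> i) g) coord_list f"

definition Lp_norm :: "ennreal \<Rightarrow> (real^'n::finite) set \<Rightarrow> (real^'n \<Rightarrow> complex) \<Rightarrow> ennreal" where
  "Lp_norm p \<Omega> g =
    (if p = \<infinity> then esssup (restrict_space lborel \<Omega>) (\<lambda>x. ennreal (norm (g x)))
     else let I = (\<integral>\<^sup>+x\<in>\<Omega>. ennreal (norm (g x) powr enn2real p) \<partial>lborel)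
          in if I = \<infinity> then \<infinity> else ennreal (enn2real I powr (1 / enn2real p)))"


section \<open>Base sequences and weight sequences\<close>

definition base_seq :: "(nat \<Rightarrow> nat) \<Rightarrow> bool" where
  "base_seq k \<longleftrightarrow> k 0 = 0 \<and> strict_mono k"

definition special :: "(nat \<Rightarrow> nat) \<Rightarrow> bool" where
  "special k \<longleftrightarrow> (\<exists>B. \<forall>j\<ge>1. real (k (Suc j)) / real (k j) \<le> B)"

definition weight_seq :: "(nat \<Rightarrow> real) \<Rightarrow> bool" where
  "weight_seq M \<longleftrightarrow> (\<forall>j. M j > 0) \<and> M 0 = 1 \<and> 1 \<le> M 1 \<and>
     (\<forall>j\<ge>1. M j / M (j - 1) \<le> M (Suc j) / M j)"

text \<open>The sequence \<open>m\<close> associated with \<open>M\<close>. The case distinction is needed since \<open>root 0 x = 0\<close>.\<close>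

definition mseq :: "(nat \<Rightarrow> real) \<Rightarrow> nat \<Rightarrow> real" where
  "mseq M j = (if j = 0 then 1 else root j (M j))"

definition totally_ordered :: "(nat \<Rightarrow> real) set \<Rightarrow> bool" where
  "totally_ordered \<MM> \<longleftrightarrow> (\<forall>M\<in>\<MM>. \<forall>M'\<in>\<MM>. (\<forall>j. M j \<le> M' j) \<or> (\<forall>j. M' j \<le> M j))"

datatype utype = Roumieu | Beurling

fun moderate_growth :: "utype \<Rightarrow> (nat \<Rightarrow> real) set \<Rightarrow> bool" where
  "moderate_growth Roumieu \<MM> \<longleftrightarrow>
     (\<forall>M\<in>\<MM>. \<exists>M'\<in>\<MM>. \<exists>C>0. \<forall>j k. M (j + k) \<le> C ^ (j + k) * M' j * M' k)"
| "moderate_growth Beurling \<MM> \<longleftrightarrow>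
     (\<forall>M\<in>\<MM>. \<exists>M'\<in>\<MM>. \<exists>C>0. \<forall>j k. M' (j + k) \<le> C ^ (j + k) * M j * M k)"

text \<open>For the spaces \<open>S\<close> with two base sequences this is needed for both of them: the derivatives
  are only controlled along the second sequence. With \<open>M j = (fact j)^2\<close>, \<open>k j = j\<close> and a second
  sequence growing fast enough, the lacunary class contains compactly supported functions that
  violate the Gevrey bounds.\<close>

fun gap_condition :: "utype \<Rightarrow> (nat \<Rightarrow> real) set \<Rightarrow> (nat \<Rightarrow> nat) \<Rightarrow> bool" where
  "gap_condition Roumieu \<MM> k \<longleftrightarrow>
     (\<forall>M\<in>\<MM>. \<exists>M'\<in>\<MM>. \<exists>B. \<forall>j. mseq M (k (Suc j)) / mseq M' (k j) \<le> B)"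
| "gap_condition Beurling \<MM> k \<longleftrightarrow>
     (\<forall>M\<in>\<MM>. \<exists>M'\<in>\<MM>. \<exists>B. \<forall>j. mseq M' (k (Suc j)) / mseq M (k j) \<le> B)"

fun factorial_condition :: "utype \<Rightarrow> (nat \<Rightarrow> real) set \<Rightarrow> bool" where
  "factorial_condition Roumieu \<MM> \<longleftrightarrow> (\<forall>M\<in>\<MM>. \<exists>B. \<forall>j. real j / mseq M j \<le> B)"
| "factorial_condition Beurling \<MM> \<longleftrightarrow> (\<forall>M\<in>\<MM>. (\<lambda>j. real j / mseq M j) \<longlonglongrightarrow> 0)"


section \<open>Function classes\<close>

text \<open>The argument \<open>K\<close> is the set of orders for which the derivative estimates are imposed:
  \<open>K = UNIV\<close> gives the usual classes and \<open>K = range k\<close> the classes attached to a base sequence \<open>k\<close>.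
  An estimate for the maximum over all multiindices of a given order is written as an estimate
  for each of them.\<close>

definition Lp_estimate ::
  "ennreal \<Rightarrow> nat set \<Rightarrow> (real^'n::finite) set \<Rightarrow> (real^'n \<Rightarrow> complex) \<Rightarrow>
   (nat \<Rightarrow> real) \<Rightarrow> real \<Rightarrow> real \<Rightarrow> bool" where
  "Lp_estimate p K \<Omega> f M C \<rho> \<longleftrightarrow>
     (\<forall>\<alpha>. mi_order \<alpha> \<in> K \<longrightarrow>
        Lp_norm p \<Omega> (mderiv \<alpha> f) \<le> ennreal (C * (\<rho> * mseq M (mi_order \<alpha>)) ^ mi_order \<alpha>))"

fun class_E ::
  "utype \<Rightarrow> (nat \<Rightarrow> real) set \<Rightarrow> ennreal \<Rightarrow> nat set \<Rightarrow> (real^'n::finite) set \<Rightarrow>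
   (real^'n \<Rightarrow> complex) set" where
  "class_E Roumieu \<MM> p K U = {f. smooth_on U f \<and>
     (\<forall>\<Omega>. open \<Omega> \<and> compact (closure \<Omega>) \<and> closure \<Omega> \<subseteq> U \<longrightarrow>
        (\<exists>M\<in>\<MM>. \<exists>C>0. \<exists>\<rho>>0. Lp_estimate p K \<Omega> f M C \<rho>))}"
| "class_E Beurling \<MM> p K U = {f. smooth_on U f \<and>
     (\<forall>\<Omega>. open \<Omega> \<and> compact (closure \<Omega>) \<and> closure \<Omega> \<subseteq> U \<longrightarrow>
        (\<forall>M\<in>\<MM>. \<forall>\<rho>>0. \<exists>C>0. Lp_estimate p K \<Omega> f M C \<rho>))}"

fun class_B ::
  "utype \<Rightarrow> (nat \<Rightarrow> real) set \<Rightarrow> ennreal \<Rightarrow> nat set \<Rightarrow> (real^'n::finite \<Rightarrow> complex) set" where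
  "class_B Roumieu \<MM> p K = {f. smooth_on UNIV f \<and>
     (\<exists>M\<in>\<MM>. \<exists>C>0. \<exists>\<rho>>0. Lp_estimate p K UNIV f M C \<rho>)}"
| "class_B Beurling \<MM> p K = {f. smooth_on UNIV f \<and>
     (\<forall>M\<in>\<MM>. \<forall>\<rho>>0. \<exists>C>0. Lp_estimate p K UNIV f M C \<rho>)}"

definition class_D ::
  "utype \<Rightarrow> (nat \<Rightarrow> real) set \<Rightarrow> nat set \<Rightarrow> (real^'n::finite \<Rightarrow> complex) set" where
  "class_D \<tau> \<MM> K = class_B \<tau> \<MM> \<infinity> K \<inter> {f. smooth_on UNIV f \<and> compact (closure {x. f x \<noteq> 0})}"

definition S_estimate ::
  "(real^'n::finite \<Rightarrow> complex) \<Rightarrow> (nat \<Rightarrow> real) \<Rightarrow> real \<Rightarrow> real \<Rightarrow> real \<Rightarrow> bool" where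
  "S_estimate f M C \<rho> \<sigma> \<longleftrightarrow>
     (\<forall>\<alpha> \<beta> x. \<bar>monomial \<alpha> x\<bar> * norm (mderiv \<beta> f x) /
        ((\<rho> * mseq M (mi_order \<alpha>)) ^ mi_order \<alpha> * (\<sigma> * mseq M (mi_order \<beta>)) ^ mi_order \<beta>) \<le> C)"

fun class_S :: "utype \<Rightarrow> (nat \<Rightarrow> real) set \<Rightarrow> (real^'n::finite \<Rightarrow> complex) set" where
  "class_S Roumieu \<MM> = {f. smooth_on UNIV f \<and>
     (\<exists>M\<in>\<MM>. \<exists>\<rho>>0. \<exists>\<sigma>>0. \<exists>C. S_estimate f M C \<rho> \<sigma>)}"
| "class_S Beurling \<MM> = {f. smooth_on UNIV f \<and>
     (\<forall>M\<in>\<MM>. \<forall>\<rho>>0. \<forall>\<sigma>>0. \<exists>C. S_estimate f M C \<rho> \<sigma>)}"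

definition S_lac_estimate ::
  "(nat \<Rightarrow> nat) \<Rightarrow> (nat \<Rightarrow> nat) \<Rightarrow> (real^'n::finite \<Rightarrow> complex) \<Rightarrow>
   (nat \<Rightarrow> real) \<Rightarrow> real \<Rightarrow> real \<Rightarrow> real \<Rightarrow> bool" where
  "S_lac_estimate k l f M C \<rho> \<sigma> \<longleftrightarrow>
     (\<forall>j. (\<forall>\<alpha> x. mi_order \<alpha> = k j \<longrightarrow> \<bar>monomial \<alpha> x\<bar> * norm (f x) \<le> C * (\<rho> * mseq M (k j)) ^ k j) \<and>
          (\<forall>\<beta> x. mi_order \<beta> = l j \<longrightarrow> norm (mderiv \<beta> f x) \<le> C * (\<sigma> * mseq M (l j)) ^ l j))"

fun class_S_lac ::
  "utype \<Rightarrow> (nat \<Rightarrow> real) set \<Rightarrow> (nat \<Rightarrow> nat) \<Rightarrow> (nat \<Rightarrow> nat) \<Rightarrow>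
   (real^'n::finite \<Rightarrow> complex) set" where
  "class_S_lac Roumieu \<MM> k l = {f. smooth_on UNIV f \<and>
     (\<exists>M\<in>\<MM>. \<exists>C>0. \<exists>\<rho>>0. \<exists>\<sigma>>0. S_lac_estimate k l f M C \<rho> \<sigma>)}"
| "class_S_lac Beurling \<MM> k l = {f. smooth_on UNIV f \<and>
     (\<forall>M\<in>\<MM>. \<forall>\<rho>>0. \<forall>\<sigma>>0. \<exists>C>0. S_lac_estimate k l f M C \<rho> \<sigma>)}"

end

theory Submission
  imports Defs "HOL-Computational_Algebra.Polynomial"
begin

text \<open>
  Each lacunary class is contained in the full one because the norm of a derivative of intermediate
  order is controlled by the norms of the derivatives of the two neighbouring orders
  \<open>a = k j\<close> and \<open>b = k (j + 1)\<close>. Suppose the derivatives of these two orders are bounded by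
  \<open>C T^a\<close> and \<open>C T^b\<close> where \<open>T = \<rho> m_b\<close>. An inequality
  \<open>t^s |D^s g| \<le> K (|g| + t^r |D^r g|)\<close> with \<open>r = b - a\<close>, used for a derivative \<open>g\<close> of order \<open>a\<close> and
  with step \<open>t = 1 / T\<close>, bounds the derivatives of order \<open>a + s\<close> by \<open>2 C K T^(a+s)\<close>. The gap condition
  replaces \<open>T\<close> by a multiple of \<open>\<rho> m'_a\<close>, and \<open>m'_a \<le> m'_(a+s)\<close>. Everything depends on the size of
  \<open>K\<close>, which must be at most exponential in the order \<open>a + s\<close>, because such a factor can be moved
  into \<open>\<rho>\<close>.

  On the whole space \<open>r\<close> may be much larger than \<open>a + s\<close>, so \<open>K\<close> has to be independent of \<open>r\<close>;
  iterating the case \<open>r = 2\<close> loses a factor of order \<open>2^(s(r-s))\<close>. The first derivative is therefore compared with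
  the expansion \<open>t D = arcsinh (sinh (t D))\<close>. Here \<open>sinh (t D)\<close> is the central difference operator, which has
  norm at most 1, and the arcsinh series converges absolutely at 1. A truncated series is thus a
  difference operator with norm bounded independently of its length, and differentiating the
  truncation error twice in \<open>t\<close> makes all but one of its terms cancel
  (\<open>asinh_second_derivative_telescope\<close>). This gives \<open>N_deriv_le\<close>, and repeating it along a word of
  directions gives \<open>Landau_Kolmogorov_words\<close> with \<open>K = 6^s\<close>.

  On a bounded set the shifted points must not leave a slightly larger set, which restricts the step to
  \<open>t \<le> const / r\<close>. The factorial condition makes \<open>t = 1 / T\<close> admissible for all but finitely many orders.
  For a special base sequence \<open>r\<close> is bounded by a multiple of the order, so now \<open>K\<close> may be exponential in \<open>r\<close>,
  and differentiating the Lagrange interpolation of a Taylor polynomial suffices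
  (\<open>local_intermediate_derivative_le\<close>).

  For the rapidly decreasing functions the two lacunary families of estimates are first completed separately.
  The mixed estimates then follow from the local inequality at a single point \<open>x\<close> with
  \<open>s = |\<beta>|\<close> and \<open>r = 2 s\<close>: it bounds \<open>|D^\<beta> f x|\<close> by a geometric mean of the supremum of \<open>|f|\<close> near \<open>x\<close>, which
  carries the decay \<open>|x|^(-2a)\<close>, and of the derivatives of order \<open>2 s\<close> (\<open>mixed_decay_estimate\<close>).
  Moderate growth turns the weights of orders \<open>2 a\<close> and \<open>2 s\<close> into those of orders \<open>a\<close> and \<open>s\<close>.

  Both inequalities use the norm only through subadditivity, homogeneity and lower semicontinuity
  under pointwise limits, the global one also through translation invariance. They are proved for any
  such functional (locales \<open>fn_norm\<close> and \<open>translation_norm\<close>); the first locale is instantiated with \<open>L^p\<close> norms and with the evaluation at a point.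
\<close>

section \<open>Norms compatible with pointwise limits\<close>

lemma vector_derivative_increment_bound:
  fixes \<phi> :: "real \<Rightarrow> 'a::real_normed_vector"
  assumes "a \<le> b"
    and "\<And>\<tau>. a \<le> \<tau> \<Longrightarrow> \<tau> \<le> b \<Longrightarrow> (\<phi> has_vector_derivative \<phi>' \<tau>) (at \<tau> within {a..b})"
    and "\<And>\<tau>. a \<le> \<tau> \<Longrightarrow> \<tau> \<le> b \<Longrightarrow> norm (\<phi>' \<tau> - c) \<le> \<epsilon>"
  shows "norm (\<phi> b - \<phi> a - (b - a) *\<^sub>R c) \<le> \<epsilon> * (b - a)"
proof -
  have d: "((\<lambda>s. \<phi> s - s *\<^sub>R c) has_vector_derivative (\<phi>' \<tau> - c)) (at \<tau> within {a..b})"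
    if "\<tau> \<in> {a..b}" for \<tau>
    using assms(2)[of \<tau>] that by (auto intro!: derivative_eq_intros)
  have on: "onorm (\<lambda>x. x *\<^sub>R (\<phi>' \<tau> - c)) \<le> \<epsilon>" if "\<tau> \<in> {a..b}" for \<tau>
    by (rule onorm_le) (use assms(3)[of \<tau>] that in \<open>auto simp: mult.commute[of \<epsilon>] intro!: mult_left_mono\<close>)
  have "norm ((\<phi> b - b *\<^sub>R c) - (\<phi> a - a *\<^sub>R c)) \<le> \<epsilon> * norm (b - a)"
    by (rule differentiable_bound[where S = "{a..b}" and f' = "\<lambda>\<tau> x. x *\<^sub>R (\<phi>' \<tau> - c)"])
      (use d on assms(1) in \<open>auto simp: has_vector_derivative_def\<close>)
  then show ?thesis using assms(1) by (simp add: algebra_simps)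
qed

lemma Riemann_sum_tendsto:
  fixes \<phi> :: "real \<Rightarrow> 'a::real_normed_vector" and t :: real
  assumes t: "0 \<le> t"
    and der: "\<And>\<tau>. 0 \<le> \<tau> \<Longrightarrow> \<tau> \<le> t \<Longrightarrow> (\<phi> has_vector_derivative \<gamma> \<tau>) (at \<tau> within {0..t})"
    and cont: "continuous_on {0..t} \<gamma>"
  shows "(\<lambda>n. \<Sum>i<Suc n. (t / Suc n) *\<^sub>R \<gamma> (t * i / Suc n)) \<longlonglongrightarrow> \<phi> t - \<phi> 0"
proof (rule LIMSEQ_I)
  fix e :: real assume e: "0 < e"
  define \<epsilon> where "\<epsilon> = e / (2 * (t + 1))"
  have \<epsilon>: "\<epsilon> > 0" "\<epsilon> * t < e" using e t by (auto simp: \<epsilon>_def field_simps intro: add_nonneg_pos)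
  have "uniformly_continuous_on {0..t} \<gamma>"
    using cont compact_uniformly_continuous by blast
  then obtain \<delta> where \<delta>: "\<delta> > 0"
    "\<And>s s'. s \<in> {0..t} \<Longrightarrow> s' \<in> {0..t} \<Longrightarrow> dist s' s < \<delta> \<Longrightarrow> dist (\<gamma> s') (\<gamma> s) < \<epsilon>"
    using \<epsilon>(1) unfolding uniformly_continuous_on_def by metis
  obtain n0 where n0: "t / \<delta> < real n0" using reals_Archimedean2 by blast
  show "\<exists>n0. \<forall>n\<ge>n0. norm ((\<Sum>i<Suc n. (t / Suc n) *\<^sub>R \<gamma> (t * i / Suc n)) - (\<phi> t - \<phi> 0)) < e"
  proof (intro exI allI impI)
    fix n assume n: "n0 \<le> n"
    define p where "p i = t * real i / Suc n" for i
    have step: "p (Suc i) - p i = t / Suc n" for i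
    proof -
      have "t * real (Suc i) - t * real i = t" by (simp add: algebra_simps)
      then show ?thesis by (simp only: p_def diff_divide_distrib[symmetric])
    qed
    have small: "t / Suc n < \<delta>"
      using n0 n \<delta>(1) by (simp add: field_simps) (smt (verit) mult_left_mono of_nat_mono of_nat_Suc)
    have bd: "norm (\<phi> (p (Suc i)) - \<phi> (p i) - (t / Suc n) *\<^sub>R \<gamma> (p i)) \<le> \<epsilon> * (t / Suc n)"
      if i: "i < Suc n" for i
    proof -
      have p0: "0 \<le> p i" using t by (simp add: p_def)
      have pt: "p (Suc i) \<le> t" using t i mult_left_mono[of "Suc i" "Suc n" t]
        by (simp add: p_def field_simps)
      have le: "p i \<le> p (Suc i)" using step[of i] t by (smt (verit) divide_nonneg_nonneg of_nat_0_le_iff)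
      have "norm (\<phi> (p (Suc i)) - \<phi> (p i) - (p (Suc i) - p i) *\<^sub>R \<gamma> (p i)) \<le> \<epsilon> * (p (Suc i) - p i)"
      proof (rule vector_derivative_increment_bound[OF le])
        fix \<tau> assume \<tau>: "p i \<le> \<tau>" "\<tau> \<le> p (Suc i)"
        show "(\<phi> has_vector_derivative \<gamma> \<tau>) (at \<tau> within {p i..p (Suc i)})"
          using der[of \<tau>] p0 pt \<tau> by (auto intro: has_vector_derivative_within_subset)
        have "dist \<tau> (p i) < \<delta>" using \<tau> step[of i] small by (simp add: dist_real_def)
        then show "norm (\<gamma> \<tau> - \<gamma> (p i)) \<le> \<epsilon>"
          using \<delta>(2)[of "p i" \<tau>] \<tau> p0 pt by (simp add: dist_norm)
      qed
      then show ?thesis by (simp only: step)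
    qed
    have tel: "\<phi> t - \<phi> 0 = (\<Sum>i<Suc n. \<phi> (p (Suc i)) - \<phi> (p i))"
      unfolding sum_lessThan_telescope[of "\<lambda>i. \<phi> (p i)"] by (simp add: p_def)
    have "norm ((\<Sum>i<Suc n. (t / Suc n) *\<^sub>R \<gamma> (p i)) - (\<phi> t - \<phi> 0))
        = norm (\<Sum>i<Suc n. \<phi> (p (Suc i)) - \<phi> (p i) - (t / Suc n) *\<^sub>R \<gamma> (p i))"
      unfolding tel sum_subtractf[symmetric]
      by (subst norm_minus_cancel[symmetric]) (simp only: sum_negf[symmetric] minus_diff_eq)
    also have "\<dots> \<le> (\<Sum>i<Suc n. \<epsilon> * (t / Suc n))"
      by (rule sum_norm_le) (use bd in auto)
    also have "\<dots> = \<epsilon> * t" by simp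
    also have "\<dots> < e" by fact
    finally show "norm ((\<Sum>i<Suc n. (t / Suc n) *\<^sub>R \<gamma> (t * i / Suc n)) - (\<phi> t - \<phi> 0)) < e"
      by (simp only: p_def)
  qed
qed

text \<open>
  The limit axiom replaces Fatou's lemma. It makes a mean value inequality available for every such
  functional, since an integral is a pointwise limit of Riemann sums. Values may be infinite, so a bound on the outer orders yields the finiteness of
  the norms of intermediate order as part of the conclusion.
\<close>

locale fn_norm =
  fixes N :: "('a::topological_space \<Rightarrow> complex) \<Rightarrow> ennreal" and \<Omega> :: "'a set"
  assumes N_add: "continuous_on \<Omega> f \<Longrightarrow> continuous_on \<Omega> g \<Longrightarrow> N (\<lambda>x. f x + g x) \<le> N f + N g"
    and N_scale: "continuous_on \<Omega> f \<Longrightarrow> N (\<lambda>x. c *\<^sub>R f x) \<le> ennreal \<bar>c\<bar> * N f"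
    and N_limit: "(\<And>n. continuous_on \<Omega> (F n)) \<Longrightarrow> continuous_on \<Omega> g \<Longrightarrow>
      (\<And>x. x \<in> \<Omega> \<Longrightarrow> (\<lambda>n::nat. F n x) \<longlonglongrightarrow> g x) \<Longrightarrow> (\<And>n. N (F n) \<le> A) \<Longrightarrow> N g \<le> A"
begin

lemma N_cong:
  assumes "continuous_on \<Omega> f" "\<And>x. x \<in> \<Omega> \<Longrightarrow> f x = g x"
  shows "N f = N g"
proof -
  have g: "continuous_on \<Omega> g" using assms continuous_on_cong by metis
  have "N f \<le> N g" by (rule N_limit[of "\<lambda>_. g"]) (use assms g in auto)
  moreover have "N g \<le> N f" by (rule N_limit[of "\<lambda>_. f"]) (use assms g in auto)
  ultimately show ?thesis by simp
qed

lemma N_zero: "N (\<lambda>x. 0) = 0"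
  using N_scale[of "\<lambda>x. 0" 0] by simp

lemma N_scale_le:
  assumes "continuous_on \<Omega> f" "N f \<le> ennreal A" "0 \<le> A" "\<bar>c\<bar> * A \<le> B"
  shows "N (\<lambda>x. c *\<^sub>R f x) \<le> ennreal B"
proof -
  have "N (\<lambda>x. c *\<^sub>R f x) \<le> ennreal \<bar>c\<bar> * N f" by (rule N_scale[OF assms(1)])
  also have "\<dots> \<le> ennreal \<bar>c\<bar> * ennreal A" by (rule mult_left_mono) (use assms in auto)
  also have "\<dots> = ennreal (\<bar>c\<bar> * A)" using assms by (simp add: ennreal_mult)
  also have "\<dots> \<le> ennreal B" using assms by (simp add: ennreal_leI)
  finally show ?thesis .
qed

lemma N_add_le:
  assumes "continuous_on \<Omega> f" "continuous_on \<Omega> g" "N f \<le> ennreal A" "N g \<le> ennreal B" "0 \<le> A" "0 \<le> B"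
  shows "N (\<lambda>x. f x + g x) \<le> ennreal (A + B)"
proof -
  have "N (\<lambda>x. f x + g x) \<le> N f + N g" by (rule N_add) (use assms in auto)
  also have "\<dots> \<le> ennreal A + ennreal B" by (rule add_mono) (use assms in auto)
  finally show ?thesis using assms by simp
qed

lemma N_diff_le:
  assumes "continuous_on \<Omega> f" "continuous_on \<Omega> g" "N f \<le> ennreal A" "N g \<le> ennreal B" "0 \<le> A" "0 \<le> B"
  shows "N (\<lambda>x. f x - g x) \<le> ennreal (A + B)"
proof -
  have "N (\<lambda>x. f x + (-1) *\<^sub>R g x) \<le> ennreal (A + B)"
  proof (rule N_add_le)
    show "N (\<lambda>x. (-1) *\<^sub>R g x) \<le> ennreal B"
      by (rule N_scale_le[where A = B]) (use assms in auto)
  qed (use assms in \<open>auto intro!: continuous_intros\<close>)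
  then show ?thesis by simp
qed

lemma N_sum_le:
  assumes "finite I" "\<And>i. i \<in> I \<Longrightarrow> continuous_on \<Omega> (f i)"
    "\<And>i. i \<in> I \<Longrightarrow> N (f i) \<le> ennreal (A i)" "\<And>i. i \<in> I \<Longrightarrow> 0 \<le> A i"
  shows "N (\<lambda>x. \<Sum>i\<in>I. c i *\<^sub>R f i x) \<le> ennreal (\<Sum>i\<in>I. \<bar>c i\<bar> * A i)"
  using assms
proof (induction I rule: finite_induct)
  case empty then show ?case by (simp add: N_zero)
next
  case (insert i I)
  have "N (\<lambda>x. c i *\<^sub>R f i x + (\<Sum>i\<in>I. c i *\<^sub>R f i x)) \<le> ennreal (\<bar>c i\<bar> * A i + (\<Sum>i\<in>I. \<bar>c i\<bar> * A i))"
    by (rule N_add_le)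
      (use insert in \<open>auto intro!: continuous_intros N_scale_le[where A = "A i"] sum_nonneg\<close>)
  then show ?case using insert by simp
qed

text \<open>
  The role of Minkowski's integral inequality: the increment is a limit of Riemann sums of \<open>G\<close>,
  each of norm at most \<open>t B\<close>.
\<close>

lemma N_mean_value:
  assumes t: "0 \<le> t" and B: "0 \<le> B"
    and der: "\<And>x \<tau>. x \<in> \<Omega> \<Longrightarrow> 0 \<le> \<tau> \<Longrightarrow> \<tau> \<le> t \<Longrightarrow>
       ((\<lambda>s. F s x) has_vector_derivative G \<tau> x) (at \<tau> within {0..t})"
    and contG: "\<And>x. x \<in> \<Omega> \<Longrightarrow> continuous_on {0..t} (\<lambda>\<tau>. G \<tau> x)"
    and cF: "continuous_on \<Omega> (F 0)" "continuous_on \<Omega> (F t)"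
    and cG: "\<And>\<tau>. 0 \<le> \<tau> \<Longrightarrow> \<tau> \<le> t \<Longrightarrow> continuous_on \<Omega> (G \<tau>)"
    and bd: "\<And>\<tau>. 0 \<le> \<tau> \<Longrightarrow> \<tau> \<le> t \<Longrightarrow> N (G \<tau>) \<le> ennreal B"
  shows "N (\<lambda>x. F t x - F 0 x) \<le> ennreal (t * B)"
proof (rule N_limit)
  have rng: "0 \<le> t * real i / Suc n" "t * real i / Suc n \<le> t" if "i < Suc n" for i n
    using t that mult_left_mono[of i "Suc n" t] by (auto simp: field_simps)
  define R where "R n x = (\<Sum>i<Suc n. (t / Suc n) *\<^sub>R G (t * i / Suc n) x)" for n x
  show "continuous_on \<Omega> (R n)" for n
    unfolding R_def using rng by (auto intro!: continuous_intros cG)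
  show "continuous_on \<Omega> (\<lambda>x. F t x - F 0 x)"
    using cF by (intro continuous_intros)
  show "(\<lambda>n. R n x) \<longlonglongrightarrow> F t x - F 0 x" if "x \<in> \<Omega>" for x
    unfolding R_def
    by (rule Riemann_sum_tendsto[where \<phi> = "\<lambda>s. F s x" and \<gamma> = "\<lambda>s. G s x"])
      (use that t der contG in auto)
  show "N (R n) \<le> ennreal (t * B)" for n
  proof -
    have "N (R n) \<le> ennreal (\<Sum>i<Suc n. \<bar>t / Suc n\<bar> * B)"
      unfolding R_def by (rule N_sum_le) (use rng cG bd B in auto)
    also have "(\<Sum>i<Suc n. \<bar>t / Suc n\<bar> * B) = t * B" using t by simp
    finally show ?thesis .
  qed
qed

end

section \<open>The norms of Lebesgue spaces\<close>

text \<open>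
  For continuous functions on an open set the essential supremum is a supremum, because a point of
  violation has a whole neighbourhood of such points, which has positive measure.
\<close>

lemma AE_le_on_open_imp_le:
  fixes g :: "'a::euclidean_space \<Rightarrow> real"
  assumes "open \<Omega>" "continuous_on \<Omega> g" "AE x in lborel. x \<in> \<Omega> \<longrightarrow> g x \<le> A" "x \<in> \<Omega>"
  shows "g x \<le> A"
proof (rule ccontr)
  assume "\<not> g x \<le> A"
  define W where "W = \<Omega> \<inter> g -` {A<..}"
  have W: "open W" unfolding W_def using assms(1,2)
    by (metis continuous_on_open_vimage open_greaterThan inf_commute)
  have "AE y in lborel. y \<notin> W" using assms(3) by eventually_elim (auto simp: W_def)
  then have "W \<in> null_sets lborel" using W by (subst AE_iff_null_sets) auto
  then have "negligible W"
    by (simp add: negligible_iff_null_sets null_sets_completionI)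
  moreover have "x \<in> W" using assms(4) \<open>\<not> g x \<le> A\<close> by (auto simp: W_def)
  ultimately show False using W open_not_negligible by auto
qed

lemma Lp_norm_infinity_le_iff:
  fixes g :: "real^'n::finite \<Rightarrow> complex"
  assumes "open \<Omega>" "continuous_on \<Omega> g"
  shows "Lp_norm \<infinity> \<Omega> g \<le> A \<longleftrightarrow> (\<forall>x\<in>\<Omega>. ennreal (norm (g x)) \<le> A)"
proof -
  let ?M = "restrict_space lborel \<Omega>"
  have \<Omega>: "\<Omega> \<in> sets lborel" using assms(1) by simp
  have meas: "(\<lambda>x. ennreal (norm (g x))) \<in> borel_measurable ?M"
  proof -
    have "g \<in> borel_measurable (restrict_space borel \<Omega>)"
      by (rule borel_measurable_continuous_on_restrict[OF assms(2)])
    then have "g \<in> borel_measurable ?M"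
      by (subst measurable_cong_sets[OF sets_restrict_space_cong[OF sets_lborel] refl])
    then show ?thesis by measurable
  qed
  show ?thesis
  proof
    assume le: "Lp_norm \<infinity> \<Omega> g \<le> A"
    show "\<forall>x\<in>\<Omega>. ennreal (norm (g x)) \<le> A"
    proof (cases A)
      case (real a)
      have "AE x in ?M. ennreal (norm (g x)) \<le> A"
        using esssup_AE[of "\<lambda>x. ennreal (norm (g x))" ?M] le by (auto simp: Lp_norm_def elim: eventually_mono)
      then have "AE x in lborel. x \<in> \<Omega> \<longrightarrow> norm (g x) \<le> a"
        using \<Omega> real by (simp add: AE_restrict_space_iff)
      then show ?thesis
        using AE_le_on_open_imp_le[OF assms(1), of "\<lambda>x. norm (g x)" a] assms(2) real
        by (auto intro!: continuous_intros)
    qed auto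
  next
    assume "\<forall>x\<in>\<Omega>. ennreal (norm (g x)) \<le> A"
    then show "Lp_norm \<infinity> \<Omega> g \<le> A"
      unfolding Lp_norm_def using meas
      by (auto intro!: esssup_I AE_I2 simp: space_restrict_space)
  qed
qed

text \<open>
  The \<open>p\<close>-th power of the norm for finite exponents; it takes the value \<open>\<infinity>\<close> exactly when the norm does.
\<close>

definition Lp_integral :: "real \<Rightarrow> (real^'n::finite) set \<Rightarrow> (real^'n \<Rightarrow> complex) \<Rightarrow> ennreal" where
  "Lp_integral q \<Omega> g = (\<integral>\<^sup>+x\<in>\<Omega>. ennreal (norm (g x) powr q) \<partial>lborel)"

lemma Lp_norm_le_iff:
  fixes g :: "real^'n::finite \<Rightarrow> complex"
  assumes "1 \<le> p" "p \<noteq> \<infinity>" "0 \<le> A"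
  shows "Lp_norm p \<Omega> g \<le> ennreal A \<longleftrightarrow> Lp_integral (enn2real p) \<Omega> g \<le> ennreal (A powr enn2real p)"
proof -
  have q: "enn2real p > 0" using assms by (cases p) auto
  show ?thesis
  proof (cases "Lp_integral (enn2real p) \<Omega> g")
    case (real i)
    have "i powr (1 / enn2real p) \<le> A \<longleftrightarrow> i \<le> A powr enn2real p"
    proof
      assume "i powr (1 / enn2real p) \<le> A"
      then have "(i powr (1 / enn2real p)) powr enn2real p \<le> A powr enn2real p"
        using q by (intro powr_mono2) auto
      then show "i \<le> A powr enn2real p" using q real by (simp add: powr_powr)
    next
      assume "i \<le> A powr enn2real p"
      then have "i powr (1 / enn2real p) \<le> (A powr enn2real p) powr (1 / enn2real p)"
        using q real by (intro powr_mono2) auto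
      then show "i powr (1 / enn2real p) \<le> A" using q assms by (simp add: powr_powr)
    qed
    then show ?thesis
      using assms real unfolding Lp_norm_def Lp_integral_def[symmetric] by (simp add: ennreal_le_iff)
  next
    case top
    then show ?thesis using assms
      unfolding Lp_norm_def Lp_integral_def[symmetric] by (auto simp: top_unique)
  qed
qed

lemma Lp_integrand_measurable:
  fixes g :: "real^'n::finite \<Rightarrow> complex"
  assumes "open \<Omega>" "continuous_on \<Omega> g" 
  shows "(\<lambda>x. ennreal (norm (g x) powr q) * indicator \<Omega> x) \<in> borel_measurable borel"
proof -
  have "(\<lambda>x. indicator \<Omega> x *\<^sub>R g x) \<in> borel_measurable borel"
    using assms by (intro borel_measurable_continuous_on_indicator) auto
  then have "(\<lambda>x. ennreal (norm (indicator \<Omega> x *\<^sub>R g x) powr q)) \<in> borel_measurable borel"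
    by measurable
  also have "(\<lambda>x. ennreal (norm (indicator \<Omega> x *\<^sub>R g x) powr q)) = (\<lambda>x. ennreal (norm (g x) powr q) * indicator \<Omega> x)"
    by (auto simp: indicator_def)
  finally show ?thesis .
qed

text \<open>
  The boundary of the half-line needs an argument of its own: there the claim reduces to
  \<open>c powr q \<le> c\<close> for \<open>c\<close> in the unit interval.
\<close>

lemma powr_convex_combination:
  fixes u v a b q :: real
  assumes "1 \<le> q" "0 \<le> u" "0 \<le> v" "0 \<le> a" "0 \<le> b" "a + b = 1"
  shows "(a * u + b * v) powr q \<le> a * u powr q + b * v powr q"
proof -
  have small: "(c * w) powr q \<le> c * w powr q" if "0 \<le> c" "c \<le> 1" "0 \<le> w" for c w :: real
  proof -
    have "c powr q \<le> c powr 1" using that assms(1) powr_mono'[of 1 q c] by simp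
    then show ?thesis using that by (simp add: powr_mult mult_right_mono)
  qed
  consider "u = 0" | "v = 0" | "u > 0" "v > 0" using assms by linarith
  then show ?thesis
  proof cases
    case 3
    have a: "a = 1 - b" using assms by simp
    show ?thesis
      using convex_onD[OF powr_convex[OF assms(1)], of b u v] assms 3 unfolding a by simp
  qed (use small assms in auto)
qed

text \<open>
  Minkowski's inequality by convexity of the \<open>q\<close>-th power: \<open>|f + g| / (a + b)\<close> is at most the convex
  combination of \<open>|f| / a\<close> and \<open>|g| / b\<close> with weights \<open>a / (a + b)\<close> and \<open>b / (a + b)\<close>.
\<close>

lemma Lp_norm_add_le:
  fixes f g :: "real^'n::finite \<Rightarrow> complex"
  assumes p: "1 \<le> p" "p \<noteq> \<infinity>" and \<Omega>: "open \<Omega>"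
    and f: "continuous_on \<Omega> f" "Lp_norm p \<Omega> f \<le> ennreal a" "0 < a"
    and g: "continuous_on \<Omega> g" "Lp_norm p \<Omega> g \<le> ennreal b" "0 < b"
  shows "Lp_norm p \<Omega> (\<lambda>x. f x + g x) \<le> ennreal (a + b)"
proof -
  define q where "q = enn2real p"
  have q: "1 \<le> q" using p unfolding q_def by (cases p) auto
  define c where "c = (a + b) powr q * (a / (a + b)) / a powr q"
  define d where "d = (a + b) powr q * (b / (a + b)) / b powr q"
  have cd: "0 \<le> c" "0 \<le> d" using f g by (auto simp: c_def d_def)
  have pt: "norm (f x + g x) powr q \<le> c * norm (f x) powr q + d * norm (g x) powr q" for x
  proof -
    have "norm (f x + g x) powr q \<le> (norm (f x) + norm (g x)) powr q"
      using q by (intro powr_mono2 norm_triangle_ineq) auto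
    also have "norm (f x) + norm (g x)
        = (a + b) * (a / (a + b) * (norm (f x) / a) + b / (a + b) * (norm (g x) / b))"
      (is "_ = (a + b) * (a / (a + b) * ?X + b / (a + b) * ?Y)")
    proof -
      have "(a + b) * (a / (a + b) * ?X + b / (a + b) * ?Y) = a * ?X + b * ?Y"
        using f(3) g(3) by (simp only: distrib_left mult.assoc[symmetric]) simp
      then show ?thesis using f(3) g(3) by simp
    qed
    also have "\<dots> powr q = (a + b) powr q * (a / (a + b) * (norm (f x) / a) + b / (a + b) * (norm (g x) / b)) powr q"
      by (rule powr_mult)
    also have "\<dots> \<le> (a + b) powr q * (a / (a + b) * (norm (f x) / a) powr q + b / (a + b) * (norm (g x) / b) powr q)"
      using f(3) g(3) q
      by (intro mult_left_mono powr_convex_combination) (auto simp: add_divide_distrib[symmetric])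
    also have "\<dots> = c * norm (f x) powr q + d * norm (g x) powr q"
      using f(3) g(3) by (simp add: c_def d_def powr_divide algebra_simps)
    finally show ?thesis .
  qed
  have "Lp_integral q \<Omega> (\<lambda>x. f x + g x)
      \<le> (\<integral>\<^sup>+x. (ennreal c * (ennreal (norm (f x) powr q) * indicator \<Omega> x)
             + ennreal d * (ennreal (norm (g x) powr q) * indicator \<Omega> x)) \<partial>lborel)"
    unfolding Lp_integral_def
    using pt cd
    by (intro nn_integral_mono)
       (auto simp: indicator_def ennreal_mult[symmetric] ennreal_plus[symmetric] simp del: ennreal_plus intro!: ennreal_leI)
  also have "\<dots> = ennreal c * Lp_integral q \<Omega> f + ennreal d * Lp_integral q \<Omega> g"
    unfolding Lp_integral_def
    using Lp_integrand_measurable[OF \<Omega> f(1), of q] Lp_integrand_measurable[OF \<Omega> g(1), of q]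
    by (simp add: nn_integral_add nn_integral_cmult)
  also have "\<dots> \<le> ennreal c * ennreal (a powr q) + ennreal d * ennreal (b powr q)"
    using f g Lp_norm_le_iff[OF p, of a \<Omega> f] Lp_norm_le_iff[OF p, of b \<Omega> g]
    by (intro add_mono mult_left_mono) (auto simp: q_def)
  also have "\<dots> = ennreal (c * a powr q + d * b powr q)"
    using cd by (simp add: ennreal_mult)
  also have "c * a powr q + d * b powr q = (a + b) powr q * (a / (a + b) + b / (a + b))"
    using f(3) g(3) by (simp add: c_def d_def distrib_left)
  also have "a / (a + b) + b / (a + b) = 1"
    using f(3) g(3) by (simp add: add_divide_distrib[symmetric])
  finally show ?thesis
    using Lp_norm_le_iff[OF p, of "a + b" \<Omega>] f g by (auto simp: q_def)
qed

lemma Lp_norm_scale: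
  fixes f :: "real^'n::finite \<Rightarrow> complex"
  assumes p: "1 \<le> p" "p \<noteq> \<infinity>" and \<Omega>: "open \<Omega>" and f: "continuous_on \<Omega> f"
  shows "Lp_norm p \<Omega> (\<lambda>x. c *\<^sub>R f x) \<le> ennreal \<bar>c\<bar> * Lp_norm p \<Omega> f"
proof -
  define q where "q = enn2real p"
  have q: "1 \<le> q" using p unfolding q_def by (cases p) auto
  have I: "Lp_integral q \<Omega> (\<lambda>x. c *\<^sub>R f x) = ennreal (\<bar>c\<bar> powr q) * Lp_integral q \<Omega> f"
    unfolding Lp_integral_def using Lp_integrand_measurable[OF \<Omega> f, of q]
    by (simp add: nn_integral_cmult[symmetric] powr_mult ennreal_mult mult.assoc)
  show ?thesis
  proof (cases "c = 0")
    case True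
    then have "Lp_norm p \<Omega> (\<lambda>x. c *\<^sub>R f x) \<le> ennreal 0"
      using I q Lp_norm_le_iff[OF p, of 0 \<Omega>] by (simp add: q_def)
    then show ?thesis by simp
  next
    case False
    show ?thesis
    proof (cases "Lp_norm p \<Omega> f")
      case (real a)
      have "Lp_integral q \<Omega> f \<le> ennreal (a powr q)"
        using Lp_norm_le_iff[OF p, of a \<Omega> f] real by (simp add: q_def)
      then have "Lp_integral q \<Omega> (\<lambda>x. c *\<^sub>R f x) \<le> ennreal (\<bar>c\<bar> powr q) * ennreal (a powr q)"
        unfolding I by (rule mult_left_mono) simp
      also have "\<dots> = ennreal ((\<bar>c\<bar> * a) powr q)"
        using real by (simp add: powr_mult ennreal_mult)
      finally have "Lp_norm p \<Omega> (\<lambda>x. c *\<^sub>R f x) \<le> ennreal (\<bar>c\<bar> * a)"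
        using Lp_norm_le_iff[OF p, of "\<bar>c\<bar> * a" \<Omega>] real by (simp add: q_def)
      then show ?thesis using real by (simp add: ennreal_mult)
    next
      case top
      then show ?thesis using False by (simp add: ennreal_mult_eq_top_iff)
    qed
  qed
qed

lemma Lp_norm_limit:
  fixes g :: "real^'n::finite \<Rightarrow> complex"
  assumes p: "1 \<le> p" "p \<noteq> \<infinity>" and \<Omega>: "open \<Omega>" 
    and F: "\<And>n::nat. continuous_on \<Omega> (F n)" "\<And>n. Lp_norm p \<Omega> (F n) \<le> A"
    and lim: "\<And>x. x \<in> \<Omega> \<Longrightarrow> (\<lambda>n. F n x) \<longlonglongrightarrow> g x"
  shows "Lp_norm p \<Omega> g \<le> A"
proof (cases A)
  case (real a)
  define q where "q = enn2real p"
  have q: "1 \<le> q" using p unfolding q_def by (cases p) auto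
  have "Lp_integral q \<Omega> g = (\<integral>\<^sup>+x. liminf (\<lambda>n. ennreal (norm (F n x) powr q) * indicator \<Omega> x) \<partial>lborel)"
    unfolding Lp_integral_def
  proof (rule nn_integral_cong)
    fix x
    have "(\<lambda>n. ennreal (norm (F n x) powr q) * indicator \<Omega> x) \<longlonglongrightarrow> ennreal (norm (g x) powr q) * indicator \<Omega> x"
    proof (cases "x \<in> \<Omega>")
      case True
      then show ?thesis using q lim[OF True]
        by (auto intro!: tendsto_ennrealI tendsto_powr' tendsto_norm)
    qed auto
    then show "ennreal (norm (g x) powr q) * indicator \<Omega> x
        = liminf (\<lambda>n. ennreal (norm (F n x) powr q) * indicator \<Omega> x)"
      by (simp add: lim_imp_Liminf)
  qed
  also have "\<dots> \<le> liminf (\<lambda>n. Lp_integral q \<Omega> (F n))"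
    unfolding Lp_integral_def
    by (rule nn_integral_liminf) (use Lp_integrand_measurable[OF \<Omega> F(1)] in auto)
  also have "\<dots> \<le> liminf (\<lambda>n. ennreal (a powr q))"
    using F(2) Lp_norm_le_iff[OF p, of a \<Omega>] real by (intro Liminf_mono always_eventually) (auto simp: q_def)
  also have "\<dots> = ennreal (a powr q)" by (simp add: Liminf_const)
  finally show ?thesis using Lp_norm_le_iff[OF p, of a \<Omega> g] real by (simp add: q_def)
qed simp

lemma fn_norm_Lp_norm:
  assumes p: "1 \<le> p" and \<Omega>: "open (\<Omega> :: (real^'n::finite) set)"
  shows "fn_norm (Lp_norm p \<Omega>) \<Omega>"
proof (cases "p = \<infinity>")
  case True
  show ?thesis
  proof
    fix f g :: "real^'n \<Rightarrow> complex" assume f: "continuous_on \<Omega> f" and g: "continuous_on \<Omega> g"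
    have "ennreal (norm (f x + g x)) \<le> Lp_norm \<infinity> \<Omega> f + Lp_norm \<infinity> \<Omega> g" if "x \<in> \<Omega>" for x
    proof -
      have "ennreal (norm (f x + g x)) \<le> ennreal (norm (f x)) + ennreal (norm (g x))"
        by (simp add: ennreal_plus[symmetric] norm_triangle_ineq ennreal_leI del: ennreal_plus)
      also have "\<dots> \<le> Lp_norm \<infinity> \<Omega> f + Lp_norm \<infinity> \<Omega> g"
        using that Lp_norm_infinity_le_iff[OF \<Omega> f] Lp_norm_infinity_le_iff[OF \<Omega> g] by (intro add_mono) auto
      finally show ?thesis .
    qed
    then show "Lp_norm p \<Omega> (\<lambda>x. f x + g x) \<le> Lp_norm p \<Omega> f + Lp_norm p \<Omega> g"
      unfolding True using f g by (subst Lp_norm_infinity_le_iff[OF \<Omega>]) (auto intro!: continuous_intros)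
  next
    fix f :: "real^'n \<Rightarrow> complex" and c :: real assume f: "continuous_on \<Omega> f"
    have "ennreal (norm (c *\<^sub>R f x)) \<le> ennreal \<bar>c\<bar> * Lp_norm \<infinity> \<Omega> f" if "x \<in> \<Omega>" for x
      using that Lp_norm_infinity_le_iff[OF \<Omega> f] by (auto simp: ennreal_mult intro!: mult_left_mono)
    then show "Lp_norm p \<Omega> (\<lambda>x. c *\<^sub>R f x) \<le> ennreal \<bar>c\<bar> * Lp_norm p \<Omega> f"
      unfolding True using f by (subst Lp_norm_infinity_le_iff[OF \<Omega>]) (auto intro!: continuous_intros)
  next
    fix F :: "nat \<Rightarrow> real^'n \<Rightarrow> complex" and g A
    assume F: "\<And>n. continuous_on \<Omega> (F n)" and g: "continuous_on \<Omega> g"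
      and lim: "\<And>x. x \<in> \<Omega> \<Longrightarrow> (\<lambda>n. F n x) \<longlonglongrightarrow> g x" and le: "\<And>n. Lp_norm p \<Omega> (F n) \<le> A"
    have "ennreal (norm (g x)) \<le> A" if "x \<in> \<Omega>" for x
    proof (rule LIMSEQ_le_const2)
      show "(\<lambda>n. ennreal (norm (F n x))) \<longlonglongrightarrow> ennreal (norm (g x))"
        using lim[OF that] by (intro tendsto_ennrealI tendsto_norm)
      show "\<exists>N. \<forall>n\<ge>N. ennreal (norm (F n x)) \<le> A"
        using le that Lp_norm_infinity_le_iff[OF \<Omega> F] unfolding True by blast
    qed
    then show "Lp_norm p \<Omega> g \<le> A"
      unfolding True using Lp_norm_infinity_le_iff[OF \<Omega> g] by auto
  qed
next
  case False
  show ?thesis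
  proof
    fix f g :: "real^'n \<Rightarrow> complex" assume f: "continuous_on \<Omega> f" and g: "continuous_on \<Omega> g"
    show "Lp_norm p \<Omega> (\<lambda>x. f x + g x) \<le> Lp_norm p \<Omega> f + Lp_norm p \<Omega> g"
    proof (cases "Lp_norm p \<Omega> f = top \<or> Lp_norm p \<Omega> g = top")
      case False
      then obtain a b where ab: "Lp_norm p \<Omega> f = ennreal a" "0 \<le> a" "Lp_norm p \<Omega> g = ennreal b" "0 \<le> b"
        by (metis ennreal_cases)
      show ?thesis
      proof (rule ennreal_le_epsilon)
        fix e :: real assume e: "0 < e"
        have "Lp_norm p \<Omega> (\<lambda>x. f x + g x) \<le> ennreal ((a + e/2) + (b + e/2))"
          by (rule Lp_norm_add_le[OF p \<open>p \<noteq> \<infinity>\<close> \<Omega> f _ _ g]) (use ab e in \<open>auto intro!: ennreal_leI\<close>)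
        also have "\<dots> = ennreal a + ennreal b + ennreal e"
          using ab e by (simp add: ennreal_plus[symmetric] del: ennreal_plus)
        finally show "Lp_norm p \<Omega> (\<lambda>x. f x + g x) \<le> Lp_norm p \<Omega> f + Lp_norm p \<Omega> g + ennreal e"
          using ab by simp
      qed
    qed auto
  qed (auto intro: Lp_norm_scale[OF p False \<Omega>] Lp_norm_limit[OF p False \<Omega>])
qed

lemma Lp_norm_translate_le:
  fixes g :: "real^'n::finite \<Rightarrow> complex"
  assumes p: "1 \<le> p" and \<Omega>: "open \<Omega>" "open \<Omega>'" and g: "continuous_on \<Omega>' g"
    and sub: "\<And>x. x \<in> \<Omega> \<Longrightarrow> x + v \<in> \<Omega>'"
    and le: "Lp_norm p \<Omega>' g \<le> ennreal A" "0 \<le> A"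
  shows "Lp_norm p \<Omega> (\<lambda>x. g (x + v)) \<le> ennreal A"
proof (cases "p = \<infinity>")
  case True
  have "continuous_on \<Omega> (\<lambda>x. g (x + v))"
    by (rule continuous_on_compose2[OF g]) (use sub in \<open>auto intro!: continuous_intros\<close>)
  then show ?thesis
    using le sub Lp_norm_infinity_le_iff[OF \<Omega>(2) g, of "ennreal A"]
      Lp_norm_infinity_le_iff[OF \<Omega>(1), of "\<lambda>x. g (x + v)" "ennreal A"]
    unfolding True by blast
next
  case False
  define q where "q = enn2real p"
  have "Lp_integral q \<Omega> (\<lambda>x. g (x + v))
      \<le> (\<integral>\<^sup>+x. ennreal (norm (g (v + x)) powr q) * indicator \<Omega>' (v + x) \<partial>lborel)"
    unfolding Lp_integral_def using sub by (intro nn_integral_mono) (auto simp: indicator_def add.commute)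
  also have "\<dots> = (\<integral>\<^sup>+x. ennreal (norm (g x) powr q) * indicator \<Omega>' x \<partial>distr lborel borel ((+) v))"
    using Lp_integrand_measurable[OF \<Omega>(2) g, of q] by (subst nn_integral_distr) auto
  also have "\<dots> = Lp_integral q \<Omega>' g"
    by (simp add: lborel_distr_plus Lp_integral_def)
  also have "\<dots> \<le> ennreal (A powr q)"
    using Lp_norm_le_iff[OF p False le(2), of \<Omega>' g] le by (simp add: q_def)
  finally show ?thesis
    using Lp_norm_le_iff[OF p False le(2), of \<Omega>] by (simp add: q_def)
qed

lemma Lp_norm_finite_bounded:
  fixes g :: "real^'n::finite \<Rightarrow> complex"
  assumes p: "1 \<le> p" and \<Omega>: "open \<Omega>" "compact (closure \<Omega>)" and g: "continuous_on (closure \<Omega>) g"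
  shows "\<exists>A\<ge>0. Lp_norm p \<Omega> g \<le> ennreal A"
proof -
  have gc: "continuous_on \<Omega> g" using g closure_subset continuous_on_subset by blast
  have "bounded (g ` closure \<Omega>)"
    using compact_continuous_image[OF g \<Omega>(2)] compact_imp_bounded by blast
  then obtain K where K: "K > 0" "\<And>x. x \<in> closure \<Omega> \<Longrightarrow> norm (g x) \<le> K"
    by (auto simp: bounded_pos)
  then have K': "norm (g x) \<le> K" if "x \<in> \<Omega>" for x using that closure_subset by blast
  show ?thesis
  proof (cases "p = \<infinity>")
    case True
    then show ?thesis using K K' Lp_norm_infinity_le_iff[OF \<Omega>(1) gc, of "ennreal K"]
      by (intro exI[of _ K]) (auto intro: ennreal_leI)
  next
    case False
    define q where "q = enn2real p"
    have q: "1 \<le> q" using p False unfolding q_def by (cases p) auto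
    have "emeasure lborel (closure \<Omega>) < \<infinity>"
      using \<Omega>(2) emeasure_compact_finite by blast
    moreover have "emeasure lborel \<Omega> \<le> emeasure lborel (closure \<Omega>)"
      by (intro emeasure_mono closure_subset) auto
    ultimately obtain m where m: "emeasure lborel \<Omega> = ennreal m" "0 \<le> m"
      by (metis ennreal_cases infinity_ennreal_def leD)
    have "Lp_integral q \<Omega> g \<le> (\<integral>\<^sup>+x. ennreal (K powr q) * indicator \<Omega> x \<partial>lborel)"
      unfolding Lp_integral_def using K' q
      by (intro nn_integral_mono) (auto simp: indicator_def intro!: ennreal_leI powr_mono2)
    also have "\<dots> = ennreal (K powr q) * emeasure lborel \<Omega>"
      using \<Omega> by (simp add: nn_integral_cmult)
    also have "\<dots> = ennreal (((K powr q * m) powr (1/q)) powr q)"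
      using m q by (simp add: ennreal_mult powr_powr)
    finally show ?thesis
      using Lp_norm_le_iff[OF p False, of "(K powr q * m) powr (1/q)" \<Omega> g] 
      by (intro exI[of _ "(K powr q * m) powr (1/q)"]) (auto simp: q_def)
  qed
qed

lemma fn_norm_point: "fn_norm (\<lambda>g. ennreal (norm (g x))) {x}"
proof
  fix f g :: "'a \<Rightarrow> complex" 
  show "ennreal (norm (f x + g x)) \<le> ennreal (norm (f x)) + ennreal (norm (g x))"
    by (simp add: ennreal_plus[symmetric] norm_triangle_ineq ennreal_leI del: ennreal_plus)
next
  fix f :: "'a \<Rightarrow> complex" and c :: real
  show "ennreal (norm (c *\<^sub>R f x)) \<le> ennreal \<bar>c\<bar> * ennreal (norm (f x))" 
    by (simp add: ennreal_mult)
next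
  fix F :: "nat \<Rightarrow> 'a \<Rightarrow> complex" and g A
  assume lim: "\<And>y. y \<in> {x} \<Longrightarrow> (\<lambda>n. F n y) \<longlonglongrightarrow> g y" and le: "\<And>n. ennreal (norm (F n x)) \<le> A"
  show "ennreal (norm (g x)) \<le> A"
    by (rule LIMSEQ_le_const2[of "\<lambda>n. ennreal (norm (F n x))"])
      (use lim le in \<open>auto intro!: tendsto_ennrealI tendsto_norm\<close>)
qed

section \<open>Iterated partial derivatives\<close>

lemma smooth_on_continuous_on: "smooth_on U f \<Longrightarrow> continuous_on U f"
  unfolding smooth_on_def by (metis Ck_on.simps(1))

lemma smooth_on_differentiable_on: "smooth_on U f \<Longrightarrow> f differentiable_on U"
  unfolding smooth_on_def by (metis Ck_on.simps(2))

lemma smooth_on_partial_deriv: "smooth_on U f \<Longrightarrow> smooth_on U (partial_deriv i f)"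
  unfolding smooth_on_def by (metis Ck_on.simps(2))

lemma smooth_on_has_partial_deriv:
  assumes "open U" "smooth_on U f" "x + t *\<^sub>R axis i 1 \<in> U"
  shows "((\<lambda>s. f (x + s *\<^sub>R axis i 1)) has_vector_derivative partial_deriv i f (x + t *\<^sub>R axis i 1)) (at t)"
proof -
  let ?y = "x + t *\<^sub>R axis i 1"
  have "f differentiable (at ?y)"
    using smooth_on_differentiable_on[OF assms(2)] assms by (simp add: differentiable_on_eq_differentiable_at)
  then obtain f' where f': "(f has_derivative f') (at ?y)" by (auto simp: differentiable_def)
  have along: "((\<lambda>s. f (z + s *\<^sub>R axis i 1)) has_vector_derivative f' (axis i 1)) (at r)"
    if "z + r *\<^sub>R axis i 1 = ?y" for z r
  proof -
    have "((\<lambda>s. z + s *\<^sub>R axis i 1) has_vector_derivative axis i 1) (at r)"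
      by (auto intro!: derivative_eq_intros)
    from vector_derivative_diff_chain_within[OF this, of f f'] f' that
    show ?thesis by (simp add: o_def has_derivative_at_withinI)
  qed
  have "partial_deriv i f ?y = f' (axis i 1)"
    unfolding partial_deriv_def by (rule vector_derivative_at) (rule along, simp)
  then show ?thesis using along[of x t] by simp
qed

lemma partial_deriv_cong:
  assumes "open U" "\<And>y. y \<in> U \<Longrightarrow> f y = g y" "x \<in> U"
  shows "partial_deriv i f x = partial_deriv i g x"
  unfolding partial_deriv_def
proof (rule vector_derivative_cong_eq)
  have "((\<lambda>t. x + t *\<^sub>R axis i 1) \<longlongrightarrow> x + 0 *\<^sub>R axis i (1::real)) (nhds (0::real))"
    by (intro tendsto_intros filterlim_ident)
  then have "\<forall>\<^sub>F t in nhds 0. x + t *\<^sub>R axis i 1 \<in> U"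
    using assms(1,3) by (auto simp: tendsto_def)
  then show "\<forall>\<^sub>F t in nhds 0. t \<in> UNIV \<longrightarrow> f (x + t *\<^sub>R axis i 1) = g (x + t *\<^sub>R axis i 1)"
    by eventually_elim (use assms(2) in auto)
qed auto

text \<open>
  The second difference is symmetric in the two directions, whereas its leading term is the mixed derivative in
  one order. Comparing the two orders proves that the mixed derivatives agree.
\<close>

lemma second_difference_approx:
  fixes f :: "real^'n::finite \<Rightarrow> complex"
  assumes U: "open U" "x \<in> U" and f: "smooth_on U f" and \<epsilon>: "0 < \<epsilon>"
  shows "\<exists>\<delta>>0. \<forall>h. 0 < h \<and> h < \<delta> \<longrightarrow>
    norm (f (x + h *\<^sub>R axis i 1 + h *\<^sub>R axis j 1) - f (x + h *\<^sub>R axis i 1) - f (x + h *\<^sub>R axis j 1) + f x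
       - (h * h) *\<^sub>R partial_deriv j (partial_deriv i f) x) \<le> \<epsilon> * h * h"
proof -
  let ?g = "partial_deriv j (partial_deriv i f)" and ?i = "axis i (1::real)" and ?j = "axis j (1::real)"
  have "continuous_on U ?g"
    by (intro smooth_on_continuous_on smooth_on_partial_deriv f)
  then have "isCont ?g x" using U by (simp add: continuous_on_eq_continuous_at)
  then obtain d1 where d1: "d1 > 0" "\<And>y. dist y x < d1 \<Longrightarrow> dist (?g y) (?g x) < \<epsilon>"
    using \<epsilon> unfolding continuous_at_eps_delta by metis
  obtain d2 where d2: "d2 > 0" "ball x d2 \<subseteq> U" using U openE by blast
  define d where "d = min d1 d2 / 2"
  have d: "d > 0" using d1 d2 by (simp add: d_def)
  show ?thesis
  proof (intro exI[of _ d] conjI allI impI d)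
    fix h assume h: "0 < h \<and> h < d"
    have near: "x + s *\<^sub>R ?i + t *\<^sub>R ?j \<in> U" "norm (?g (x + s *\<^sub>R ?i + t *\<^sub>R ?j) - ?g x) \<le> \<epsilon>"
      if "0 \<le> s" "s \<le> h" "0 \<le> t" "t \<le> h" for s t
    proof -
      have "norm (s *\<^sub>R ?i + t *\<^sub>R ?j) \<le> norm (s *\<^sub>R ?i) + norm (t *\<^sub>R ?j)" by (rule norm_triangle_ineq)
      also have "\<dots> < min d1 d2" using that h by (simp add: d_def norm_axis_1)
      finally have *: "dist (x + s *\<^sub>R ?i + t *\<^sub>R ?j) x < min d1 d2" by (simp add: dist_norm add.assoc)
      then have "x + s *\<^sub>R ?i + t *\<^sub>R ?j \<in> ball x d2" by (simp add: dist_commute)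
      then show "x + s *\<^sub>R ?i + t *\<^sub>R ?j \<in> U" using d2(2) by blast
      show "norm (?g (x + s *\<^sub>R ?i + t *\<^sub>R ?j) - ?g x) \<le> \<epsilon>"
        using d1(2)[of "x + s *\<^sub>R ?i + t *\<^sub>R ?j"] * by (simp add: dist_norm)
    qed
    have inner: "norm (partial_deriv i f (x + s *\<^sub>R ?i + h *\<^sub>R ?j) - partial_deriv i f (x + s *\<^sub>R ?i)
        - h *\<^sub>R ?g x) \<le> \<epsilon> * h" if s: "0 \<le> s" "s \<le> h" for s
    proof -
      have "norm (partial_deriv i f (x + s *\<^sub>R ?i + h *\<^sub>R ?j) - partial_deriv i f (x + s *\<^sub>R ?i + 0 *\<^sub>R ?j)
          - (h - 0) *\<^sub>R ?g x) \<le> \<epsilon> * (h - 0)"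
      proof (rule vector_derivative_increment_bound[where \<phi>' = "\<lambda>t. ?g (x + s *\<^sub>R ?i + t *\<^sub>R ?j)"])
        fix t assume t: "0 \<le> t" "t \<le> h"
        show "((\<lambda>t. partial_deriv i f (x + s *\<^sub>R ?i + t *\<^sub>R ?j)) has_vector_derivative
            ?g (x + s *\<^sub>R ?i + t *\<^sub>R ?j)) (at t within {0..h})"
          by (rule has_vector_derivative_at_within, rule smooth_on_has_partial_deriv[OF U(1)])
            (rule smooth_on_partial_deriv[OF f], rule near(1)[OF s t])
        show "norm (?g (x + s *\<^sub>R ?i + t *\<^sub>R ?j) - ?g x) \<le> \<epsilon>" by (rule near(2)[OF s t])
      qed (use h in auto)
      then show ?thesis by simp
    qed
    have swap: "x + h *\<^sub>R ?j + s *\<^sub>R ?i = x + s *\<^sub>R ?i + h *\<^sub>R ?j" for s by (simp add: add_ac)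
    have rearrange: "(A - B) - (C - D) - h *\<^sub>R (h *\<^sub>R c) = A - B - C + D - (h * h) *\<^sub>R c"
      for A B C D c :: complex by simp
    have "norm ((f (x + h *\<^sub>R ?j + h *\<^sub>R ?i) - f (x + h *\<^sub>R ?i)) - (f (x + h *\<^sub>R ?j + 0 *\<^sub>R ?i) - f (x + 0 *\<^sub>R ?i))
        - (h - 0) *\<^sub>R (h *\<^sub>R ?g x)) \<le> (\<epsilon> * h) * (h - 0)"
    proof (rule vector_derivative_increment_bound[where
          \<phi>' = "\<lambda>s. partial_deriv i f (x + h *\<^sub>R ?j + s *\<^sub>R ?i) - partial_deriv i f (x + s *\<^sub>R ?i)"])
      fix s assume s: "0 \<le> s" "s \<le> h"
      have U1: "x + h *\<^sub>R ?j + s *\<^sub>R ?i \<in> U" and U2: "x + s *\<^sub>R ?i \<in> U"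
        using near(1)[of s h] near(1)[of s 0] s h unfolding swap by auto
      show "((\<lambda>s. f (x + h *\<^sub>R ?j + s *\<^sub>R ?i) - f (x + s *\<^sub>R ?i)) has_vector_derivative
          partial_deriv i f (x + h *\<^sub>R ?j + s *\<^sub>R ?i) - partial_deriv i f (x + s *\<^sub>R ?i)) (at s within {0..h})"
        by (rule has_vector_derivative_at_within, rule has_vector_derivative_diff)
          (rule smooth_on_has_partial_deriv[OF U(1) f U1] smooth_on_has_partial_deriv[OF U(1) f U2])+
      show "norm (partial_deriv i f (x + h *\<^sub>R ?j + s *\<^sub>R ?i) - partial_deriv i f (x + s *\<^sub>R ?i)
          - h *\<^sub>R ?g x) \<le> \<epsilon> * h"
        unfolding swap by (rule inner[OF s])
    qed (use h in auto)
    then show "norm (f (x + h *\<^sub>R ?i + h *\<^sub>R ?j) - f (x + h *\<^sub>R ?i) - f (x + h *\<^sub>R ?j) + f x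
       - (h * h) *\<^sub>R ?g x) \<le> \<epsilon> * h * h"
      by (simp only: swap rearrange diff_zero scaleR_zero_left add_0_right)
  qed
qed

lemma partial_deriv_commute:
  fixes f :: "real^'n::finite \<Rightarrow> complex"
  assumes U: "open U" "x \<in> U" and f: "smooth_on U f"
  shows "partial_deriv i (partial_deriv j f) x = partial_deriv j (partial_deriv i f) x"
proof -
  let ?a = "partial_deriv i (partial_deriv j f) x" and ?b = "partial_deriv j (partial_deriv i f) x"
  have "norm (?a - ?b) \<le> \<epsilon>" if \<epsilon>: "0 < \<epsilon>" for \<epsilon>
  proof -
    obtain d1 where d1: "d1 > 0" "\<And>h. 0 < h \<and> h < d1 \<Longrightarrow>
      norm (f (x + h *\<^sub>R axis j 1 + h *\<^sub>R axis i 1) - f (x + h *\<^sub>R axis j 1) - f (x + h *\<^sub>R axis i 1) + f x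
       - (h * h) *\<^sub>R ?a) \<le> \<epsilon> / 2 * h * h"
      using second_difference_approx[OF U f, of "\<epsilon>/2" j i] \<epsilon> by auto
    obtain d2 where d2: "d2 > 0" "\<And>h. 0 < h \<and> h < d2 \<Longrightarrow>
      norm (f (x + h *\<^sub>R axis i 1 + h *\<^sub>R axis j 1) - f (x + h *\<^sub>R axis i 1) - f (x + h *\<^sub>R axis j 1) + f x
       - (h * h) *\<^sub>R ?b) \<le> \<epsilon> / 2 * h * h"
      using second_difference_approx[OF U f, of "\<epsilon>/2" i j] \<epsilon> by auto
    define h where "h = min d1 d2 / 2"
    have h: "0 < h" "h < d1" "h < d2" using d1 d2 by (auto simp: h_def)
    define \<Delta> where "\<Delta> = f (x + h *\<^sub>R axis i 1 + h *\<^sub>R axis j 1) - f (x + h *\<^sub>R axis i 1) - f (x + h *\<^sub>R axis j 1) + f x"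
    have "norm (\<Delta> - (h * h) *\<^sub>R ?a) \<le> \<epsilon> / 2 * h * h"
      using d1(2)[of h] h by (simp add: \<Delta>_def algebra_simps)
    moreover have "norm (\<Delta> - (h * h) *\<^sub>R ?b) \<le> \<epsilon> / 2 * h * h"
      using d2(2)[of h] h by (simp add: \<Delta>_def)
    moreover have "(h * h) *\<^sub>R (?a - ?b) = (\<Delta> - (h * h) *\<^sub>R ?b) - (\<Delta> - (h * h) *\<^sub>R ?a)"
      by (simp add: algebra_simps)
    ultimately have "norm ((h * h) *\<^sub>R (?a - ?b)) \<le> \<epsilon> * (h * h)"
      using norm_triangle_ineq4[of "\<Delta> - (h * h) *\<^sub>R ?b" "\<Delta> - (h * h) *\<^sub>R ?a"] by simp
    then have "(h * h) * norm (?a - ?b) \<le> (h * h) * \<epsilon>" by (simp add: mult.commute)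
    then show ?thesis using h by simp
  qed
  then have "norm (?a - ?b) \<le> 0" by (rule field_le_epsilon) simp
  then show ?thesis by simp
qed

text \<open>
  Derivatives are indexed by words of directions instead of multiindices: a word can be split into a
  prefix and a suffix, and its length is the order.
\<close>

definition word_deriv :: "'n list \<Rightarrow> (real^'n::finite \<Rightarrow> complex) \<Rightarrow> real^'n \<Rightarrow> complex" where
  "word_deriv w f = foldr partial_deriv w f"

lemma word_deriv_simps [simp]:
  "word_deriv [] f = f"
  "word_deriv (i # w) f = partial_deriv i (word_deriv w f)"
  "word_deriv (v @ w) f = word_deriv v (word_deriv w f)"
  by (simp_all add: word_deriv_def)

lemma smooth_on_word_deriv: "smooth_on U f \<Longrightarrow> smooth_on U (word_deriv w f)"
  by (induction w) (auto intro: smooth_on_partial_deriv)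

lemma word_deriv_replicate: "word_deriv (replicate m i) f = (partial_deriv i ^^ m) f"
  by (induction m) auto

lemma word_deriv_move:
  assumes "open U" "smooth_on U f" "x \<in> U"
  shows "word_deriv (u @ i # v) f x = word_deriv (i # u @ v) f x"
  using assms(3)
proof (induction u arbitrary: x)
  case (Cons j u)
  have "word_deriv ((j # u) @ i # v) f x = partial_deriv j (word_deriv (i # u @ v) f) x"
    using partial_deriv_cong[OF assms(1) Cons.IH Cons.prems] by simp
  also have "\<dots> = word_deriv (i # (j # u) @ v) f x"
    using partial_deriv_commute[OF assms(1) Cons.prems smooth_on_word_deriv[OF assms(2)], of j i "u @ v"]
    by simp
  finally show ?case .
qed simp

lemma word_deriv_perm:
  assumes "open U" "smooth_on U f" "mset w = mset w'" "x \<in> U"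
  shows "word_deriv w f x = word_deriv w' f x"
  using assms(3,4)
proof (induction w arbitrary: w' x)
  case (Cons i w)
  then have "i \<in> set w'" by (metis list.set_intros(1) set_mset_mset)
  then obtain u v where w': "w' = u @ i # v" by (meson split_list)
  then have m: "mset w = mset (u @ v)" using Cons.prems(1) by simp
  have "word_deriv (i # w) f x = word_deriv (i # u @ v) f x"
    using partial_deriv_cong[OF assms(1) Cons.IH[OF m] Cons.prems(2)] by simp
  then show ?case
    using word_deriv_move[OF assms(1,2) Cons.prems(2), of u i v] by (simp add: w')
qed simp

lemma coord_list: "distinct (coord_list :: 'n::finite list)" "set (coord_list :: 'n list) = UNIV"
proof -
  have "\<exists>is :: 'n list. distinct is \<and> set is = UNIV"
    using finite_distinct_list[OF finite] by metis
  from someI_ex[OF this]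
  show "distinct (coord_list :: 'n::finite list)" "set (coord_list :: 'n list) = UNIV"
    unfolding coord_list_def by auto
qed

definition mi_word :: "('n::finite \<Rightarrow> nat) \<Rightarrow> 'n list" where
  "mi_word \<alpha> = concat (map (\<lambda>i. replicate (\<alpha> i) i) coord_list)"

lemma mderiv_eq_word_deriv: "mderiv \<alpha> f = word_deriv (mi_word \<alpha>) f"
proof -
  have "foldr (\<lambda>i g. (partial_deriv i ^^ \<alpha> i) g) is f
      = word_deriv (concat (map (\<lambda>i. replicate (\<alpha> i) i) is)) f" for "is" 
    by (induction "is") (auto simp: word_deriv_replicate)
  then show ?thesis by (simp add: mderiv_def mi_word_def)
qed

lemma length_mi_word: "length (mi_word \<alpha>) = mi_order (\<alpha> :: 'n::finite \<Rightarrow> nat)"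
  using coord_list[where 'n = 'n] by (simp add: mi_word_def mi_order_def length_concat o_def sum_list_distinct_conv_sum_set)

lemma count_mi_word: "count (mset (mi_word \<alpha>)) i = \<alpha> (i :: 'n::finite)"
proof -
  have "count (mset (concat (map (\<lambda>i. replicate (\<alpha> i) i) is))) i = (if i \<in> set is then \<alpha> i else 0)"
    if "distinct is" for "is" :: "'n list"
    using that by (induction "is") auto
  then show ?thesis using coord_list[where 'n = 'n] by (auto simp: mi_word_def)
qed

lemma mderiv_of_word:
  assumes "open U" "smooth_on U f" "x \<in> U"
  shows "mderiv (count (mset w)) f x = word_deriv w f x"
  unfolding mderiv_eq_word_deriv
  by (rule word_deriv_perm[OF assms(1,2) _ assms(3)]) (auto intro!: multiset_eqI simp: count_mi_word)

lemma mi_order_of_word: "mi_order (count (mset w)) = length w"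
proof -
  have "mset (mi_word (count (mset w))) = mset w"
    by (auto intro!: multiset_eqI simp: count_mi_word)
  then show ?thesis using length_mi_word mset_eq_length by metis
qed

section \<open>Intermediate derivatives on the whole space\<close>

definition central_diff :: "'a::real_normed_vector \<Rightarrow> ('a \<Rightarrow> complex) \<Rightarrow> 'a \<Rightarrow> complex" where
  "central_diff h f x = (1/2) *\<^sub>R (f (x + h) - f (x - h))"

definition central_mean :: "'a::real_normed_vector \<Rightarrow> ('a \<Rightarrow> complex) \<Rightarrow> 'a \<Rightarrow> complex" where
  "central_mean h f x = (1/2) *\<^sub>R (f (x + h) + f (x - h))"

text \<open>
  A function with all its derivatives along the direction \<open>e\<close>. Then \<open>central_diff (t e)\<close> acts as
  \<open>sinh (t D)\<close> and \<open>central_mean (t e)\<close> as \<open>cosh (t D)\<close>, where \<open>D\<close> is the derivative along \<open>e\<close>.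
\<close>

definition deriv_chain :: "'a::real_normed_vector \<Rightarrow> (nat \<Rightarrow> 'a \<Rightarrow> complex) \<Rightarrow> bool" where
  "deriv_chain e v \<longleftrightarrow> (\<forall>j. continuous_on UNIV (v j)) \<and>
     (\<forall>j x t. ((\<lambda>s. v j (x + s *\<^sub>R e)) has_vector_derivative v (Suc j) (x + t *\<^sub>R e)) (at t))"

text \<open>
  The coefficients of \<open>(1 + y^2) powr (-1/2)\<close> at \<open>y^(2j)\<close>; those of arcsinh are obtained on division
  by \<open>2 j + 1\<close>.
\<close>

definition asinh_coeff :: "nat \<Rightarrow> real" where
  "asinh_coeff j = (\<Prod>i<j. - (2 * real i + 1) / (2 * real i + 2))"

lemma asinh_coeff_0: "asinh_coeff 0 = 1"
  by (simp add: asinh_coeff_def)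

lemma asinh_coeff_Suc: "(2 * real j + 2) * asinh_coeff (Suc j) = - ((2 * real j + 1) * asinh_coeff j)"
  by (simp add: asinh_coeff_def field_simps)

lemma asinh_coeff_abs_le: "\<bar>asinh_coeff j\<bar> \<le> 1"
  unfolding asinh_coeff_def abs_prod by (rule prod_le_1) auto

text \<open>
  The moduli of the coefficients telescope,
  \<open>|c_j| - |c_(j+1)| = |c_j| / (2j + 2) \<ge> |c_j| / (2 (2j + 1))\<close>, which gives 2 in place of the sharp
  bound \<open>pi / 2\<close>.
\<close>

lemma asinh_coeff_sum: "(\<Sum>j<n. \<bar>asinh_coeff j / (2 * real j + 1)\<bar>) \<le> 2"
proof -
  have "(\<Sum>j<n. \<bar>asinh_coeff j / (2 * real j + 1)\<bar>) \<le> 2 - 2 * \<bar>asinh_coeff n\<bar>"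
  proof (induction n)
    case (Suc n)
    have "asinh_coeff (Suc n) = asinh_coeff n * (- (2 * real n + 1) / (2 * real n + 2))"
      by (simp only: asinh_coeff_def prod.lessThan_Suc)
    then have eq: "\<bar>asinh_coeff (Suc n)\<bar> = \<bar>asinh_coeff n\<bar> * ((2 * real n + 1) / (2 * real n + 2))"
      by (simp only: abs_mult abs_divide abs_minus_cancel) simp
    have "1 / (2 * real n + 1) \<le> 2 - 2 * ((2 * real n + 1) / (2 * real n + 2))"
      by (simp add: field_simps)
    from mult_left_mono[OF this, of "\<bar>asinh_coeff n\<bar>"]
    show ?case using Suc by (simp add: eq algebra_simps)
  qed (simp add: asinh_coeff_0)
  then show ?thesis by (smt (verit) abs_ge_zero)
qed

text \<open>
  \<open>cosh^2 = 1 + sinh^2\<close> for the operators.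
\<close>

lemma central_mean_mean: "central_mean h (central_mean h f) x = f x + central_diff h (central_diff h f) x"
  by (simp add: central_mean_def central_diff_def scaleR_conv_of_real algebra_simps)

lemma central_diff_mean: "central_diff h (central_mean h f) x = central_mean h (central_diff h f) x"
  by (simp add: central_mean_def central_diff_def algebra_simps)

lemma continuous_on_central_diff:
  assumes "continuous_on UNIV f"
  shows "continuous_on UNIV (central_diff h f)"
proof -
  have "continuous_on UNIV (\<lambda>x. f (x + c))" for c
    by (rule continuous_on_compose2[OF assms]) (auto intro!: continuous_intros)
  from this[of h] this[of "-h"] show ?thesis
    unfolding central_diff_def by (auto intro!: continuous_intros)
qed

lemma continuous_on_central_mean:
  assumes "continuous_on UNIV f"
  shows "continuous_on UNIV (central_mean h f)"
proof -
  have "continuous_on UNIV (\<lambda>x. f (x + c))" for c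
    by (rule continuous_on_compose2[OF assms]) (auto intro!: continuous_intros)
  from this[of h] this[of "-h"] show ?thesis
    unfolding central_mean_def by (auto intro!: continuous_intros)
qed

lemma continuous_on_central_diff_power:
  "continuous_on UNIV f \<Longrightarrow> continuous_on UNIV ((central_diff h ^^ m) f)"
  by (induction m) (auto intro: continuous_on_central_diff)

lemma deriv_chain_central_diff:
  assumes "deriv_chain e v"
  shows "deriv_chain e (\<lambda>j. (central_diff h ^^ m) (v j))"
proof (induction m)
  case (Suc m)
  have step: "deriv_chain e (\<lambda>j. central_diff h (g j))" if g: "deriv_chain e g" for g
  proof -
    have d: "((\<lambda>s. g j (x + s *\<^sub>R e)) has_vector_derivative g (Suc j) (x + t *\<^sub>R e)) (at t)" for j x t
      using g by (simp add: deriv_chain_def)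
    have "((\<lambda>s. (1/2) *\<^sub>R (g j ((x + h) + s *\<^sub>R e) - g j ((x - h) + s *\<^sub>R e))) has_vector_derivative
          (1/2) *\<^sub>R (g (Suc j) ((x + h) + t *\<^sub>R e) - g (Suc j) ((x - h) + t *\<^sub>R e))) (at t)" for j x t
      by (rule bounded_linear.has_vector_derivative[OF bounded_linear_scaleR_right has_vector_derivative_diff])
        (rule d)+
    moreover have "(x + h) + s *\<^sub>R e = x + s *\<^sub>R e + h" "(x - h) + s *\<^sub>R e = x + s *\<^sub>R e - h" for x s
      by simp_all
    ultimately have "((\<lambda>s. central_diff h (g j) (x + s *\<^sub>R e)) has_vector_derivative
        central_diff h (g (Suc j)) (x + t *\<^sub>R e)) (at t)" for j x t
      by (simp add: central_diff_def)
    then show ?thesis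
      using g by (simp add: deriv_chain_def continuous_on_central_diff)
  qed
  show ?case using step[OF Suc] by simp
qed (use assms in simp)

text \<open>
  The rule \<open>d/dt sinh(t D)^m = m cosh(t D) sinh(t D)^(m-1) D\<close>. The base point moves with speed \<open>c\<close> along the
  line, because in the induction step one more difference moves it by \<open>t e\<close> in either direction.
\<close>

lemma central_diff_power_derivative:
  assumes v: "deriv_chain e v"
  shows "((\<lambda>s. (central_diff (s *\<^sub>R e) ^^ m) (v j) (x + (c * s) *\<^sub>R e)) has_vector_derivative
      (real m *\<^sub>R central_mean (t *\<^sub>R e) ((central_diff (t *\<^sub>R e) ^^ (m - 1)) (v (Suc j))) (x + (c * t) *\<^sub>R e)
       + c *\<^sub>R (central_diff (t *\<^sub>R e) ^^ m) (v (Suc j)) (x + (c * t) *\<^sub>R e))) (at t)"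
proof (induction m arbitrary: c)
  case 0
  have "((\<lambda>s. v j (x + s *\<^sub>R e)) has_vector_derivative v (Suc j) (x + (c * t) *\<^sub>R e)) (at (c * t))"
    using v by (simp add: deriv_chain_def)
  moreover have "((\<lambda>s. c * s) has_vector_derivative c) (at t)"
    by (auto intro!: derivative_eq_intros simp: has_real_derivative_iff_has_vector_derivative[symmetric])
  ultimately have "((\<lambda>s. v j (x + s *\<^sub>R e)) \<circ> (\<lambda>s. c * s) has_vector_derivative c *\<^sub>R v (Suc j) (x + (c * t) *\<^sub>R e)) (at t)"
    by (intro vector_diff_chain_at) auto
  then show ?case by (simp add: o_def)
next
  case (Suc m)
  let ?h = "t *\<^sub>R e" and ?y = "x + (c * t) *\<^sub>R e"
  let ?S = "\<lambda>m. (central_diff ?h ^^ m) (v (Suc j))"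
  have shift: "x + (c * s) *\<^sub>R e + s *\<^sub>R e = x + ((c + 1) * s) *\<^sub>R e"
    "x + (c * s) *\<^sub>R e - s *\<^sub>R e = x + ((c - 1) * s) *\<^sub>R e" for s
    by (auto simp: algebra_simps)
  have "((\<lambda>s. (1/2) *\<^sub>R ((central_diff (s *\<^sub>R e) ^^ m) (v j) (x + ((c + 1) * s) *\<^sub>R e)
            - (central_diff (s *\<^sub>R e) ^^ m) (v j) (x + ((c - 1) * s) *\<^sub>R e))) has_vector_derivative
       (1/2) *\<^sub>R ((real m *\<^sub>R central_mean ?h (?S (m - 1)) (x + ((c + 1) * t) *\<^sub>R e) + (c + 1) *\<^sub>R ?S m (x + ((c + 1) * t) *\<^sub>R e))
         - (real m *\<^sub>R central_mean ?h (?S (m - 1)) (x + ((c - 1) * t) *\<^sub>R e) + (c - 1) *\<^sub>R ?S m (x + ((c - 1) * t) *\<^sub>R e)))) (at t)"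
    by (intro bounded_linear.has_vector_derivative[OF bounded_linear_scaleR_right] has_vector_derivative_diff Suc)
  also have "(\<lambda>s. (1/2) *\<^sub>R ((central_diff (s *\<^sub>R e) ^^ m) (v j) (x + ((c + 1) * s) *\<^sub>R e)
            - (central_diff (s *\<^sub>R e) ^^ m) (v j) (x + ((c - 1) * s) *\<^sub>R e)))
       = (\<lambda>s. (central_diff (s *\<^sub>R e) ^^ Suc m) (v j) (x + (c * s) *\<^sub>R e))"
    by (simp add: central_diff_def[of "_ *\<^sub>R e" "(_ ^^ _) _"] shift)
  also have "(1/2) *\<^sub>R ((real m *\<^sub>R central_mean ?h (?S (m - 1)) (x + ((c + 1) * t) *\<^sub>R e) + (c + 1) *\<^sub>R ?S m (x + ((c + 1) * t) *\<^sub>R e))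
         - (real m *\<^sub>R central_mean ?h (?S (m - 1)) (x + ((c - 1) * t) *\<^sub>R e) + (c - 1) *\<^sub>R ?S m (x + ((c - 1) * t) *\<^sub>R e)))
      = real m *\<^sub>R central_diff ?h (central_mean ?h (?S (m - 1))) ?y + c *\<^sub>R central_diff ?h (?S m) ?y + central_mean ?h (?S m) ?y"
    unfolding central_diff_def[of ?h "central_mean ?h _"] central_diff_def[of ?h "?S m"] central_mean_def[of ?h "?S m"] shift
    by (simp add: algebra_simps)
  also have "real m *\<^sub>R central_diff ?h (central_mean ?h (?S (m - 1))) ?y = real m *\<^sub>R central_mean ?h (?S m) ?y"
    by (cases m) (auto simp: central_diff_mean)
  also have "real m *\<^sub>R central_mean ?h (?S m) ?y + c *\<^sub>R central_diff ?h (?S m) ?y + central_mean ?h (?S m) ?y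
      = real (Suc m) *\<^sub>R central_mean ?h (?S (Suc m - 1)) ?y + c *\<^sub>R ?S (Suc m) ?y"
    by (simp add: algebra_simps)
  finally show ?case .
qed

lemma central_mean_power_derivative:
  assumes v: "deriv_chain e v"
  shows "((\<lambda>s. central_mean (s *\<^sub>R e) ((central_diff (s *\<^sub>R e) ^^ m) (v j)) x) has_vector_derivative
      (real m *\<^sub>R ((central_diff (t *\<^sub>R e) ^^ (m - 1)) (v (Suc j)) x + (central_diff (t *\<^sub>R e) ^^ (m + 1)) (v (Suc j)) x)
       + (central_diff (t *\<^sub>R e) ^^ (m + 1)) (v (Suc j)) x)) (at t)"
proof -
  let ?h = "t *\<^sub>R e"
  let ?S = "\<lambda>m. (central_diff ?h ^^ m) (v (Suc j))"
  have "((\<lambda>s. (1/2) *\<^sub>R ((central_diff (s *\<^sub>R e) ^^ m) (v j) (x + (1 * s) *\<^sub>R e)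
            + (central_diff (s *\<^sub>R e) ^^ m) (v j) (x + ((-1) * s) *\<^sub>R e))) has_vector_derivative
       (1/2) *\<^sub>R ((real m *\<^sub>R central_mean ?h (?S (m - 1)) (x + (1 * t) *\<^sub>R e) + 1 *\<^sub>R ?S m (x + (1 * t) *\<^sub>R e))
         + (real m *\<^sub>R central_mean ?h (?S (m - 1)) (x + ((-1) * t) *\<^sub>R e) + (-1) *\<^sub>R ?S m (x + ((-1) * t) *\<^sub>R e)))) (at t)"
    by (intro bounded_linear.has_vector_derivative[OF bounded_linear_scaleR_right] has_vector_derivative_add
        central_diff_power_derivative[OF v])
  also have "(\<lambda>s. (1/2) *\<^sub>R ((central_diff (s *\<^sub>R e) ^^ m) (v j) (x + (1 * s) *\<^sub>R e)
            + (central_diff (s *\<^sub>R e) ^^ m) (v j) (x + ((-1) * s) *\<^sub>R e)))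
       = (\<lambda>s. central_mean (s *\<^sub>R e) ((central_diff (s *\<^sub>R e) ^^ m) (v j)) x)"
    by (simp add: central_mean_def)
  also have "(1/2) *\<^sub>R ((real m *\<^sub>R central_mean ?h (?S (m - 1)) (x + (1 * t) *\<^sub>R e) + 1 *\<^sub>R ?S m (x + (1 * t) *\<^sub>R e))
         + (real m *\<^sub>R central_mean ?h (?S (m - 1)) (x + ((-1) * t) *\<^sub>R e) + (-1) *\<^sub>R ?S m (x + ((-1) * t) *\<^sub>R e)))
      = real m *\<^sub>R central_mean ?h (central_mean ?h (?S (m - 1))) x + central_diff ?h (?S m) x"
    unfolding central_mean_def[of ?h "central_mean ?h _"] central_diff_def[of ?h "?S m"]
    by (simp add: algebra_simps)
  also have "real m *\<^sub>R central_mean ?h (central_mean ?h (?S (m - 1))) x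
      = real m *\<^sub>R (?S (m - 1) x + ?S (m + 1) x)"
    by (cases m) (auto simp: central_mean_mean)
  finally show ?thesis by simp
qed

text \<open>
  With \<open>s m\<close> for \<open>sinh(t D)^m D^2\<close>, the left-hand side is up to sign the second derivative in \<open>t\<close> of
  \<open>t D - sum a_j sinh(t D)^(2j+1)\<close>. The recursion of the coefficients is the differential equation of arcsinh, so
  only the term of highest order survives.
\<close>

lemma asinh_second_derivative_telescope:
  "(\<Sum>j<Suc n. asinh_coeff j *\<^sub>R (real (2 * j) *\<^sub>R ((s :: nat \<Rightarrow> complex) (2 * j - 1) + s (2 * j + 1)) + s (2 * j + 1)))
    = ((2 * real n + 1) * asinh_coeff n) *\<^sub>R s (2 * n + 1)"
proof (induction n)
  case (Suc n)
  have "(\<Sum>j<Suc (Suc n). asinh_coeff j *\<^sub>R (real (2 * j) *\<^sub>R (s (2 * j - 1) + s (2 * j + 1)) + s (2 * j + 1)))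
      = ((2 * real n + 1) * asinh_coeff n + (2 * real n + 2) * asinh_coeff (Suc n)) *\<^sub>R s (2 * n + 1)
        + ((2 * real (Suc n) + 1) * asinh_coeff (Suc n)) *\<^sub>R s (2 * Suc n + 1)"
    by (subst sum.lessThan_Suc, subst Suc) (simp add: scaleR_conv_of_real algebra_simps)
  then show ?case by (simp add: asinh_coeff_Suc)
qed (simp add: asinh_coeff_0)

locale translation_norm = fn_norm N UNIV for N :: "('a::real_normed_vector \<Rightarrow> complex) \<Rightarrow> ennreal" +
  assumes N_translate: "continuous_on UNIV f \<Longrightarrow> N (\<lambda>x. f (x + h)) \<le> N f"
begin

lemma N_central:
  assumes f: "continuous_on UNIV f" "N f \<le> ennreal A" "0 \<le> A"
  shows "N (central_diff h f) \<le> ennreal A" "N (central_mean h f) \<le> ennreal A"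
proof -
  have c: "continuous_on UNIV (\<lambda>x. f (x + c))" for c
    by (rule continuous_on_compose2[OF f(1)]) (auto intro!: continuous_intros)
  have n: "N (\<lambda>x. f (x + c)) \<le> ennreal A" for c
    using N_translate[OF f(1), of c] f(2) by simp
  have s: "N (\<lambda>x. (1/2) *\<^sub>R f (x + c)) \<le> ennreal (A/2)" for c
    by (rule N_scale_le[OF c n]) (use f in auto)
  have cs: "continuous_on UNIV (\<lambda>x. (1/2) *\<^sub>R f (x + c))" for c
    by (intro continuous_intros c)
  show "N (central_diff h f) \<le> ennreal A"
    using N_diff_le[OF cs cs s s, of h "-h"] f by (simp add: central_diff_def[abs_def] scaleR_diff_right)
  show "N (central_mean h f) \<le> ennreal A"
    using N_add_le[OF cs cs s s, of h "-h"] f by (simp add: central_mean_def[abs_def] scaleR_add_right)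
qed

lemma N_central_diff_chain:
  assumes v: "deriv_chain e v" and B: "N (v (Suc j)) \<le> ennreal B" "0 \<le> B" and t: "0 \<le> t"
  shows "N (central_diff (t *\<^sub>R e) (v j)) \<le> ennreal (t * B)"
proof -
  have cont: "continuous_on UNIV (v i)" for i using v by (simp add: deriv_chain_def)
  have "N (\<lambda>x. central_diff (t *\<^sub>R e) (v j) x - central_diff (0 *\<^sub>R e) (v j) x) \<le> ennreal (t * B)"
  proof (rule N_mean_value[where G = "\<lambda>s. central_mean (s *\<^sub>R e) (v (Suc j))"])
    show "((\<lambda>s. central_diff (s *\<^sub>R e) (v j) x) has_vector_derivative central_mean (\<tau> *\<^sub>R e) (v (Suc j)) x)
        (at \<tau> within {0..t})" for x \<tau>
      using central_diff_power_derivative[OF v, of 1 j x 0 \<tau>] by (simp add: has_vector_derivative_at_within)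
    show "continuous_on {0..t} (\<lambda>\<tau>. central_mean (\<tau> *\<^sub>R e) (v (Suc j)) x)" for x
      by (intro continuous_at_imp_continuous_on ballI has_vector_derivative_continuous)
        (rule central_mean_power_derivative[OF v, of 0, simplified])
  qed (use t B cont in \<open>auto intro: continuous_on_central_diff continuous_on_central_mean N_central\<close>)
  then show ?thesis by (simp add: central_diff_def[of 0])
qed

text \<open>
  Each difference can be estimated either by \<open>t\<close> times the norm of a derivative or trivially; the
  freedom to use only \<open>i\<close> of the \<open>m\<close> differences in the first way serves both parities of the order.
\<close>

lemma N_central_diff_power:
  assumes "deriv_chain e v" "N (v (j + i)) \<le> ennreal B" "0 \<le> B" "0 \<le> t" "i \<le> m"
  shows "N ((central_diff (t *\<^sub>R e) ^^ m) (v j)) \<le> ennreal (t ^ i * B)"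
  using assms(2,5)
proof (induction m arbitrary: i j)
  case 0 then show ?case by simp
next
  case (Suc m)
  have cont: "continuous_on UNIV ((central_diff (t *\<^sub>R e) ^^ m) (v j))"
    using assms(1) by (intro continuous_on_central_diff_power) (simp add: deriv_chain_def)
  show ?case
  proof (cases i)
    case 0
    then show ?thesis using Suc.IH[of j 0] Suc.prems N_central(1)[OF cont] assms(3) by simp
  next
    case (Suc i')
    then have "N ((central_diff (t *\<^sub>R e) ^^ m) (v (Suc j))) \<le> ennreal (t ^ i' * B)"
      using Suc.IH[of "Suc j" i'] Suc.prems by simp
    from N_central_diff_chain[OF deriv_chain_central_diff[OF assms(1)] this _ assms(4)]
    show ?thesis using Suc assms(3,4) by (simp add: mult.assoc)
  qed
qed

text \<open>
  \<open>P s\<close> is the truncated arcsinh series and \<open>E0 s\<close> its error. The error and its first derivative vanish at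
  \<open>s = 0\<close>, and the second derivative is a single difference expression of size \<open>r t^(r-2) |D^r|\<close>.
\<close>

lemma N_deriv_le_arcsinh:
  assumes v: "deriv_chain e v" and A: "N (v 0) \<le> ennreal A" "0 \<le> A"
    and R: "N (v r) \<le> ennreal R" "0 \<le> R" and t: "0 \<le> t" and r: "2 \<le> r"
  shows "N (\<lambda>x. t *\<^sub>R v 1 x) \<le> ennreal (2 * A + real r * t ^ r * R)"
proof -
  have cont: "continuous_on UNIV (v i)" for i using v by (simp add: deriv_chain_def)
  \<comment> \<open>The length of the truncation: \<open>r\<close> is \<open>2 n + 2\<close> or \<open>2 n + 3\<close>.\<close>
  define n where "n = (r - 2) div 2"
  have n: "r - 2 \<le> 2 * n + 1" "2 * n + 1 \<le> r" using r by (auto simp: n_def)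
  define S where "S s m f = (central_diff (s *\<^sub>R e) ^^ m) f" for s m and f :: "'a \<Rightarrow> complex"
  have contS: "continuous_on UNIV (S s m (v i))" for s m i
    unfolding S_def by (rule continuous_on_central_diff_power) (rule cont)
  define P where "P s x = (\<Sum>j<Suc n. (asinh_coeff j / (2 * real j + 1)) *\<^sub>R S s (2 * j + 1) (v 0) x)" for s x
  define E0 where "E0 s x = s *\<^sub>R v 1 x - P s x" for s x
  define E1 where "E1 s x = v 1 x - (\<Sum>j<Suc n. asinh_coeff j *\<^sub>R central_mean (s *\<^sub>R e) (S s (2 * j) (v 1)) x)" for s x
  define E2 where "E2 s x = - (((2 * real n + 1) * asinh_coeff n) *\<^sub>R S s (2 * n + 1) (v 2) x)" for s x
  have dS: "((\<lambda>s. S s m (v j) x) has_vector_derivative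
      (real m *\<^sub>R central_mean (s *\<^sub>R e) (S s (m - 1) (v (Suc j))) x)) (at s)" for s m j x
    using central_diff_power_derivative[OF v, of m j x 0 s] by (simp add: S_def)
  have dM: "((\<lambda>s. central_mean (s *\<^sub>R e) (S s m (v 1)) x) has_vector_derivative
      (real m *\<^sub>R (S s (m - 1) (v 2) x + S s (m + 1) (v 2) x) + S s (m + 1) (v 2) x)) (at s)" for s m x
    using central_mean_power_derivative[OF v, of m 1 x s] unfolding S_def Suc_1 .
  have dP: "((\<lambda>s. P s x) has_vector_derivative
      (\<Sum>j<Suc n. asinh_coeff j *\<^sub>R central_mean (s *\<^sub>R e) (S s (2 * j) (v 1)) x)) (at s)" for s x
    unfolding P_def
  proof (rule has_vector_derivative_sum)
    fix j
    have "((\<lambda>s. (asinh_coeff j / (2 * real j + 1)) *\<^sub>R S s (2 * j + 1) (v 0) x) has_vector_derivative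
      (asinh_coeff j / (2 * real j + 1)) *\<^sub>R (real (2 * j + 1) *\<^sub>R central_mean (s *\<^sub>R e) (S s (2 * j + 1 - 1) (v (Suc 0))) x)) (at s)"
      by (rule bounded_linear.has_vector_derivative[OF bounded_linear_scaleR_right dS])
    moreover have "asinh_coeff j / (2 * real j + 1) * real (2 * j + 1) = asinh_coeff j"
      by (simp add: field_simps)
    ultimately show "((\<lambda>s. (asinh_coeff j / (2 * real j + 1)) *\<^sub>R S s (2 * j + 1) (v 0) x) has_vector_derivative
      asinh_coeff j *\<^sub>R central_mean (s *\<^sub>R e) (S s (2 * j) (v 1)) x) (at s)"
      by (simp only: scaleR_scaleR diff_add_inverse2 One_nat_def)
  qed
  \<comment> \<open>\<open>E1\<close> and \<open>E2\<close> are the first two derivatives of \<open>E0\<close>; for \<open>E2\<close> this is the telescoping identity.\<close>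
  have dE0: "((\<lambda>s. E0 s x) has_vector_derivative E1 s x) (at s)" for s x
    unfolding E0_def E1_def
    by (intro has_vector_derivative_diff dP) (auto intro!: derivative_eq_intros)
  have dE1: "((\<lambda>s. E1 s x) has_vector_derivative E2 s x) (at s)" for s x
  proof -
    have "((\<lambda>s. E1 s x) has_vector_derivative (0 -
       (\<Sum>j<Suc n. asinh_coeff j *\<^sub>R (real (2 * j) *\<^sub>R (S s (2 * j - 1) (v 2) x + S s (2 * j + 1) (v 2) x)
          + S s (2 * j + 1) (v 2) x)))) (at s)"
      unfolding E1_def
      by (intro has_vector_derivative_diff has_vector_derivative_const has_vector_derivative_sum
          bounded_linear.has_vector_derivative[OF bounded_linear_scaleR_right] dM)
    then show ?thesis
      using asinh_second_derivative_telescope[of "\<lambda>m. S s m (v 2) x" n] by (simp only: E2_def diff_0)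
  qed
  have S0: "S 0 m f x = 0" if "0 < m" for m f x
    using that by (cases m) (auto simp: S_def central_diff_def)
  have E0_0: "E0 0 x = 0" for x by (simp add: E0_def P_def S0)
  have E1_0: "E1 0 x = 0" for x
  proof -
    have "(\<Sum>j<Suc n. asinh_coeff j *\<^sub>R central_mean (0 *\<^sub>R e) (S 0 (2 * j) (v 1)) x)
      = (\<Sum>j<Suc n. if j = 0 then v 1 x else 0)"
    proof (intro sum.cong refl)
      fix j
      have "central_mean 0 (S 0 m f) x = 0" if "0 < m" for m f
        by (simp add: central_mean_def S0[OF that])
      moreover have "central_mean 0 (v 1) x = v 1 x"
        by (simp add: central_mean_def scaleR_2[symmetric])
      ultimately show "asinh_coeff j *\<^sub>R central_mean (0 *\<^sub>R e) (S 0 (2 * j) (v 1)) x = (if j = 0 then v 1 x else 0)"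
        by (cases "j = 0") (auto simp: asinh_coeff_0 S_def)
    qed
    then show ?thesis by (simp add: E1_def)
  qed
  have cE1: "continuous_on UNIV (E1 s)" for s
    unfolding E1_def by (intro continuous_intros cont continuous_on_central_mean contS)
  have cP: "continuous_on UNIV (P s)" for s
    unfolding P_def by (intro continuous_intros contS)
  have cE0: "continuous_on UNIV (E0 s)" for s
    unfolding E0_def by (intro continuous_intros cont cP)
  have cE2: "continuous_on UNIV (E2 s)" for s
    unfolding E2_def by (intro continuous_intros contS)
  have tcont: "continuous_on T (\<lambda>s. E1 s x)" for T x
    by (intro continuous_at_imp_continuous_on ballI has_vector_derivative_continuous[OF dE1])
  have tcont2: "continuous_on T (\<lambda>s. E2 s x)" for T x
    unfolding E2_def
    by (intro continuous_intros continuous_at_imp_continuous_on ballI has_vector_derivative_continuous[OF dS])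
  have NE2: "N (E2 s) \<le> ennreal (real r * t ^ (r - 2) * R)" if s: "0 \<le> s" "s \<le> t" for s
  proof -
    have "2 + (r - 2) = r" using r by simp
    then have NS: "N (S s (2 * n + 1) (v 2)) \<le> ennreal (s ^ (r - 2) * R)"
      unfolding S_def
      by (intro N_central_diff_power[OF v]) (use R s n in \<open>simp_all only:\<close>)
    have "\<bar>- ((2 * real n + 1) * asinh_coeff n)\<bar> * (s ^ (r - 2) * R) \<le> real r * (t ^ (r - 2) * R)"
    proof (rule mult_mono)
      have "\<bar>- ((2 * real n + 1) * asinh_coeff n)\<bar> \<le> (2 * real n + 1) * 1"
        unfolding abs_minus_cancel abs_mult using asinh_coeff_abs_le[of n] by (intro mult_mono) auto
      also have "\<dots> \<le> real r" using of_nat_mono[OF n(2), where 'a = real] by simp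
      finally show "\<bar>- ((2 * real n + 1) * asinh_coeff n)\<bar> \<le> real r" .
      show "s ^ (r - 2) * R \<le> t ^ (r - 2) * R"
        using s R by (intro mult_right_mono power_mono) auto
    qed (use s R in auto)
    from N_scale_le[OF contS NS _ this] show ?thesis
      using s R by (simp add: E2_def[abs_def] mult.assoc)
  qed
  have NE1: "N (E1 s) \<le> ennreal (t * (real r * t ^ (r - 2) * R))" if s: "0 \<le> s" "s \<le> t" for s
  proof -
    have "N (\<lambda>x. E1 s x - E1 0 x) \<le> ennreal (s * (real r * t ^ (r - 2) * R))"
      by (rule N_mean_value[where G = E2])
        (use s R t cE1 cE2 tcont2 NE2 dE1 in \<open>auto intro: has_vector_derivative_at_within\<close>)
    also have "\<dots> \<le> ennreal (t * (real r * t ^ (r - 2) * R))"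
      using s R t by (intro ennreal_leI mult_right_mono) auto
    finally show ?thesis by (simp add: E1_0)
  qed
  have "N (\<lambda>x. E0 t x - E0 0 x) \<le> ennreal (t * (t * (real r * t ^ (r - 2) * R)))"
    by (rule N_mean_value[where G = E1])
      (use R t cE0 cE1 tcont NE1 dE0 in \<open>auto intro: has_vector_derivative_at_within\<close>)
  moreover have "t * (t * (real r * t ^ (r - 2) * R)) = real r * t ^ r * R"
  proof -
    have "t * (t * t ^ (r - 2)) = t ^ Suc (Suc (r - 2))" by simp
    also have "Suc (Suc (r - 2)) = r" using r by simp
    finally show ?thesis by (simp add: mult.assoc mult.left_commute)
  qed
  ultimately have NE0: "N (E0 t) \<le> ennreal (real r * t ^ r * R)" by (simp add: E0_0)
  have NP: "N (P t) \<le> ennreal (2 * A)"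
  proof -
    have "N (P t) \<le> ennreal (\<Sum>j<Suc n. \<bar>asinh_coeff j / (2 * real j + 1)\<bar> * A)"
      unfolding P_def
    proof (rule N_sum_le)
      fix j
      show "N (S t (2 * j + 1) (v 0)) \<le> ennreal A"
        using N_central_diff_power[OF v, of 0 0 A t "2 * j + 1"] A t by (simp add: S_def)
    qed (use contS A in auto)
    also have "\<dots> \<le> ennreal (2 * A)"
      using asinh_coeff_sum[of "Suc n"] A
      by (intro ennreal_leI) (simp only: sum_distrib_right[symmetric] mult_right_mono)
    finally show ?thesis .
  qed
  have "N (\<lambda>x. P t x + E0 t x) \<le> ennreal (2 * A + real r * t ^ r * R)"
    by (rule N_add_le[OF cP cE0 NP NE0]) (use A R t in auto)
  then show ?thesis by (simp add: E0_def)
qed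

text \<open>
  The factor \<open>r\<close> in front of the highest derivative is absorbed by halving the step, as \<open>r \<le> 2^r\<close>.
\<close>

lemma N_deriv_le:
  assumes v: "deriv_chain e v" and A: "N (v 0) \<le> ennreal A" "0 \<le> A"
    and R: "N (v r) \<le> ennreal R" "0 \<le> R" and t: "0 < t" and r: "1 \<le> r"
  shows "N (v 1) \<le> ennreal ((4 * A + 2 * t ^ r * R) / t)"
proof (cases "r = 1")
  case True
  have "R \<le> (4 * A + 2 * t ^ r * R) / t"
    using True A R t by (simp add: field_simps)
  then show ?thesis using R True by (auto intro: order_trans ennreal_leI)
next
  case False
  then have r2: "2 \<le> r" using r by simp
  have cont: "continuous_on UNIV (v i)" for i using v by (simp add: deriv_chain_def)
  have "N (\<lambda>x. (t/2) *\<^sub>R v 1 x) \<le> ennreal (2 * A + real r * (t/2) ^ r * R)"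
    by (rule N_deriv_le_arcsinh[OF v A R _ r2]) (use t in auto)
  then have "N (\<lambda>x. (2/t) *\<^sub>R ((t/2) *\<^sub>R v 1 x)) \<le> ennreal ((2/t) * (2 * A + real r * (t/2) ^ r * R))"
    by (rule N_scale_le[rotated]) (use A R t in \<open>auto intro!: continuous_intros cont\<close>)
  moreover have "(2/t) * (2 * A + real r * (t/2) ^ r * R) \<le> (4 * A + 2 * t ^ r * R) / t"
  proof -
    have "real r \<le> 2 ^ r" using of_nat_less_two_power[of r] by (metis less_imp_le)
    then have "real r * (t/2) ^ r \<le> t ^ r"
      using t by (simp add: power_divide divide_le_eq mult.commute)
    then have "real r * (t/2) ^ r * R \<le> t ^ r * R" using R by (intro mult_right_mono) auto
    then have "2 * (2 * A + real r * (t/2) ^ r * R) / t \<le> (4 * A + 2 * t ^ r * R) / t"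
      using t by (intro divide_right_mono) auto
    then show ?thesis by simp
  qed
  ultimately show ?thesis using t by (auto intro: order_trans ennreal_leI)
qed

end

lemma deriv_chain_partial_deriv:
  assumes "smooth_on UNIV g"
  shows "deriv_chain (axis i 1) (\<lambda>j. (partial_deriv i ^^ j) g)"
proof -
  have s: "smooth_on UNIV ((partial_deriv i ^^ j) g)" for j
    by (induction j) (auto intro: assms smooth_on_partial_deriv)
  show ?thesis unfolding deriv_chain_def
    using smooth_on_continuous_on[OF s] smooth_on_has_partial_deriv[OF open_UNIV s] by auto
qed

text \<open>
  Adding one direction \<open>i\<close> at a time: the one-dimensional inequality in direction \<open>i\<close> only involves a word
  of full length \<open>r\<close> besides the word already treated. The step \<open>t\<close> stays the same throughout, so each
  direction costs a constant factor.
\<close>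

lemma Landau_Kolmogorov_words:
  fixes g :: "real^'n::finite \<Rightarrow> complex"
  assumes "translation_norm N" and g: "smooth_on UNIV g"
    and A: "N g \<le> ennreal A" "0 \<le> A"
    and R: "\<And>w. length w = r \<Longrightarrow> N (word_deriv w g) \<le> ennreal R" "0 \<le> R" and t: "0 < t"
    and w: "length w \<le> r"
  shows "N (word_deriv w g) \<le> ennreal (6 ^ length w * (A + t ^ r * R) / t ^ length w)"
  using w
proof (induction w)
  case Nil
  have "A \<le> A + t ^ r * R" using R t by simp
  then show ?case using A by (auto intro: order_trans ennreal_leI)
next
  case (Cons i w)
  interpret translation_norm N by fact
  let ?u = "word_deriv w g" and ?l = "length w" and ?B = "A + t ^ r * R"
  have B: "0 \<le> ?B" using A R t by simp
  have len: "?l < r" using Cons.prems by simp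
  have "N ((partial_deriv i ^^ 1) ?u) \<le> ennreal ((4 * (6 ^ ?l * ?B / t ^ ?l) + 2 * t ^ (r - ?l) * R) / t)"
  proof (rule N_deriv_le[OF deriv_chain_partial_deriv])
    show "smooth_on UNIV ?u" by (rule smooth_on_word_deriv[OF g])
    show "N ((partial_deriv i ^^ 0) ?u) \<le> ennreal (6 ^ ?l * ?B / t ^ ?l)"
      using Cons by simp
    show "N ((partial_deriv i ^^ (r - ?l)) ?u) \<le> ennreal R"
      using R(1)[of "replicate (r - ?l) i @ w"] len by (simp add: word_deriv_replicate)
  qed (use B R t len in auto)
  also have "(4 * (6 ^ ?l * ?B / t ^ ?l) + 2 * t ^ (r - ?l) * R) / t
      = (4 * (6 ^ ?l * ?B) + 2 * (t ^ r * R)) / t ^ Suc ?l"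
    using t len by (simp add: field_simps power_add[symmetric])
  also have "\<dots> \<le> 6 ^ Suc ?l * ?B / t ^ Suc ?l"
  proof (rule divide_right_mono)
    have "1 * (t ^ r * R) \<le> 6 ^ ?l * ?B" using A R t by (intro mult_mono) auto
    moreover have "4 * X + 2 * Y \<le> 6 * X" if "1 * Y \<le> X" for X Y :: real using that by simp
    ultimately show "4 * (6 ^ ?l * ?B) + 2 * (t ^ r * R) \<le> 6 ^ Suc ?l * ?B"
      by (simp only: power_Suc mult.assoc)
  qed (use t in auto)
  finally show ?case by (simp add: ennreal_leI)
qed

lemma translation_norm_Lp_norm:
  assumes "1 \<le> p"
  shows "translation_norm (Lp_norm p (UNIV :: (real^'n::finite) set))"
proof -
  interpret fn_norm "Lp_norm p (UNIV :: (real^'n) set)" UNIV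
    by (rule fn_norm_Lp_norm[OF assms]) simp
  show ?thesis
  proof
    fix f :: "real^'n \<Rightarrow> complex" and h assume f: "continuous_on UNIV f"
    show "Lp_norm p UNIV (\<lambda>x. f (x + h)) \<le> Lp_norm p UNIV f"
    proof (cases "Lp_norm p UNIV f")
      case (real a)
      then show ?thesis
        using Lp_norm_translate_le[OF assms open_UNIV open_UNIV f, of h a] by simp
    qed simp
  qed
qed

section \<open>Intermediate derivatives near a set\<close>

lemma power_self_le_fact: "real r ^ r \<le> 3 ^ r * fact r"
proof -
  have "(\<lambda>n. real r ^ n /\<^sub>R fact n) sums exp (real r)" by (rule exp_converges)
  then have "(\<Sum>n\<in>{r}. real r ^ n /\<^sub>R fact n) \<le> exp (real r)"
    using sum_le_suminf[of "\<lambda>n. real r ^ n /\<^sub>R fact n" "{r}"]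
    by (auto simp: sums_iff)
  also have "exp (real r) = exp 1 ^ r" by (simp add: exp_of_nat_mult[symmetric])
  also have "\<dots> \<le> 3 ^ r" by (intro power_mono exp_le) auto
  finally show ?thesis by (simp add: field_simps)
qed

lemma real_le_two_power: "real r \<le> 2 ^ r"
  using of_nat_less_two_power[of r] by (metis less_imp_le)

text \<open>
  A Cauchy estimate: the numerator on the right dominates the polynomial on the circle of radius \<open>\<rho>\<close>.
\<close>

lemma coeff_prod_linear_le:
  fixes a b :: "'i \<Rightarrow> real"
  assumes "finite A" "0 < \<rho>"
  shows "\<bar>coeff (\<Prod>j\<in>A. smult (a j) [:b j, 1:]) s\<bar> \<le> (\<Prod>j\<in>A. \<bar>a j\<bar> * (\<bar>b j\<bar> + \<rho>)) / \<rho> ^ s"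
  using assms(1)
proof (induction A arbitrary: s rule: finite_induct)
  case empty
  then show ?case using assms(2) by (cases s) auto
next
  case (insert j A)
  let ?p = "\<Prod>j\<in>A. smult (a j) [:b j, 1:]" and ?P = "\<Prod>j\<in>A. \<bar>a j\<bar> * (\<bar>b j\<bar> + \<rho>)"
  have P: "0 \<le> ?P" using assms(2) by (intro prod_nonneg) auto
  have co: "coeff (smult (a j) [:b j, 1:] * ?p) s = a j * (b j * coeff ?p s + (case s of 0 \<Rightarrow> 0 | Suc k \<Rightarrow> coeff ?p k))"
    by (cases s) (auto simp: algebra_simps)
  have tail: "\<bar>case s of 0 \<Rightarrow> 0 | Suc k \<Rightarrow> coeff ?p k\<bar> \<le> \<rho> * (?P / \<rho> ^ s)"
  proof (cases s)
    case 0 then show ?thesis using P assms(2) by simp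
  next
    case (Suc k) then show ?thesis using insert.IH[of k] assms(2) by simp
  qed
  have "\<bar>b j * coeff ?p s + (case s of 0 \<Rightarrow> 0 | Suc k \<Rightarrow> coeff ?p k)\<bar>
      \<le> \<bar>b j\<bar> * (?P / \<rho> ^ s) + \<rho> * (?P / \<rho> ^ s)"
  proof (intro order_trans[OF abs_triangle_ineq] add_mono tail)
    show "\<bar>b j * coeff ?p s\<bar> \<le> \<bar>b j\<bar> * (?P / \<rho> ^ s)"
      unfolding abs_mult by (rule mult_left_mono[OF insert.IH]) simp
  qed
  then have "\<bar>a j\<bar> * \<bar>b j * coeff ?p s + (case s of 0 \<Rightarrow> 0 | Suc k \<Rightarrow> coeff ?p k)\<bar>
      \<le> \<bar>a j\<bar> * (\<bar>b j\<bar> * (?P / \<rho> ^ s) + \<rho> * (?P / \<rho> ^ s))"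
    by (rule mult_left_mono) simp
  then show ?case
    unfolding prod.insert[OF insert.hyps] co abs_mult by (simp add: algebra_simps add_divide_distrib)
qed

lemma prod_node_distances:
  assumes "i < r"
  shows "(\<Prod>j\<in>{..<r} - {i}. \<bar>real i - real j\<bar>) = fact i * fact (r - 1 - i)"
proof -
  have split: "{..<r} - {i} = {..<i} \<union> {i<..<r}" using assms by auto
  have "(\<Prod>j\<in>{..<i}. \<bar>real i - real j\<bar>) = (\<Prod>j=0..<i. real (i - j))"
    by (intro prod.cong) (auto simp: of_nat_diff)
  also have "\<dots> = fact i" by (simp add: fact_prod_rev)
  finally have 1: "(\<Prod>j\<in>{..<i}. \<bar>real i - real j\<bar>) = fact i" .
  have "(\<Prod>j\<in>{i<..<r}. \<bar>real i - real j\<bar>) = (\<Prod>j\<in>{1..r - 1 - i}. real j)"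
    by (rule prod.reindex_bij_witness[of _ "\<lambda>j. j + i" "\<lambda>j. j - i"]) (use assms in auto)
  also have "\<dots> = fact (r - 1 - i)" by (simp add: fact_prod)
  finally have 2: "(\<Prod>j\<in>{i<..<r}. \<bar>real i - real j\<bar>) = fact (r - 1 - i)" .
  have "{..<i} \<inter> {i<..<r} = {}" by auto
  then show ?thesis
    by (simp only: split prod.union_disjoint[OF finite_lessThan finite_greaterThanLessThan] 1 2)
qed

text \<open>
  Applied to the values at \<open>0, ..., r - 1\<close>, the weights give the \<open>s\<close>-th derivative at 0 of every polynomial
  of degree less than \<open>r\<close>: they are the derivatives of the Lagrange basis polynomials.
\<close>

lemma differentiation_weights:
  assumes s: "s < r"
  shows "\<exists>w :: nat \<Rightarrow> real. (\<forall>l<r. (\<Sum>i<r. w i * real i ^ l) = (if l = s then fact s else 0)) \<and>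
    (\<Sum>i<r. \<bar>w i\<bar>) \<le> 24 ^ r"
proof -
  define L where "L i = (\<Prod>j\<in>{..<r} - {i}. smult (1 / (real i - real j)) [:- real j, 1:])" for i
  define w where "w i = fact s * coeff (L i) s" for i
  have L: "poly (L i) (real k) = (if k = i then 1 else 0)" if "k < r" for i k
  proof (cases "k = i")
    case True
    then show ?thesis unfolding L_def poly_prod
      by (auto intro!: prod.neutral simp: diff_divide_distrib[symmetric])
  next
    case False
    then have "poly (L i) (real k) = 0" unfolding L_def poly_prod
      using that by (intro prod_zero) auto
    then show ?thesis using False by simp
  qed
  have deg: "degree (L i) < r" if "i < r" for i
  proof -
    have "degree (L i) \<le> sum (degree \<circ> (\<lambda>j. smult (1 / (real i - real j)) [:- real j, 1:])) ({..<r} - {i})"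
      unfolding L_def by (rule degree_prod_sum_le) simp
    also have "\<dots> \<le> sum (\<lambda>_. 1) ({..<r} - {i})"
      by (intro sum_mono) (auto simp: degree_smult_le)
    also have "\<dots> < r" using that by simp
    finally show ?thesis .
  qed
  have interp: "(\<Sum>i<r. smult (real i ^ l) (L i)) = monom 1 l" if l: "l < r" for l
  proof (rule poly_eqI_degree[where A = "real ` {..<r}"])
    fix x assume "x \<in> real ` {..<r}"
    then obtain k where k: "x = real k" "k < r" by auto
    have "poly (\<Sum>i<r. smult (real i ^ l) (L i)) x = (\<Sum>i<r. if k = i then real i ^ l else 0)"
      unfolding poly_sum by (intro sum.cong refl) (use k L in auto)
    also have "\<dots> = real k ^ l" using k by simp
    finally show "poly (\<Sum>i<r. smult (real i ^ l) (L i)) x = poly (monom 1 l) x"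
      using k by (simp add: poly_monom)
  next
    have c: "card (real ` {..<r}) = r" by (simp add: card_image inj_on_def)
    show "degree (\<Sum>i<r. smult (real i ^ l) (L i)) < card (real ` {..<r})"
      unfolding c using deg l by (intro degree_sum_less) (auto intro: le_less_trans[OF degree_smult_le])
    show "degree (monom (1::real) l) < card (real ` {..<r})" unfolding c using l by (simp add: degree_monom_eq)
  qed
  have moments: "(\<Sum>i<r. w i * real i ^ l) = (if l = s then fact s else 0)" if l: "l < r" for l
  proof -
    have "(\<Sum>i<r. w i * real i ^ l) = fact s * coeff (\<Sum>i<r. smult (real i ^ l) (L i)) s"
      by (simp add: w_def coeff_sum sum_distrib_left mult_ac)
    also have "\<dots> = (if l = s then fact s else 0)" by (simp add: interp[OF l])
    finally show ?thesis .
  qed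
  have bound: "\<bar>w i\<bar> \<le> 12 ^ r" if i: "i < r" for i
  proof -
    have r: "0 < real r" using s by simp
    \<comment> \<open>Radius \<open>r\<close>, so that the division by \<open>r^s\<close> compensates the factor \<open>fact s\<close> in \<open>w i\<close>.\<close>
    have "\<bar>coeff (L i) s\<bar> \<le> (\<Prod>j\<in>{..<r} - {i}. \<bar>1 / (real i - real j)\<bar> * (\<bar>- real j\<bar> + real r)) / real r ^ s"
      unfolding L_def by (rule coeff_prod_linear_le) (use r in auto)
    also have "\<dots> \<le> (\<Prod>j\<in>{..<r} - {i}. \<bar>1 / (real i - real j)\<bar> * (2 * real r)) / real r ^ s"
      using r by (intro divide_right_mono prod_mono) (auto intro!: divide_right_mono)
    also have "(\<Prod>j\<in>{..<r} - {i}. \<bar>1 / (real i - real j)\<bar> * (2 * real r))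
        = (2 * real r) ^ (r - 1) / (\<Prod>j\<in>{..<r} - {i}. \<bar>real i - real j\<bar>)"
      using i by (simp add: prod.distrib prod_dividef)
    also have "\<dots> = (2 * real r) ^ (r - 1) * real ((r - 1) choose i) / fact (r - 1)"
      unfolding prod_node_distances[OF i] using i by (simp add: binomial_fact)
    also have "\<dots> \<le> (2 * real r) ^ (r - 1) * 2 ^ (r - 1) / fact (r - 1)"
    proof (intro divide_right_mono mult_left_mono)
      have "(r - 1) choose i \<le> 2 ^ (r - 1)" by (rule binomial_le_pow2)
      then show "real ((r - 1) choose i) \<le> 2 ^ (r - 1)"
        by (metis of_nat_le_iff of_nat_numeral of_nat_power)
    qed auto
    also have "\<dots> = 4 ^ (r - 1) * (real r ^ r / fact r)"
    proof -
      have "(fact r :: real) = real r * fact (r - 1)" using i by (intro fact_reduce) simp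
      moreover have "real r ^ r = real r * real r ^ (r - 1)" using i by (cases r) auto
      ultimately have "real r ^ r / fact r = real r ^ (r - 1) / fact (r - 1)" using i by simp
      moreover have "(2 * real r) ^ (r - 1) * 2 ^ (r - 1) = 4 ^ (r - 1) * real r ^ (r - 1)"
        by (simp only: power_mult_distrib[symmetric]) simp
      ultimately show ?thesis by simp
    qed
    also have "\<dots> \<le> 4 ^ r * 3 ^ r"
      using power_self_le_fact[of r] by (intro mult_mono power_increasing) (auto simp: field_simps)
    finally have c: "\<bar>coeff (L i) s\<bar> \<le> 12 ^ r / real r ^ s"
      using r by (simp add: divide_right_mono power_mult_distrib[symmetric])
    have "(fact s :: real) \<le> real s ^ s" using fact_le_power[of s, where 'a = real] by simp
    also have "\<dots> \<le> real r ^ s" using s by (intro power_mono) auto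
    finally have f: "(fact s :: real) \<le> real r ^ s" .
    have "\<bar>w i\<bar> \<le> real r ^ s * (12 ^ r / real r ^ s)"
      unfolding w_def abs_mult using c f by (intro mult_mono) auto
    then show ?thesis using r by simp
  qed
  have "(\<Sum>i<r. \<bar>w i\<bar>) \<le> (\<Sum>i<r. 12 ^ r)" using bound by (intro sum_mono) auto
  also have "\<dots> = real r * 12 ^ r" by simp
  also have "\<dots> \<le> 2 ^ r * 12 ^ r" by (intro mult_right_mono real_le_two_power) auto
  also have "\<dots> = 24 ^ r" by (simp add: power_mult_distrib[symmetric])
  finally show ?thesis using moments by (intro exI[of _ w]) auto
qed

lemma Taylor_sum_derivative:
  fixes V :: "nat \<Rightarrow> real \<Rightarrow> complex"
  assumes V: "\<And>j. (V j has_vector_derivative V (Suc j) \<tau>) (at \<tau> within S)"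
  shows "((\<lambda>\<sigma>. \<Sum>l<Suc n. ((T - \<sigma>) ^ l / fact l) *\<^sub>R V l \<sigma>) has_vector_derivative
    ((T - \<tau>) ^ n / fact n) *\<^sub>R V (Suc n) \<tau>) (at \<tau> within S)"
proof (induction n)
  case 0
  show ?case using V[of 0] by simp
next
  case (Suc n)
  have c: "((\<lambda>\<sigma>. (T - \<sigma>) ^ Suc n / fact (Suc n)) has_real_derivative - ((T - \<tau>) ^ n / fact n)) (at \<tau> within S)"
  proof -
    have "((\<lambda>\<sigma>. T - \<sigma>) has_real_derivative -1) (at \<tau> within S)" by (auto intro!: derivative_eq_intros)
    from DERIV_cdivide[OF DERIV_power[OF this, of "Suc n"], of "fact (Suc n)"]
    show ?thesis by (simp add: fact_Suc del: of_nat_Suc power_Suc)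
  qed
  have "((\<lambda>\<sigma>. ((T - \<sigma>) ^ Suc n / fact (Suc n)) *\<^sub>R V (Suc n) \<sigma>) has_vector_derivative
     ((T - \<tau>) ^ Suc n / fact (Suc n)) *\<^sub>R V (Suc (Suc n)) \<tau> + (- ((T - \<tau>) ^ n / fact n)) *\<^sub>R V (Suc n) \<tau>) (at \<tau> within S)"
    by (rule has_vector_derivative_scaleR[OF c V])
  from has_vector_derivative_add[OF Suc this] show ?case
    by (subst sum.lessThan_Suc) (simp add: algebra_simps)
qed

context fn_norm
begin

text \<open>
  The Taylor polynomial at 0, evaluated at \<open>T\<close>, differs from \<open>v 0 T\<close> by an integral of \<open>v r\<close>. It is the
  curve \<open>F\<close> obtained by moving the centre of the expansion from 0 to \<open>T\<close> that the mean value
  inequality is applied to.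
\<close>

lemma N_Taylor_polynomial_le:
  fixes v :: "nat \<Rightarrow> real \<Rightarrow> 'a \<Rightarrow> complex"
  assumes T: "0 \<le> T" and r: "0 < r"
    and der: "\<And>j x \<tau>. x \<in> \<Omega> \<Longrightarrow> 0 \<le> \<tau> \<Longrightarrow> \<tau> \<le> T \<Longrightarrow>
      ((\<lambda>\<sigma>. v j \<sigma> x) has_vector_derivative v (Suc j) \<tau> x) (at \<tau>)"
    and cont: "\<And>j \<tau>. 0 \<le> \<tau> \<Longrightarrow> \<tau> \<le> T \<Longrightarrow> continuous_on \<Omega> (v j \<tau>)"
    and A: "N (v 0 T) \<le> ennreal A" "0 \<le> A"
    and R: "\<And>\<tau>. 0 \<le> \<tau> \<Longrightarrow> \<tau> \<le> T \<Longrightarrow> N (v r \<tau>) \<le> ennreal R" "0 \<le> R"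
  shows "N (\<lambda>x. \<Sum>l<r. (T ^ l / fact l) *\<^sub>R v l 0 x) \<le> ennreal (A + T ^ r / fact (r - 1) * R)"
proof -
  obtain n where n: "r = Suc n" using r by (cases r) auto
  define F where "F \<sigma> x = (\<Sum>l<r. ((T - \<sigma>) ^ l / fact l) *\<^sub>R v l \<sigma> x)" for \<sigma> x
  define G where "G \<sigma> x = ((T - \<sigma>) ^ n / fact n) *\<^sub>R v r \<sigma> x" for \<sigma> x
  have FT: "F T = v 0 T"
    unfolding F_def n sum.lessThan_Suc_shift by (simp add: power_0_left)
  have cF: "continuous_on \<Omega> (F \<sigma>)" if "0 \<le> \<sigma>" "\<sigma> \<le> T" for \<sigma>
    unfolding F_def by (intro continuous_intros cont that)
  have cG: "continuous_on \<Omega> (G \<sigma>)" if "0 \<le> \<sigma>" "\<sigma> \<le> T" for \<sigma>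
    unfolding G_def by (intro continuous_intros cont that)
  have "N (\<lambda>x. F T x - F 0 x) \<le> ennreal (T * (T ^ n / fact n * R))"
  proof (rule N_mean_value[where G = G])
    fix x \<tau> assume x: "x \<in> \<Omega>" "0 \<le> \<tau>" "\<tau> \<le> T"
    show "((\<lambda>s. F s x) has_vector_derivative G \<tau> x) (at \<tau> within {0..T})"
      unfolding F_def G_def n
      by (rule Taylor_sum_derivative[where V = "\<lambda>j s. v j s x"])
        (rule has_vector_derivative_at_within[OF der[OF x]])
  next
    fix x assume x: "x \<in> \<Omega>"
    have "continuous_on {0..T} (\<lambda>\<tau>. v r \<tau> x)"
      by (intro continuous_at_imp_continuous_on ballI has_vector_derivative_continuous[OF der]) (use x in auto)
    then show "continuous_on {0..T} (\<lambda>\<tau>. G \<tau> x)"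
      unfolding G_def by (intro continuous_intros) auto
  next
    fix \<tau> assume \<tau>: "0 \<le> \<tau>" "\<tau> \<le> T"
    have "\<bar>(T - \<tau>) ^ n / fact n\<bar> \<le> T ^ n / fact n"
      using \<tau> by (simp add: abs_mult power_abs divide_right_mono power_mono)
    then show "N (G \<tau>) \<le> ennreal (T ^ n / fact n * R)"
      unfolding G_def by (intro N_scale_le[OF cont[OF \<tau>] R(1)[OF \<tau>] R(2)] mult_right_mono R)
  qed (use T R cF cG in auto)
  then have rem: "N (\<lambda>x. F T x - F 0 x) \<le> ennreal (T ^ r / fact (r - 1) * R)"
    by (simp add: n mult_ac)
  have "N (\<lambda>x. v 0 T x - (F T x - F 0 x)) \<le> ennreal (A + T ^ r / fact (r - 1) * R)"
    by (rule N_diff_le[OF _ _ A(1) rem]) (use T A R in \<open>auto intro!: cont cF continuous_intros\<close>)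
  then show ?thesis unfolding FT by (simp add: F_def)
qed

text \<open>
  The derivative of order \<open>s\<close> is recovered from the values of the Taylor polynomial at the points
  \<open>0, h, ..., (r - 1) h\<close>.
\<close>

lemma N_intermediate_derivative_le:
  fixes v :: "nat \<Rightarrow> real \<Rightarrow> 'a \<Rightarrow> complex"
  assumes h: "0 < h" and s: "s \<le> r"
    and der: "\<And>j x \<tau>. x \<in> \<Omega> \<Longrightarrow> 0 \<le> \<tau> \<Longrightarrow> \<tau> \<le> real r * h \<Longrightarrow>
      ((\<lambda>\<sigma>. v j \<sigma> x) has_vector_derivative v (Suc j) \<tau> x) (at \<tau>)"
    and cont: "\<And>j \<tau>. 0 \<le> \<tau> \<Longrightarrow> \<tau> \<le> real r * h \<Longrightarrow> continuous_on \<Omega> (v j \<tau>)"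
    and A: "\<And>\<tau>. 0 \<le> \<tau> \<Longrightarrow> \<tau> \<le> real r * h \<Longrightarrow> N (v 0 \<tau>) \<le> ennreal A" "0 \<le> A"
    and R: "\<And>\<tau>. 0 \<le> \<tau> \<Longrightarrow> \<tau> \<le> real r * h \<Longrightarrow> N (v r \<tau>) \<le> ennreal R" "0 \<le> R"
  shows "N (v s 0) \<le> ennreal (144 ^ r * (A + h ^ r * R) / h ^ s)"
proof (cases "s = r")
  case True
  have "1 * R \<le> 144 ^ r * (A / h ^ r + R)"
    using A R h by (intro mult_mono) auto
  also have "\<dots> = 144 ^ r * (A + h ^ r * R) / h ^ s"
    using True h by (simp add: field_simps)
  finally show ?thesis using R(1)[of 0] h True by (auto intro: order_trans ennreal_leI)
next
  case False
  then have sr: "s < r" using s by simp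
  obtain w :: "nat \<Rightarrow> real" where w: "\<And>l. l < r \<Longrightarrow> (\<Sum>i<r. w i * real i ^ l) = (if l = s then fact s else 0)"
    "(\<Sum>i<r. \<bar>w i\<bar>) \<le> 24 ^ r"
    using differentiation_weights[OF sr] by auto
  let ?B = "A + h ^ r * R"
  have B: "0 \<le> ?B" using A R h by simp
  have c0: "continuous_on \<Omega> (v l 0)" for l using cont[of 0] h by simp
  define P where "P i x = (\<Sum>l<r. ((real i * h) ^ l / fact l) *\<^sub>R v l 0 x)" for i x
  have cP: "continuous_on \<Omega> (P i)" for i unfolding P_def by (intro continuous_intros c0)
  have NP: "N (P i) \<le> ennreal (6 ^ r * ?B)" if i: "i < r" for i
  proof -
    have ih: "0 \<le> real i * h" "real i * h \<le> real r * h" using i h by auto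
    have "N (P i) \<le> ennreal (A + (real i * h) ^ r / fact (r - 1) * R)"
      unfolding P_def
      by (rule N_Taylor_polynomial_le) (use ih sr A R in \<open>auto intro!: der cont\<close>)
    also have "(real i * h) ^ r / fact (r - 1) \<le> 6 ^ r * h ^ r"
    proof -
      have "(real i * h) ^ r / fact (r - 1) \<le> (real r * h) ^ r / fact (r - 1)"
        using ih by (intro divide_right_mono power_mono) auto
      also have "\<dots> = real r * (real r ^ r / fact r) * h ^ r"
      proof -
        have "(fact r :: real) = real r * fact (r - 1)" using sr by (intro fact_reduce) simp
        then show ?thesis using sr by (simp add: power_mult_distrib)
      qed
      also have "\<dots> \<le> 2 ^ r * 3 ^ r * h ^ r"
        using power_self_le_fact[of r] h
        by (intro mult_right_mono mult_mono real_le_two_power) (auto simp: field_simps)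
      also have "(2::real) ^ r * 3 ^ r = 6 ^ r" by (simp only: power_mult_distrib[symmetric]) simp
      finally show ?thesis .
    qed
    then have "A + (real i * h) ^ r / fact (r - 1) * R \<le> 6 ^ r * A + 6 ^ r * h ^ r * R"
      using A R mult_right_mono[of 1 "6 ^ r" A] by (intro add_mono mult_right_mono) auto
    finally show ?thesis by (simp add: algebra_simps ennreal_leI)
  qed
  have comb: "(\<Sum>i<r. w i *\<^sub>R P i x) = h ^ s *\<^sub>R v s 0 x" for x
  proof -
    have "(\<Sum>i<r. w i *\<^sub>R P i x) = (\<Sum>l<r. \<Sum>i<r. (w i * real i ^ l * (h ^ l / fact l)) *\<^sub>R v l 0 x)"
      unfolding P_def scaleR_sum_right
      by (subst sum.swap) (simp add: power_mult_distrib mult_ac)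
    also have "\<dots> = (\<Sum>l<r. ((\<Sum>i<r. w i * real i ^ l) * (h ^ l / fact l)) *\<^sub>R v l 0 x)"
      by (simp only: scaleR_sum_left[symmetric] sum_distrib_right[symmetric])
    also have "\<dots> = (\<Sum>l<r. if l = s then h ^ s *\<^sub>R v s 0 x else 0)"
      by (intro sum.cong refl) (auto simp: w(1))
    also have "\<dots> = h ^ s *\<^sub>R v s 0 x" using sr by simp
    finally show ?thesis .
  qed
  have "N (\<lambda>x. \<Sum>i<r. w i *\<^sub>R P i x) \<le> ennreal (\<Sum>i<r. \<bar>w i\<bar> * (6 ^ r * ?B))"
    by (rule N_sum_le) (use cP NP B in auto)
  also have "\<dots> \<le> ennreal (24 ^ r * (6 ^ r * ?B))"
    using w(2) B by (intro ennreal_leI) (simp only: sum_distrib_right[symmetric] mult_right_mono zero_le_mult_iff zero_le_power zero_le_numeral simp_thms)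
  finally have "N (\<lambda>x. h ^ s *\<^sub>R v s 0 x) \<le> ennreal (24 ^ r * (6 ^ r * ?B))"
    by (simp only: comb)
  then have "N (\<lambda>x. (1 / h ^ s) *\<^sub>R (h ^ s *\<^sub>R v s 0 x)) \<le> ennreal ((1 / h ^ s) * (24 ^ r * (6 ^ r * ?B)))"
    by (rule N_scale_le[rotated]) (use h B in \<open>auto intro!: continuous_intros c0\<close>)
  moreover have "(1 / h ^ s) * (24 ^ r * (6 ^ r * ?B)) = 144 ^ r * ?B / h ^ s"
  proof -
    have "(24::real) ^ r * 6 ^ r = 144 ^ r" by (simp only: power_mult_distrib[symmetric]) simp
    then show ?thesis by (simp only: mult.assoc[symmetric]) simp
  qed
  moreover have "(1 / h ^ s) *\<^sub>R (h ^ s *\<^sub>R v s 0 x) = v s 0 x" for x using h by simp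
  ultimately show ?thesis by (simp only:)
qed

end

lemma smooth_on_partial_deriv_power: "smooth_on U f \<Longrightarrow> smooth_on U ((partial_deriv i ^^ m) f)"
  by (induction m) (auto intro: smooth_on_partial_deriv)

text \<open>
  The coordinates are treated one after the other, each with reach \<open>r h\<close>; hence the total reach
  \<open>n r h\<close> in \<open>n\<close> dimensions. A coordinate is handled by a single use of the one-dimensional
  inequality for all its derivatives together. Treating the single derivatives in turn, as on the whole space, would multiply
  the reach by the order.
\<close>

lemma local_intermediate_derivative_le:
  fixes g :: "real^'n::finite \<Rightarrow> complex"
  assumes "fn_norm N \<Omega>" and U: "open U" and g: "smooth_on U g" and h: "0 < h" and r: "1 \<le> r"
    and sub: "\<And>x y. x \<in> \<Omega> \<Longrightarrow> norm y \<le> real CARD('n) * (real r * h) \<Longrightarrow> x + y \<in> U"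
    and A: "\<And>y. norm y \<le> real CARD('n) * (real r * h) \<Longrightarrow> N (\<lambda>x. g (x + y)) \<le> ennreal A" "0 \<le> A"
    and R: "\<And>w y. length w = r \<Longrightarrow> norm y \<le> real CARD('n) * (real r * h) \<Longrightarrow>
      N (\<lambda>x. word_deriv w g (x + y)) \<le> ennreal R" "0 \<le> R"
    and w: "length w \<le> r"
  shows "N (word_deriv w g) \<le> ennreal (288 ^ (r * CARD('n)) * (A + h ^ r * R) / h ^ length w)"
proof -
  interpret fn_norm N \<Omega> by fact
  let ?n = "real CARD('n)" and ?B = "A + h ^ r * R"
  have B: "0 \<le> ?B" using A R h by simp
  define \<beta> where "\<beta> = count (mset w)"
  define wd where "wd is = concat (map (\<lambda>i. replicate (\<beta> i) i) is)" for "is" :: "'n list"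
  have cont: "continuous_on \<Omega> (\<lambda>x. u (x + y))"
    if "smooth_on U u" "norm y \<le> ?n * (real r * h)" for u :: "real^'n \<Rightarrow> complex" and y
    by (rule continuous_on_compose2[OF smooth_on_continuous_on[OF that(1)]])
      (use sub that(2) in \<open>auto intro!: continuous_intros\<close>)
  have claim: "N (\<lambda>x. word_deriv (wd is) g (x + y)) \<le> ennreal (288 ^ (r * length is) * ?B / h ^ length (wd is))"
    if "length (wd is) \<le> r" "length is \<le> CARD('n)" "norm y \<le> (?n - real (length is)) * (real r * h)"
    for "is" y
    using that
  proof (induction "is" arbitrary: y)
    case Nil
    have "A \<le> ?B" using R h by simp
    moreover have "N (\<lambda>x. g (x + y)) \<le> ennreal A" using A(1)[of y] Nil by simp
    ultimately have "N (\<lambda>x. g (x + y)) \<le> ennreal ?B" by (metis ennreal_leI order_trans)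
    then show ?case by (simp add: wd_def)
  next
    case (Cons i js)
    let ?u = "word_deriv (wd js) g" and ?l = "length (wd js)" and ?s = "\<beta> i"
    let ?D = "288 ^ (r * length js) * ?B / h ^ ?l"
    define q where "q = r - ?l"
    have len: "length (wd (i # js)) = ?s + ?l" by (simp add: wd_def)
    have q: "?s \<le> q" "q + ?l = r" using Cons.prems(1) unfolding len q_def by auto
    have u: "smooth_on U ?u" by (rule smooth_on_word_deriv[OF g])
    define V where "V j \<tau> = (\<lambda>x. (partial_deriv i ^^ j) ?u (x + (y + \<tau> *\<^sub>R axis i 1)))" for j \<tau>
    have rh: "0 \<le> real r * h" using h by simp
    have small: "norm (y + \<tau> *\<^sub>R axis i 1) \<le> (?n - real (length js)) * (real r * h)"
      if \<tau>: "0 \<le> \<tau>" "\<tau> \<le> real q * h" for \<tau>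
    proof -
      have "real q * h \<le> real r * h" using q h by (intro mult_right_mono) auto
      then have "norm (y + \<tau> *\<^sub>R axis i 1) \<le> (?n - real (length (i # js))) * (real r * h) + real r * h"
        using \<tau> Cons.prems(3) by (intro order_trans[OF norm_triangle_ineq] add_mono) auto
      then show ?thesis by (simp add: algebra_simps)
    qed
    have small': "norm (y + \<tau> *\<^sub>R axis i 1) \<le> ?n * (real r * h)"
      if \<tau>: "0 \<le> \<tau>" "\<tau> \<le> real q * h" for \<tau>
      using small[OF \<tau>] mult_right_mono[of "?n - real (length js)" ?n, OF _ rh] by simp
    have "N (V ?s 0) \<le> ennreal (144 ^ q * (?D + h ^ q * R) / h ^ ?s)"
    proof (rule N_intermediate_derivative_le[OF h q(1)])
      fix j x \<tau> assume x: "x \<in> \<Omega>" and \<tau>: "0 \<le> \<tau>" "\<tau> \<le> real q * h"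
      have "x + y + \<tau> *\<^sub>R axis i 1 \<in> U" using sub[OF x small'[OF \<tau>]] by (simp add: add.assoc)
      from smooth_on_has_partial_deriv[OF U smooth_on_partial_deriv_power[OF u, where i = i and m = j] this]
      show "((\<lambda>\<sigma>. V j \<sigma> x) has_vector_derivative V (Suc j) \<tau> x) (at \<tau>)"
        by (simp add: V_def add.assoc)
    next
      fix j \<tau> assume \<tau>: "0 \<le> \<tau>" "\<tau> \<le> real q * h"
      show "continuous_on \<Omega> (V j \<tau>)"
        unfolding V_def by (rule cont[OF smooth_on_partial_deriv_power[OF u] small'[OF \<tau>]])
    next
      fix \<tau> assume \<tau>: "0 \<le> \<tau>" "\<tau> \<le> real q * h"
      show "N (V 0 \<tau>) \<le> ennreal ?D"
        using Cons.IH[OF _ _ small[OF \<tau>]] Cons.prems len by (simp add: V_def)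
      show "N (V q \<tau>) \<le> ennreal R"
        using R(1)[of "replicate q i @ wd js", OF _ small'[OF \<tau>]] q
        by (simp add: V_def word_deriv_replicate)
    qed (use B R h in auto)
    also have "144 ^ q * (?D + h ^ q * R) / h ^ ?s = 144 ^ q * (288 ^ (r * length js) * ?B + h ^ r * R) / h ^ (?s + ?l)"
      using h by (simp add: q(2)[symmetric] power_add field_simps)
    also have "\<dots> \<le> 288 ^ (r * length (i # js)) * ?B / h ^ (?s + ?l)"
    proof (rule divide_right_mono)
      have "h ^ r * R \<le> 288 ^ (r * length js) * ?B"
      proof -
        have hR: "0 \<le> h ^ r * R" using R(2) h by simp
        have "1 * (h ^ r * R) \<le> 288 ^ (r * length js) * ?B"
          by (rule mult_mono) (use A(2) hR in auto)
        then show ?thesis by (simp only: mult_1_left)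
      qed
      then have "288 ^ (r * length js) * ?B + h ^ r * R \<le> 2 * (288 ^ (r * length js) * ?B)"
        by (simp only: mult_2 add_left_mono)
      moreover have "(144::real) ^ q \<le> 144 ^ r" using q by (intro power_increasing) auto
      moreover have "0 \<le> 288 ^ (r * length js) * ?B + h ^ r * R"
        using A(2) R(2) h by (intro add_nonneg_nonneg mult_nonneg_nonneg) auto
      ultimately have "144 ^ q * (288 ^ (r * length js) * ?B + h ^ r * R) \<le> 144 ^ r * (2 * (288 ^ (r * length js) * ?B))"
        by (intro mult_mono) simp_all
      also have "\<dots> = (144 ^ r * 2) * (288 ^ (r * length js) * ?B)" by simp
      also have "\<dots> \<le> 288 ^ r * (288 ^ (r * length js) * ?B)"
      proof (rule mult_right_mono)
        have "(144::real) ^ r * 2 ^ 1 \<le> 144 ^ r * 2 ^ r" using r by (intro mult_left_mono power_increasing) auto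
        then show "(144::real) ^ r * 2 \<le> 288 ^ r" by (simp only: power_mult_distrib[symmetric]) simp
      qed (use B in simp)
      finally show "144 ^ q * (288 ^ (r * length js) * ?B + h ^ r * R) \<le> 288 ^ (r * length (i # js)) * ?B"
        by (simp add: power_add mult.assoc)
    qed (use h in simp)
    finally have "N (V ?s 0) \<le> ennreal (288 ^ (r * length (i # js)) * ?B / h ^ length (wd (i # js)))"
      by (simp add: ennreal_leI len)
    moreover have "V ?s 0 = (\<lambda>x. word_deriv (wd (i # js)) g (x + y))"
      by (simp add: V_def wd_def word_deriv_replicate)
    ultimately show ?case by simp
  qed
  have card: "length (coord_list :: 'n list) = CARD('n)"
    using coord_list[where 'n = 'n] distinct_card by metis
  have wd: "wd coord_list = mi_word \<beta>" by (simp add: wd_def mi_word_def)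
  have len: "length (mi_word \<beta>) = length w"
    unfolding length_mi_word \<beta>_def by (rule mi_order_of_word)
  have "N (\<lambda>x. word_deriv (mi_word \<beta>) g (x + 0)) \<le> ennreal (288 ^ (r * CARD('n)) * ?B / h ^ length w)"
    using claim[of coord_list 0] w card by (simp add: wd len)
  moreover have "N (\<lambda>x. word_deriv (mi_word \<beta>) g (x + 0)) = N (word_deriv w g)"
  proof (rule N_cong)
    show "continuous_on \<Omega> (\<lambda>x. word_deriv (mi_word \<beta>) g (x + 0))"
      by (rule cont[OF smooth_on_word_deriv[OF g]]) (use h in simp)
    fix x assume "x \<in> \<Omega>"
    then have "x \<in> U" using sub[of x 0] h by simp
    then show "word_deriv (mi_word \<beta>) g (x + 0) = word_deriv w g x"
      using mderiv_of_word[OF U g, of x w] by (simp add: \<beta>_def mderiv_eq_word_deriv)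
  qed
  ultimately show ?thesis by simp
qed

section \<open>Weight sequences\<close>

lemma weight_seq_mu_mono:
  assumes M: "weight_seq M" and "i \<le> j"
  shows "M (Suc i) / M i \<le> M (Suc j) / M j"
  using assms(2)
proof (induction j rule: dec_induct)
  case (step j)
  have "M (Suc j) / M j \<le> M (Suc (Suc j)) / M (Suc j)"
    using M unfolding weight_seq_def by (metis One_nat_def diff_Suc_1 le_add1 plus_1_eq_Suc)
  then show ?case using step by simp
qed simp

lemma weight_seq_mu_ge_1:
  assumes "weight_seq M"
  shows "1 \<le> M (Suc j) / M j"
proof -
  have "1 \<le> M (Suc 0) / M 0" using assms by (simp add: weight_seq_def)
  also have "\<dots> \<le> M (Suc j) / M j" by (rule weight_seq_mu_mono[OF assms]) simp
  finally show ?thesis .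
qed

lemma weight_seq_ge_1:
  assumes "weight_seq M"
  shows "1 \<le> M j"
proof (induction j)
  case (Suc j)
  then have "0 < M j" by simp
  with weight_seq_mu_ge_1[OF assms, of j] have "M j \<le> M (Suc j)" by (simp only: pos_le_divide_eq mult_1_left)
  then show ?case using Suc by simp
qed (use assms in \<open>simp add: weight_seq_def\<close>)

text \<open>
  \<open>M j\<close> is the product of the first \<open>j\<close> quotients, each at most the next one.
\<close>

lemma weight_seq_le_mu_power:
  assumes "weight_seq M"
  shows "M j \<le> (M (Suc j) / M j) ^ j"
proof (induction j)
  case (Suc j)
  have "M (Suc j) = M j * (M (Suc j) / M j)" using weight_seq_ge_1[OF assms, of j] by simp
  also have "\<dots> \<le> (M (Suc j) / M j) ^ j * (M (Suc j) / M j)"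
    using Suc weight_seq_mu_ge_1[OF assms, of j] by (intro mult_right_mono) auto
  also have "\<dots> \<le> (M (Suc (Suc j)) / M (Suc j)) ^ Suc j"
    unfolding power_Suc2[symmetric]
    using weight_seq_mu_mono[OF assms, of j "Suc j"] weight_seq_mu_ge_1[OF assms, of j] by (intro power_mono) auto
  finally show ?case .
qed (use assms in \<open>simp add: weight_seq_def\<close>)

lemma mseq_power:
  assumes "weight_seq M"
  shows "mseq M j ^ j = M j"
  using assms weight_seq_ge_1[OF assms, of j] by (cases "j = 0") (auto simp: mseq_def weight_seq_def)

lemma mseq_ge_1: "weight_seq M \<Longrightarrow> 1 \<le> mseq M j"
  using weight_seq_ge_1[of M j] by (auto simp: mseq_def)

lemma mseq_pos: "weight_seq M \<Longrightarrow> 0 < mseq M j"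
  using mseq_ge_1[of M j] by simp

text \<open>
  \<open>mseq M j\<close> is the geometric mean of the first \<open>j\<close> quotients, hence at most the quotient with which
  the next mean is formed.
\<close>

lemma mseq_mono:
  assumes M: "weight_seq M" and "i \<le> j"
  shows "mseq M i \<le> mseq M j"
  using assms(2)
proof (induction j rule: dec_induct)
  case (step j)
  have "mseq M j \<le> mseq M (Suc j)"
  proof (cases "j = 0")
    case True
    then show ?thesis using mseq_ge_1[OF M, of 1] by (simp add: mseq_def)
  next
    case False
    let ?a = "mseq M j" and ?\<mu> = "M (Suc j) / M j"
    have a: "0 \<le> ?a" using mseq_pos[OF M, of j] by simp
    have "?a ^ j \<le> ?\<mu> ^ j"
      using weight_seq_le_mu_power[OF M, of j] by (simp add: mseq_power[OF M])
    then have "?a \<le> ?\<mu>"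
      using False weight_seq_mu_ge_1[OF M, of j] by (metis power_mono_iff a gr0I order_trans zero_le_one)
    then have "?a ^ j * ?a \<le> M j * ?\<mu>"
      unfolding mseq_power[OF M] using weight_seq_ge_1[OF M, of j] by (intro mult_left_mono) auto
    also have "\<dots> = mseq M (Suc j) ^ Suc j"
      using weight_seq_ge_1[OF M, of j] by (simp add: mseq_power[OF M] del: power_Suc)
    finally have "?a ^ Suc j \<le> mseq M (Suc j) ^ Suc j" by (simp only: power_Suc2)
    then show ?thesis using mseq_pos[OF M, of "Suc j"] by (rule power_le_imp_le_base[OF _ less_imp_le])
  qed
  then show ?case using step by simp
qed simp

lemma mseq_le:
  assumes "\<forall>j. M j \<le> M' j"
  shows "mseq M j \<le> mseq M' j"
  using assms by (auto simp: mseq_def)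

text \<open>
  The diagonal case of moderate growth, after taking roots of order \<open>2 a\<close>.
\<close>

lemma mseq_double_le:
  assumes M: "weight_seq M" "weight_seq M'" and C: "0 < C"
    and le: "\<forall>j k. M (j + k) \<le> C ^ (j + k) * M' j * M' k"
  shows "mseq M (2 * a) \<le> max 1 C * mseq M' a"
proof (cases "a = 0")
  case True then show ?thesis by (simp add: mseq_def)
next
  case False
  have "mseq M (2 * a) ^ (2 * a) = M (a + a)" by (simp add: mseq_power[OF M(1)] mult_2)
  also have "\<dots> \<le> C ^ (a + a) * M' a * M' a" using le by blast
  also have "\<dots> = (C * mseq M' a) ^ (2 * a)"
    by (simp add: power_mult_distrib mult_2 power_add mseq_power[OF M(2)])
  finally have "mseq M (2 * a) \<le> C * mseq M' a"
    using False C mseq_pos[OF M(1)] mseq_pos[OF M(2)]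
    by (metis power_mono_iff less_imp_le mult_pos_pos nat_0_less_mult_iff gr0I zero_less_numeral)
  also have "\<dots> \<le> max 1 C * mseq M' a" using mseq_pos[OF M(2), of a] by (intro mult_right_mono) auto
  finally show ?thesis .
qed

lemma base_seq_interval:
  assumes "base_seq k"
  shows "\<exists>j. k j \<le> n \<and> n < k (Suc j)"
proof (induction n)
  case 0
  then show ?case using assms strict_monoD[of k 0 1] by (auto simp: base_seq_def intro!: exI[of _ 0])
next
  case (Suc n)
  then obtain j where j: "k j \<le> n" "n < k (Suc j)" by blast
  show ?case
  proof (cases "Suc n < k (Suc j)")
    case True then show ?thesis using j by (auto intro!: exI[of _ j])
  next
    case False
    then have "k (Suc j) = Suc n" using j by simp
    moreover have "k (Suc j) < k (Suc (Suc j))" using assms by (simp add: base_seq_def strict_monoD)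
    ultimately show ?thesis by (auto intro!: exI[of _ "Suc j"])
  qed
qed

section \<open>Lacunary estimates in Lebesgue norms\<close>

lemma Lp_estimate_iff_words:
  fixes f :: "real^'n::finite \<Rightarrow> complex"
  assumes p: "1 \<le> p" and U: "open U" "smooth_on U f" and \<Omega>: "open \<Omega>" "\<Omega> \<subseteq> U"
  shows "Lp_estimate p K \<Omega> f M C \<rho> \<longleftrightarrow>
    (\<forall>w. length w \<in> K \<longrightarrow>
      Lp_norm p \<Omega> (word_deriv w f) \<le> ennreal (C * (\<rho> * mseq M (length w)) ^ length w))"
proof
  interpret fn_norm "Lp_norm p \<Omega>" \<Omega> by (rule fn_norm_Lp_norm[OF p \<Omega>(1)])
  assume est: "Lp_estimate p K \<Omega> f M C \<rho>"
  have "Lp_norm p \<Omega> (word_deriv w f) = Lp_norm p \<Omega> (mderiv (count (mset w)) f)" for w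
  proof (rule N_cong)
    show "continuous_on \<Omega> (word_deriv w f)"
      using smooth_on_continuous_on[OF smooth_on_word_deriv[OF U(2)]] \<Omega>(2) continuous_on_subset by blast
  qed (use mderiv_of_word[OF U] \<Omega>(2) in auto)
  then show "\<forall>w. length w \<in> K \<longrightarrow>
      Lp_norm p \<Omega> (word_deriv w f) \<le> ennreal (C * (\<rho> * mseq M (length w)) ^ length w)"
    using est unfolding Lp_estimate_def by (metis mi_order_of_word)
next
  assume "\<forall>w. length w \<in> K \<longrightarrow>
      Lp_norm p \<Omega> (word_deriv w f) \<le> ennreal (C * (\<rho> * mseq M (length w)) ^ length w)"
  then show "Lp_estimate p K \<Omega> f M C \<rho>"
    unfolding Lp_estimate_def mderiv_eq_word_deriv length_mi_word[symmetric] by blast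
qed

text \<open>
  At the step \<open>1 / T\<close> the contributions of the two outer orders are of equal size.
\<close>

lemma interpolation_balance:
  fixes C T :: real
  assumes "0 \<le> C" "0 < T" "A \<le> C * T ^ a"
  shows "(A + (1 / T) ^ r * (C * T ^ (a + r))) / (1 / T) ^ s \<le> 2 * C * T ^ (a + s)"
proof -
  have "(A + (1 / T) ^ r * (C * T ^ (a + r))) / (1 / T) ^ s = (A + C * T ^ a) * T ^ s"
    using assms by (simp add: power_one_over power_add field_simps)
  also have "\<dots> \<le> (2 * (C * T ^ a)) * T ^ s"
    using assms by (intro mult_right_mono) auto
  finally show ?thesis by (simp add: power_add mult_ac)
qed

lemma gap_factor_pos:
  assumes "weight_seq M" "weight_seq M'" "mseq M i \<le> B * mseq M' j"
  shows "0 < B"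
  using mseq_pos[OF assms(1), of i] mseq_pos[OF assms(2), of j] assms(3)
  by (metis less_le_trans zero_less_mult_pos2)

text \<open>
  \<open>L\<close> is the constant of the interpolation inequality. Here \<open>\<rho>\<close> absorbs it, and the gap condition
  passes from the larger outer order to the smaller one.
\<close>

lemma interpolated_weight_le:
  assumes M: "weight_seq M" "weight_seq M'" and C: "0 < C" "0 < \<rho>"
    and gap: "mseq M (a + r) \<le> B * mseq M' a"
    and T: "T = \<rho> * mseq M (a + r)" and L: "0 \<le> L" "L \<le> K ^ (a + s)"
  shows "L * (C * (\<rho> * mseq M a) ^ a + (1 / T) ^ r * (C * T ^ (a + r))) / (1 / T) ^ s
    \<le> 2 * C * (K * B * \<rho> * mseq M' (a + s)) ^ (a + s)"
proof -
  have B: "0 < B" by (rule gap_factor_pos[OF M gap])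
  have T0: "0 < T" using C mseq_pos[OF M(1)] by (simp add: T)
  have "(\<rho> * mseq M a) ^ a \<le> T ^ a"
    unfolding T using C mseq_mono[OF M(1), of a "a + r"] mseq_pos[OF M(1), of a]
    by (intro power_mono mult_left_mono) simp_all
  then have "C * (\<rho> * mseq M a) ^ a \<le> C * T ^ a" using C by (intro mult_left_mono) auto
  then have bal: "(C * (\<rho> * mseq M a) ^ a + (1 / T) ^ r * (C * T ^ (a + r))) / (1 / T) ^ s
      \<le> 2 * C * T ^ (a + s)"
    by (rule interpolation_balance[OF less_imp_le[OF C(1)] T0])
  have "T \<le> \<rho> * (B * mseq M' a)"
    unfolding T using C gap by (intro mult_left_mono) auto
  also have "\<dots> \<le> \<rho> * (B * mseq M' (a + s))"
    using C B mseq_mono[OF M(2), of a "a + s"] by (intro mult_left_mono) auto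
  finally have T': "T \<le> B * \<rho> * mseq M' (a + s)" by (simp add: mult_ac)
  have "L * (C * (\<rho> * mseq M a) ^ a + (1 / T) ^ r * (C * T ^ (a + r))) / (1 / T) ^ s
      \<le> L * (2 * C * T ^ (a + s))"
    using mult_left_mono[OF bal L(1)] by simp
  also have "\<dots> \<le> K ^ (a + s) * (2 * C * (B * \<rho> * mseq M' (a + s)) ^ (a + s))"
  proof (rule mult_mono[OF L(2)])
    show "2 * C * T ^ (a + s) \<le> 2 * C * (B * \<rho> * mseq M' (a + s)) ^ (a + s)"
      using C T0 T' by (intro mult_left_mono power_mono) simp_all
    show "0 \<le> 2 * C * T ^ (a + s)" using C T0 by simp
    show "0 \<le> K ^ (a + s)" using L by simp
  qed
  also have "\<dots> = 2 * C * (K * B * \<rho> * mseq M' (a + s)) ^ (a + s)"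
    by (simp only: mult.assoc power_mult_distrib mult.left_commute)
  finally show ?thesis .
qed

text \<open>
  A word of intermediate order is split so that its inner part \<open>u\<close> has the outer order \<open>k j\<close>.
\<close>

lemma lacunary_to_full_Lp_estimate:
  fixes f :: "real^'n::finite \<Rightarrow> complex"
  assumes p: "1 \<le> p" and f: "smooth_on UNIV f" and k: "base_seq k"
    and M: "weight_seq M" "weight_seq M'" and C: "0 < C" "0 < \<rho>"
    and gap: "\<And>j. mseq M (k (Suc j)) \<le> B * mseq M' (k j)"
    and est: "Lp_estimate p (range k) UNIV f M C \<rho>"
  shows "Lp_estimate p UNIV UNIV f M' (2 * C) (6 * B * \<rho>)"
  unfolding Lp_estimate_iff_words[OF p open_UNIV f open_UNIV subset_UNIV]
proof (intro allI impI)
  fix w :: "'n list"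
  have lac: "Lp_norm p UNIV (word_deriv w f) \<le> ennreal (C * (\<rho> * mseq M (k j)) ^ k j)"
    if "length w = k j" for w j
    using est that unfolding Lp_estimate_iff_words[OF p open_UNIV f open_UNIV subset_UNIV] by (metis rangeI)
  obtain j where j: "k j \<le> length w" "length w < k (Suc j)" using base_seq_interval[OF k] by blast
  define u v where "u = drop (length w - k j) w" and "v = take (length w - k j) w"
  have w: "w = v @ u" "length u = k j" "length v + k j = length w" using j by (auto simp: u_def v_def)
  define r where "r = k (Suc j) - k j"
  have r: "k (Suc j) = k j + r" using j by (simp add: r_def)
  define T where "T = \<rho> * mseq M (k (Suc j))"
  have T: "0 < T" using C mseq_pos[OF M(1)] by (simp add: T_def)
  have "Lp_norm p UNIV (word_deriv v (word_deriv u f))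
      \<le> ennreal (6 ^ length v * (C * (\<rho> * mseq M (k j)) ^ k j + (1 / T) ^ r * (C * T ^ (k j + r))) / (1 / T) ^ length v)"
  proof (rule Landau_Kolmogorov_words[OF translation_norm_Lp_norm[OF p] smooth_on_word_deriv[OF f]])
    show "Lp_norm p UNIV (word_deriv u f) \<le> ennreal (C * (\<rho> * mseq M (k j)) ^ k j)"
      by (rule lac[OF w(2)])
    show "Lp_norm p UNIV (word_deriv w' (word_deriv u f)) \<le> ennreal (C * T ^ (k j + r))" if "length w' = r" for w'
      using lac[of "w' @ u" "Suc j"] that w(2) r by (simp add: T_def add.commute)
    show "0 \<le> C * (\<rho> * mseq M (k j)) ^ k j" "0 \<le> C * T ^ (k j + r)" "0 < 1 / T"
      using C T mseq_pos[OF M(1), of "k j"] by simp_all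
    show "length v \<le> r" using w j r by simp
  qed
  also have "\<dots> \<le> ennreal (2 * C * (6 * B * \<rho> * mseq M' (length w)) ^ length w)"
  proof (rule ennreal_leI)
    have n: "k j + length v = length w" using w(3) by simp
    have "(6::real) ^ length v \<le> 6 ^ (k j + length v)" by (intro power_increasing) auto
    from interpolated_weight_le[OF M C _ _ _ this, of r B T] gap[of j]
    show "6 ^ length v * (C * (\<rho> * mseq M (k j)) ^ k j + (1 / T) ^ r * (C * T ^ (k j + r))) / (1 / T) ^ length v
        \<le> 2 * C * (6 * B * \<rho> * mseq M' (length w)) ^ length w"
      unfolding n r[symmetric] T_def by simp
  qed
  finally show "Lp_norm p UNIV (word_deriv w f) \<le> ennreal (2 * C * (6 * B * \<rho> * mseq M' (length w)) ^ length w)"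
    by (simp add: w(1))
qed

lemma Lp_estimate_mono_set: "Lp_estimate p UNIV \<Omega> f M C \<rho> \<Longrightarrow> Lp_estimate p K \<Omega> f M C \<rho>"
  by (simp add: Lp_estimate_def)

lemma gap_quotient_bound:
  assumes "weight_seq M'" "\<forall>j. mseq M (k (Suc j)) / mseq M' (k j) \<le> B"
  shows "mseq M (k (Suc j)) \<le> max 1 B * mseq M' (k j)"
proof -
  have "mseq M (k (Suc j)) \<le> B * mseq M' (k j)"
    using spec[OF assms(2), of j] by (simp only: pos_divide_le_eq[OF mseq_pos[OF assms(1)]])
  also have "\<dots> \<le> max 1 B * mseq M' (k j)" using mseq_pos[OF assms(1), of "k j"] by (intro mult_right_mono) auto
  finally show ?thesis .
qed

theorem class_B_lacunary:
  assumes p: "1 \<le> p" and k: "base_seq k" and M: "\<And>M. M \<in> \<MM> \<Longrightarrow> weight_seq M"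
    and gap: "gap_condition \<tau> \<MM> k"
  shows "(class_B \<tau> \<MM> p (range k) :: (real^'n::finite \<Rightarrow> complex) set) = class_B \<tau> \<MM> p UNIV"
proof
  show "(class_B \<tau> \<MM> p UNIV :: (real^'n::finite \<Rightarrow> complex) set) \<subseteq> class_B \<tau> \<MM> p (range k)"
    by (cases \<tau>) (auto intro: Lp_estimate_mono_set, (meson Lp_estimate_mono_set)+)
  show "(class_B \<tau> \<MM> p (range k) :: (real^'n::finite \<Rightarrow> complex) set) \<subseteq> class_B \<tau> \<MM> p UNIV"
  proof
    fix f :: "real^'n \<Rightarrow> complex"
    assume f: "f \<in> class_B \<tau> \<MM> p (range k)"
    show "f \<in> class_B \<tau> \<MM> p UNIV"
    proof (cases \<tau>)
      case Roumieu
      then obtain N C \<rho> where N: "smooth_on UNIV f" "N \<in> \<MM>" "C > 0" "\<rho> > 0" "Lp_estimate p (range k) UNIV f N C \<rho>"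
        using f by auto
      obtain N' B where N': "N' \<in> \<MM>" "\<forall>j. mseq N (k (Suc j)) / mseq N' (k j) \<le> B"
        using gap Roumieu N(2) by auto
      have "Lp_estimate p UNIV UNIV f N' (2 * C) (6 * max 1 B * \<rho>)"
        by (rule lacunary_to_full_Lp_estimate[OF p N(1) k M[OF N(2)] M[OF N'(1)] N(3,4)
              gap_quotient_bound[OF M[OF N'(1)] N'(2)] N(5)])
      moreover have "2 * C > 0" "6 * max 1 B * \<rho> > 0" using N by auto
      ultimately show ?thesis
        unfolding Roumieu class_B.simps mem_Collect_eq using N(1) N'(1) by blast
    next
      case Beurling
      have sm: "smooth_on UNIV f" using f Beurling by simp
      have "\<exists>C>0. Lp_estimate p UNIV UNIV f N C \<rho>" if N: "N \<in> \<MM>" "\<rho> > 0" for N \<rho>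
      proof -
        obtain N' B where N': "N' \<in> \<MM>" "\<forall>j. mseq N' (k (Suc j)) / mseq N (k j) \<le> B"
          using gap Beurling N(1) by auto
        let ?\<rho> = "\<rho> / (6 * max 1 B)"
        have \<rho>: "?\<rho> > 0" using N by simp
        then obtain C where C: "C > 0" "Lp_estimate p (range k) UNIV f N' C ?\<rho>"
          using f Beurling N'(1) by auto
        have "Lp_estimate p UNIV UNIV f N (2 * C) (6 * max 1 B * ?\<rho>)"
          by (rule lacunary_to_full_Lp_estimate[OF p sm k M[OF N'(1)] M[OF N(1)] C(1) \<rho>
                gap_quotient_bound[OF M[OF N(1)] N'(2)] C(2)])
        moreover have "6 * max 1 B * ?\<rho> = \<rho>" by simp
        ultimately show ?thesis using C(1) by (intro exI[of _ "2 * C"]) auto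
      qed
      then show ?thesis using sm Beurling by auto
    qed
  qed
qed

text \<open>
  Bounds that hold from some order on can be extended to all orders at the expense of the constant only,
  as there are finitely many words of bounded length.
\<close>

lemma finitely_many_exceptions:
  fixes F :: "'n::finite list \<Rightarrow> ennreal" and b :: "nat \<Rightarrow> real"
  assumes b: "\<And>i. 0 < b i" and fin: "\<And>w. length w < n0 \<Longrightarrow> F w \<noteq> top"
    and le: "\<And>w. n0 \<le> length w \<Longrightarrow> F w \<le> ennreal (C * b (length w))"
  shows "\<exists>C'>0. \<forall>w. F w \<le> ennreal (C' * b (length w))"
proof -
  define W where "W = {w :: 'n list. length w < n0}"
  have W: "finite W"
    using finite_lists_length_le[of "UNIV :: 'n set" n0] by (rule rev_finite_subset) (auto simp: W_def)
  define S where "S = (\<Sum>w\<in>W. enn2real (F w) / b (length w))"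
  have S: "0 \<le> S" unfolding S_def using b by (intro sum_nonneg divide_nonneg_pos) auto
  have "F w \<le> ennreal ((\<bar>C\<bar> + 1 + S) * b (length w))" for w
  proof (cases "length w < n0")
    case True
    then obtain a where a: "F w = ennreal a" "0 \<le> a" using fin[OF True] by (cases "F w") auto
    have "enn2real (F w) / b (length w) \<le> S"
      unfolding S_def using True b W
      by (intro member_le_sum) (auto simp: W_def less_imp_le)
    then have "a \<le> S * b (length w)" using a b[of "length w"] by (simp add: pos_divide_le_eq)
    also have "\<dots> \<le> (\<bar>C\<bar> + 1 + S) * b (length w)"
      using b[of "length w"] by (intro mult_right_mono) auto
    finally show ?thesis using a by (simp add: ennreal_leI)
  next
    case False
    have "C * b (length w) \<le> (\<bar>C\<bar> + 1 + S) * b (length w)"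
      using b[of "length w"] S by (intro mult_right_mono) auto
    then show ?thesis using le[of w] False by (meson ennreal_leI not_less order_trans)
  qed
  then show ?thesis using S by (intro exI[of _ "\<bar>C\<bar> + 1 + S"]) auto
qed

text \<open>
  The step \<open>1 / T\<close> has reach \<open>n r / T\<close>, which has to stay below \<open>\<delta>\<close>. For large orders this is the
  assumption \<open>small\<close>; for the others the norms are merely finite.
\<close>

lemma lacunary_to_full_local_Lp_estimate:
  fixes f :: "real^'n::finite \<Rightarrow> complex"
  assumes p: "1 \<le> p" and U: "open U" and f: "smooth_on U f" and k: "base_seq k"
    and special: "\<And>j. 1 \<le> j \<Longrightarrow> k (Suc j) \<le> D * k j"
    and M: "weight_seq M" "weight_seq M'" and C: "0 < C" "0 < \<rho>"
    and gap: "\<And>j. mseq M (k (Suc j)) \<le> B * mseq M' (k j)"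
    and \<Omega>: "open \<Omega>" "compact (closure \<Omega>)" "closure \<Omega> \<subseteq> U"
    and \<Omega>': "open \<Omega>'" "\<Omega>' \<subseteq> U" "\<And>x y. x \<in> \<Omega> \<Longrightarrow> norm y \<le> \<delta> \<Longrightarrow> x + y \<in> \<Omega>'"
    and est: "Lp_estimate p (range k) \<Omega>' f M C \<rho>"
    and small: "\<And>j. j0 \<le> j \<Longrightarrow> real CARD('n) * (real (k (Suc j)) / (\<rho> * mseq M (k (Suc j)))) \<le> \<delta>"
  shows "\<exists>C'>0. Lp_estimate p UNIV \<Omega> f M' C' (288 ^ (CARD('n) * D) * B * \<rho>)"
proof -
  let ?K = "288 ^ (CARD('n) * D) :: real"
  have B: "0 < B" by (rule gap_factor_pos[OF M gap])
  have \<Omega>U: "\<Omega> \<subseteq> U" using \<Omega>(3) closure_subset by blast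
  have lac: "Lp_norm p \<Omega>' (word_deriv w f) \<le> ennreal (C * (\<rho> * mseq M (k j)) ^ k j)"
    if "length w = k j" for w j
    using est that unfolding Lp_estimate_iff_words[OF p U f \<Omega>'(1,2)] by (metis rangeI)
  define b where "b n = (?K * B * \<rho> * mseq M' n) ^ n" for n
  \<comment> \<open>Orders from \<open>n0\<close> on lie in gaps with index above \<open>j0\<close>; in particular the gap starting at 0 is excluded.\<close>
  define n0 where "n0 = k (Suc j0)"
  have "\<exists>C'>0. \<forall>w. Lp_norm p \<Omega> (word_deriv w f) \<le> ennreal (C' * b (length w))"
  proof (rule finitely_many_exceptions)
    show "0 < b n" for n using B C mseq_pos[OF M(2)] by (simp add: b_def)
  next
    fix w :: "'n list"
    have "continuous_on (closure \<Omega>) (word_deriv w f)"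
      using smooth_on_continuous_on[OF smooth_on_word_deriv[OF f]] \<Omega>(3) continuous_on_subset by blast
    from Lp_norm_finite_bounded[OF p \<Omega>(1,2) this]
    show "Lp_norm p \<Omega> (word_deriv w f) \<noteq> top" by (metis ennreal_neq_top neq_top_trans)
  next
    fix w :: "'n list" assume "n0 \<le> length w"
    obtain j where j: "k j \<le> length w" "length w < k (Suc j)" using base_seq_interval[OF k] by blast
    have sm: "strict_mono k" using k by (simp add: base_seq_def)
    have "k (Suc j0) < k (Suc j)" using j \<open>n0 \<le> length w\<close> by (simp add: n0_def)
    then have j0: "j0 \<le> j" "1 \<le> j" using strict_mono_less[OF sm] by auto
    define u v where "u = drop (length w - k j) w" and "v = take (length w - k j) w"
    have w: "w = v @ u" "length u = k j" "length v + k j = length w" using j by (auto simp: u_def v_def)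
    define r where "r = k (Suc j) - k j"
    have r: "k (Suc j) = k j + r" "1 \<le> r" using j by (auto simp: r_def)
    define T where "T = \<rho> * mseq M (k (Suc j))"
    have T: "0 < T" using C mseq_pos[OF M(1)] by (simp add: T_def)
    have reach: "real CARD('n) * (real r * (1 / T)) \<le> \<delta>"
    proof -
      have "real r * (1 / T) \<le> real (k (Suc j)) / (\<rho> * mseq M (k (Suc j)))"
        unfolding T_def[symmetric] using T r(1) by (simp add: divide_right_mono)
      then have "real CARD('n) * (real r * (1 / T)) \<le> real CARD('n) * (real (k (Suc j)) / (\<rho> * mseq M (k (Suc j))))"
        by (intro mult_left_mono) auto
      then show ?thesis using small[OF j0(1)] by simp
    qed
    have tr: "Lp_norm p \<Omega> (\<lambda>x. g (x + y)) \<le> ennreal A"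
      if "smooth_on U g" "norm y \<le> \<delta>" "Lp_norm p \<Omega>' g \<le> ennreal A" "0 \<le> A"
      for g :: "real^'n \<Rightarrow> complex" and y A
      by (rule Lp_norm_translate_le[OF p \<Omega>(1) \<Omega>'(1) _ _ that(3,4)])
        (use smooth_on_continuous_on[OF that(1)] \<Omega>' that(2) continuous_on_subset in blast)+
    have pos: "0 \<le> C * (\<rho> * mseq M (k j)) ^ k j" "0 \<le> C * T ^ (k j + r)"
      using C T mseq_pos[OF M(1), of "k j"] by simp_all
    have "Lp_norm p \<Omega> (word_deriv v (word_deriv u f))
      \<le> ennreal (288 ^ (r * CARD('n)) * (C * (\<rho> * mseq M (k j)) ^ k j + (1 / T) ^ r * (C * T ^ (k j + r))) / (1 / T) ^ length v)"
    proof (rule local_intermediate_derivative_le[OF fn_norm_Lp_norm[OF p \<Omega>(1)] U smooth_on_word_deriv[OF f] _ r(2) _ _ pos(1) _ pos(2)])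
      show "0 < 1 / T" using T by simp
      show "x + y \<in> U" if "x \<in> \<Omega>" "norm y \<le> real CARD('n) * (real r * (1 / T))" for x y
        using \<Omega>'(2,3) that reach by (meson order_trans subsetD)
      show "Lp_norm p \<Omega> (\<lambda>x. word_deriv u f (x + y)) \<le> ennreal (C * (\<rho> * mseq M (k j)) ^ k j)"
        if "norm y \<le> real CARD('n) * (real r * (1 / T))" for y
        by (rule tr[OF smooth_on_word_deriv[OF f] order_trans[OF that reach] lac[OF w(2)] pos(1)])
      show "Lp_norm p \<Omega> (\<lambda>x. word_deriv w' (word_deriv u f) (x + y)) \<le> ennreal (C * T ^ (k j + r))"
        if "length w' = r" "norm y \<le> real CARD('n) * (real r * (1 / T))" for w' y
      proof (rule tr[OF _ order_trans[OF that(2) reach] _ pos(2)])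
        show "smooth_on U (word_deriv w' (word_deriv u f))" by (intro smooth_on_word_deriv f)
        have "length (w' @ u) = k (Suc j)" using that(1) w(2) r(1) by simp
        from lac[OF this] show "Lp_norm p \<Omega>' (word_deriv w' (word_deriv u f)) \<le> ennreal (C * T ^ (k j + r))"
          by (simp only: T_def[symmetric] r(1)[symmetric] word_deriv_simps)
      qed
      show "length v \<le> r" using w j r by simp
    qed
    also have "\<dots> \<le> ennreal (2 * C * b (length w))"
    proof (rule ennreal_leI)
      have n: "k j + length v = length w" using w(3) by simp
      have "r * CARD('n) \<le> (CARD('n) * D) * length w"
      proof -
        have "r \<le> D * k j" using special[OF j0(2)] r by simp
        also have "\<dots> \<le> D * length w" using j by simp
        finally show ?thesis by (metis mult.assoc mult.commute mult_le_mono1)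
      qed
      then have K: "(288::real) ^ (r * CARD('n)) \<le> ?K ^ (k j + length v)"
        unfolding power_mult[symmetric] n by (intro power_increasing) auto
      from interpolated_weight_le[OF M C _ _ _ this, of r B T] gap[of j]
      show "288 ^ (r * CARD('n)) * (C * (\<rho> * mseq M (k j)) ^ k j + (1 / T) ^ r * (C * T ^ (k j + r))) / (1 / T) ^ length v
        \<le> 2 * C * b (length w)"
        unfolding n r(1)[symmetric] T_def b_def by simp
    qed
    finally show "Lp_norm p \<Omega> (word_deriv w f) \<le> ennreal (2 * C * b (length w))"
      by (simp add: w(1))
  qed
  then show ?thesis
    unfolding Lp_estimate_iff_words[OF p U f \<Omega>(1) \<Omega>U] b_def by auto
qed

lemma Lp_estimate_mono_radius:
  fixes f :: "real^'n::finite \<Rightarrow> complex"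
  assumes "Lp_estimate p K \<Omega> f M C \<rho>" "\<rho> \<le> \<rho>'" "0 \<le> \<rho>" "0 \<le> C" "weight_seq M"
  shows "Lp_estimate p K \<Omega> f M C \<rho>'"
  unfolding Lp_estimate_def
proof (intro allI impI)
  fix \<alpha> :: "'n \<Rightarrow> nat" assume "mi_order \<alpha> \<in> K"
  then have "Lp_norm p \<Omega> (mderiv \<alpha> f) \<le> ennreal (C * (\<rho> * mseq M (mi_order \<alpha>)) ^ mi_order \<alpha>)"
    using assms(1) by (simp add: Lp_estimate_def)
  also have "\<dots> \<le> ennreal (C * (\<rho>' * mseq M (mi_order \<alpha>)) ^ mi_order \<alpha>)"
    using assms(2-4) mseq_pos[OF assms(5), of "mi_order \<alpha>"]
    by (intro ennreal_leI mult_left_mono power_mono mult_right_mono) simp_all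
  finally show "Lp_norm p \<Omega> (mderiv \<alpha> f) \<le> ennreal (C * (\<rho>' * mseq M (mi_order \<alpha>)) ^ mi_order \<alpha>)" .
qed

lemma special_nat_bound:
  assumes "special k" "base_seq k"
  obtains D where "\<And>j. 1 \<le> j \<Longrightarrow> k (Suc j) \<le> D * k j"
proof -
  obtain B where B: "\<forall>j\<ge>1. real (k (Suc j)) / real (k j) \<le> B" using assms(1) by (auto simp: special_def)
  obtain D where D: "B \<le> real D" using real_arch_simple by blast
  have "k (Suc j) \<le> D * k j" if j: "1 \<le> j" for j
  proof -
    have "0 < k j" using assms(2) j strict_monoD[of k 0 j] by (simp add: base_seq_def)
    moreover have "real (k (Suc j)) / real (k j) \<le> B" using B j by blast
    ultimately have "real (k (Suc j)) \<le> B * real (k j)" by (simp add: pos_divide_le_eq)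
    also have "\<dots> \<le> real D * real (k j)" using D by (intro mult_right_mono) auto
    finally show ?thesis by (metis of_nat_le_iff of_nat_mult)
  qed
  then show ?thesis by (rule that)
qed

text \<open>
  The larger set must again be relatively compact in \<open>U\<close>, since the class only provides estimates on such sets.
\<close>

lemma relatively_compact_enlargement:
  fixes \<Omega> :: "'a::euclidean_space set"
  assumes "compact (closure \<Omega>)" "open U" "closure \<Omega> \<subseteq> U"
  obtains \<delta> \<Omega>' where "0 < \<delta>" "open \<Omega>'" "compact (closure \<Omega>')" "closure \<Omega>' \<subseteq> U"
    "\<And>x y. x \<in> \<Omega> \<Longrightarrow> norm y \<le> \<delta> \<Longrightarrow> x + y \<in> \<Omega>'"
proof -
  obtain e where e: "e > 0" "(\<Union>x\<in>closure \<Omega>. cball x e) \<subseteq> U"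
    using compact_subset_open_imp_cball_epsilon_subset[OF assms] by metis
  define S where "S = (\<Union>x\<in>closure \<Omega>. \<Union>y\<in>cball 0 e. {x + y})"
  have S: "compact S" unfolding S_def by (rule compact_sums') (use assms(1) in auto)
  have SU: "S \<subseteq> U" unfolding S_def using e(2) by (force simp: dist_norm)
  have cl: "closure (interior S) \<subseteq> S"
    using S by (simp add: closure_minimal compact_imp_closed interior_subset)
  show ?thesis
  proof (rule that[of "e/2" "interior S"])
    show "compact (closure (interior S))"
      using S cl by (meson bounded_subset closed_closure compact_eq_bounded_closed)
    show "closure (interior S) \<subseteq> U" using cl SU by simp
    fix x y :: 'a assume x: "x \<in> \<Omega>" and y: "norm y \<le> e / 2"
    have "ball x e \<subseteq> S"
    proof
      fix z assume "z \<in> ball x e"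
      then have "z - x \<in> cball 0 e" by (simp add: dist_norm norm_minus_commute)
      moreover have "z = x + (z - x)" by simp
      ultimately show "z \<in> S" unfolding S_def using x closure_subset by blast
    qed
    moreover have "x + y \<in> ball x e" using y e by (simp add: dist_norm)
    ultimately show "x + y \<in> interior S" by (meson interiorI open_ball)
  qed (use e in auto)
qed

text \<open>
  The step is made admissible in different ways: in the Roumieu case by enlarging \<open>\<rho>\<close>, which is free
  there; in the Beurling case \<open>\<rho>\<close> is prescribed, but the factorial quotient tends to 0.
\<close>

theorem class_E_lacunary:
  assumes p: "1 \<le> p" and k: "base_seq k" "special k" and M: "\<And>M. M \<in> \<MM> \<Longrightarrow> weight_seq M"
    and gap: "gap_condition \<tau> \<MM> k" and fac: "factorial_condition \<tau> \<MM>" and U: "open U"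
  shows "class_E \<tau> \<MM> p (range k) U = class_E \<tau> \<MM> p UNIV (U :: (real^'n::finite) set)"
proof
  show "class_E \<tau> \<MM> p UNIV U \<subseteq> class_E \<tau> \<MM> p (range k) U"
  proof
    fix f assume "f \<in> class_E \<tau> \<MM> p UNIV U"
    then show "f \<in> class_E \<tau> \<MM> p (range k) U"
      by (cases \<tau>) (simp_all only: class_E.simps mem_Collect_eq, meson Lp_estimate_mono_set, meson Lp_estimate_mono_set)
  qed
  show "class_E \<tau> \<MM> p (range k) U \<subseteq> class_E \<tau> \<MM> p UNIV U"
  proof
    fix f :: "real^'n \<Rightarrow> complex"
    assume f: "f \<in> class_E \<tau> \<MM> p (range k) U"
    then have sm: "smooth_on U f" by (cases \<tau>) auto
    obtain D where D: "\<And>j. 1 \<le> j \<Longrightarrow> k (Suc j) \<le> D * k j" using special_nat_bound[OF k(2,1)] by blast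
    let ?n = "real CARD('n)" and ?K = "288 ^ (CARD('n) * D) :: real"
    let ?rc = "\<lambda>\<Omega>. open \<Omega> \<and> compact (closure \<Omega>) \<and> closure \<Omega> \<subseteq> U"
    show "f \<in> class_E \<tau> \<MM> p UNIV U"
    proof (cases \<tau>)
      case Roumieu
      have "\<exists>N\<in>\<MM>. \<exists>C>0. \<exists>\<rho>>0. Lp_estimate p UNIV \<Omega> f N C \<rho>" if \<Omega>: "?rc \<Omega>" for \<Omega>
      proof -
        obtain \<delta> \<Omega>' where \<delta>: "0 < \<delta>" "open \<Omega>'" "compact (closure \<Omega>')" "closure \<Omega>' \<subseteq> U"
          "\<And>x y. x \<in> \<Omega> \<Longrightarrow> norm y \<le> \<delta> \<Longrightarrow> x + y \<in> \<Omega>'"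
          using relatively_compact_enlargement[of \<Omega> U] \<Omega> U by metis
        have \<Omega>'U: "\<Omega>' \<subseteq> U" using \<delta>(4) closure_subset by blast
        obtain N C \<rho> where N: "N \<in> \<MM>" "C > 0" "\<rho> > 0" "Lp_estimate p (range k) \<Omega>' f N C \<rho>"
          using f \<delta>(2-4) unfolding Roumieu class_E.simps mem_Collect_eq by meson
        obtain N' B where N': "N' \<in> \<MM>" "\<forall>j. mseq N (k (Suc j)) / mseq N' (k j) \<le> B"
          using gap N(1) unfolding Roumieu gap_condition.simps by blast
        obtain H where H: "\<forall>j. real j / mseq N j \<le> H"
          using fac N(1) unfolding Roumieu factorial_condition.simps by blast
        \<comment> \<open>Large enough for the reach of the step to stay below \<open>\<delta>\<close>.\<close>
        define \<rho>' where "\<rho>' = max \<rho> (?n * H / \<delta>)"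
        have \<rho>': "\<rho> \<le> \<rho>'" "0 < \<rho>'" "?n * H / \<delta> \<le> \<rho>'" using N by (auto simp: \<rho>'_def)
        have "\<exists>C'>0. Lp_estimate p UNIV \<Omega> f N' C' (?K * max 1 B * \<rho>')"
        proof (rule lacunary_to_full_local_Lp_estimate[OF p U sm k(1) D M[OF N(1)] M[OF N'(1)] N(2) \<rho>'(2)
              gap_quotient_bound[OF M[OF N'(1)] N'(2)] _ _ _ \<delta>(2) \<Omega>'U \<delta>(5)])
          show "Lp_estimate p (range k) \<Omega>' f N C \<rho>'"
            using Lp_estimate_mono_radius[OF N(4) \<rho>'(1)] N M by simp
          fix j
          have "?n * (real (k (Suc j)) / (\<rho>' * mseq N (k (Suc j)))) = ?n * (real (k (Suc j)) / mseq N (k (Suc j))) / \<rho>'"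
            by simp
          also have "\<dots> \<le> ?n * H / \<rho>'"
            using spec[OF H, of "k (Suc j)"] \<rho>'(2) by (intro divide_right_mono mult_left_mono) auto
          also have "\<dots> \<le> \<delta>" using \<rho>' \<delta>(1) by (simp add: field_simps)
          finally show "?n * (real (k (Suc j)) / (\<rho>' * mseq N (k (Suc j)))) \<le> \<delta>" .
        qed (use \<Omega> in auto)
        moreover have "?K * max 1 B * \<rho>' > 0" using \<rho>'(2) by (intro mult_pos_pos) auto
        ultimately show ?thesis using N'(1) by blast
      qed
      then show ?thesis using sm unfolding Roumieu class_E.simps mem_Collect_eq by blast
    next
      case Beurling
      have "\<exists>C>0. Lp_estimate p UNIV \<Omega> f N C \<rho>" if \<Omega>: "?rc \<Omega>" and N: "N \<in> \<MM>" "\<rho> > 0" for \<Omega> N \<rho>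
      proof -
        obtain \<delta> \<Omega>' where \<delta>: "0 < \<delta>" "open \<Omega>'" "compact (closure \<Omega>')" "closure \<Omega>' \<subseteq> U"
          "\<And>x y. x \<in> \<Omega> \<Longrightarrow> norm y \<le> \<delta> \<Longrightarrow> x + y \<in> \<Omega>'"
          using relatively_compact_enlargement[of \<Omega> U] \<Omega> U by metis
        have \<Omega>'U: "\<Omega>' \<subseteq> U" using \<delta>(4) closure_subset by blast
        obtain N' B where N': "N' \<in> \<MM>" "\<forall>j. mseq N' (k (Suc j)) / mseq N (k j) \<le> B"
          using gap N(1) unfolding Beurling gap_condition.simps by blast
        define \<rho>0 where "\<rho>0 = \<rho> / (?K * max 1 B)"
        have \<rho>: "\<rho>0 > 0" unfolding \<rho>0_def using N by (intro divide_pos_pos mult_pos_pos) auto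
        obtain C where C: "C > 0" "Lp_estimate p (range k) \<Omega>' f N' C \<rho>0"
          using f \<delta>(2-4) N'(1) \<rho> unfolding Beurling class_E.simps mem_Collect_eq by meson
        have "(\<lambda>j. real j / mseq N' j) \<longlonglongrightarrow> 0" using fac N'(1) Beurling by simp
        moreover have "strict_mono (\<lambda>j. k (Suc j))" using k(1) by (simp add: base_seq_def strict_mono_def)
        ultimately have "(\<lambda>j. real (k (Suc j)) / mseq N' (k (Suc j))) \<longlonglongrightarrow> 0"
          using LIMSEQ_subseq_LIMSEQ[of _ 0 "\<lambda>j. k (Suc j)"] by (simp add: o_def)
        then have "\<forall>\<^sub>F j in sequentially. real (k (Suc j)) / mseq N' (k (Suc j)) < \<delta> * \<rho>0 / ?n"
          using \<delta>(1) \<rho> by (intro order_tendstoD(2)[OF _ divide_pos_pos]) auto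
        then obtain j0 where j0: "\<And>j. j0 \<le> j \<Longrightarrow> real (k (Suc j)) / mseq N' (k (Suc j)) < \<delta> * \<rho>0 / ?n"
          by (auto simp: eventually_sequentially)
        have "\<exists>C'>0. Lp_estimate p UNIV \<Omega> f N C' (?K * max 1 B * \<rho>0)"
        proof (rule lacunary_to_full_local_Lp_estimate[OF p U sm k(1) D M[OF N'(1)] M[OF N(1)] C(1) \<rho>
              gap_quotient_bound[OF M[OF N(1)] N'(2)] _ _ _ \<delta>(2) \<Omega>'U \<delta>(5) C(2)])
          fix j assume j: "j0 \<le> j"
          have "?n * (real (k (Suc j)) / (\<rho>0 * mseq N' (k (Suc j)))) = ?n * (real (k (Suc j)) / mseq N' (k (Suc j))) / \<rho>0"
            by simp
          also have "\<dots> \<le> ?n * (\<delta> * \<rho>0 / ?n) / \<rho>0"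
            using j0[OF j] \<rho> by (intro divide_right_mono mult_left_mono) auto
          also have "\<dots> = \<delta>" using \<rho> by simp
          finally show "?n * (real (k (Suc j)) / (\<rho>0 * mseq N' (k (Suc j)))) \<le> \<delta>" .
        qed (use \<Omega> in auto)
        moreover have "?K * max 1 B * \<rho>0 = \<rho>" by (simp add: \<rho>0_def)
        ultimately show ?thesis by simp
      qed
      then show ?thesis using sm unfolding Beurling class_E.simps mem_Collect_eq by blast
    qed
  qed
qed

section \<open>Rapidly decreasing functions\<close>

lemma abs_monomial_le_power:
  fixes x :: "real^'n::finite"
  assumes "\<And>l. \<bar>x $ l\<bar> \<le> Y"
  shows "\<bar>monomial \<alpha> x\<bar> \<le> Y ^ mi_order \<alpha>"
proof -
  have "\<bar>monomial \<alpha> x\<bar> = (\<Prod>l\<in>UNIV. \<bar>x $ l\<bar> ^ \<alpha> l)"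
    by (simp add: monomial_def abs_prod power_abs)
  also have "\<dots> \<le> (\<Prod>l\<in>UNIV. Y ^ \<alpha> l)"
    by (intro prod_mono) (auto intro: power_mono assms)
  also have "\<dots> = Y ^ mi_order \<alpha>" by (simp add: mi_order_def power_sum)
  finally show ?thesis .
qed

definition mi_single :: "'n::finite \<Rightarrow> nat \<Rightarrow> 'n \<Rightarrow> nat" where
  "mi_single i n = (\<lambda>l. if l = i then n else 0)"

lemma mi_order_single: "mi_order (mi_single i n) = n"
  by (simp add: mi_order_def mi_single_def)

lemma monomial_single: "monomial (mi_single i n) x = (x $ i) ^ n"
proof -
  have "monomial (mi_single i n) x = (\<Prod>l\<in>UNIV. if l = i then (x $ i) ^ n else 1)"
    unfolding monomial_def mi_single_def by (intro prod.cong) auto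
  then show ?thesis by simp
qed

text \<open>
  Monomials are compared with the powers of the largest coordinate, which are monomials of every order.
\<close>

lemma max_coordinate:
  fixes x :: "real^'n::finite"
  obtains i where "\<And>l. \<bar>x $ l\<bar> \<le> \<bar>x $ i\<bar>"
proof -
  have "Max (range (\<lambda>l. \<bar>x $ l\<bar>)) \<in> range (\<lambda>l. \<bar>x $ l\<bar>)" by (intro Max_in) auto
  then obtain i where "Max (range (\<lambda>l. \<bar>x $ l\<bar>)) = \<bar>x $ i\<bar>" by blast
  then have "\<bar>x $ l\<bar> \<le> \<bar>x $ i\<bar>" for l using Max_ge[of "range (\<lambda>l. \<bar>x $ l\<bar>)" "\<bar>x $ l\<bar>"] by simp
  then show ?thesis using that by blast
qed

lemma power_interpolation:
  fixes Y T F C :: real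
  assumes "0 \<le> Y" "0 < T" "0 \<le> F" "a \<le> n" "n \<le> b"
    and "Y ^ a * F \<le> C * T ^ a" "Y ^ b * F \<le> C * T ^ b"
  shows "Y ^ n * F \<le> C * T ^ n"
proof (cases "Y \<le> T")
  case True
  have "Y ^ n * F = Y ^ (n - a) * (Y ^ a * F)" using assms by (simp add: power_add[symmetric])
  also have "\<dots> \<le> T ^ (n - a) * (C * T ^ a)"
    using assms True by (intro mult_mono[OF power_mono]) auto
  also have "\<dots> = C * T ^ n" using assms by (simp add: power_add[symmetric] mult.left_commute)
  finally show ?thesis .
next
  case False
  have "T ^ (b - n) * (Y ^ n * F) \<le> Y ^ (b - n) * (Y ^ n * F)"
    using assms False by (intro mult_right_mono power_mono) auto
  also have "\<dots> = Y ^ b * F" using assms by (simp add: power_add[symmetric] mult.assoc[symmetric])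
  also have "\<dots> \<le> C * T ^ b" by fact
  also have "\<dots> = T ^ (b - n) * (C * T ^ n)" using assms by (simp add: power_add[symmetric] mult.left_commute)
  finally show ?thesis using assms by simp
qed

text \<open>
  The analogue of \<open>lacunary_to_full_Lp_estimate\<close> for multiplication by monomials, where interpolation between two
  powers of one number is elementary.
\<close>

lemma lacunary_to_full_decay:
  fixes f :: "real^'n::finite \<Rightarrow> complex"
  assumes k: "base_seq k" and M: "weight_seq M" "weight_seq M'" and C: "0 < C" "0 < \<rho>"
    and gap: "\<And>j. mseq M (k (Suc j)) \<le> B * mseq M' (k j)"
    and est: "\<And>j \<alpha> x. mi_order \<alpha> = k j \<Longrightarrow> \<bar>monomial \<alpha> x\<bar> * norm (f x) \<le> C * (\<rho> * mseq M (k j)) ^ k j"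
  shows "\<bar>monomial \<alpha> x\<bar> * norm (f x) \<le> C * (B * \<rho> * mseq M' (mi_order \<alpha>)) ^ mi_order \<alpha>"
proof -
  have B: "0 < B" by (rule gap_factor_pos[OF M gap])
  let ?n = "mi_order \<alpha>"
  obtain j where j: "k j \<le> ?n" "?n < k (Suc j)" using base_seq_interval[OF k] by blast
  obtain i where i: "\<And>l. \<bar>x $ l\<bar> \<le> \<bar>x $ i\<bar>" using max_coordinate by blast
  let ?Y = "\<bar>x $ i\<bar>"
  define T where "T = \<rho> * mseq M (k (Suc j))"
  have T: "0 < T" using C mseq_pos[OF M(1)] by (simp add: T_def)
  have e: "?Y ^ k j' * norm (f x) \<le> C * (\<rho> * mseq M (k j')) ^ k j'" for j'
    using est[of "mi_single i (k j')" j' x] by (simp add: mi_order_single monomial_single power_abs)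
  have le: "(\<rho> * mseq M (k j)) ^ k j \<le> T ^ k j"
    unfolding T_def using C mseq_mono[OF M(1), of "k j" "k (Suc j)"] mseq_pos[OF M(1), of "k j"] j
    by (intro power_mono mult_left_mono) simp_all
  have "\<bar>monomial \<alpha> x\<bar> * norm (f x) \<le> ?Y ^ ?n * norm (f x)"
    by (intro mult_right_mono abs_monomial_le_power i) simp
  also have "\<dots> \<le> C * T ^ ?n"
  proof (rule power_interpolation[of _ _ _ "k j" _ "k (Suc j)"])
    show "?Y ^ k j * norm (f x) \<le> C * T ^ k j"
      using e[of j] mult_left_mono[OF le, of C] C by linarith
    show "?Y ^ k (Suc j) * norm (f x) \<le> C * T ^ k (Suc j)" using e[of "Suc j"] by (simp only: T_def)
  qed (use j T in auto)
  also have "\<dots> \<le> C * (B * \<rho> * mseq M' ?n) ^ ?n"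
  proof -
    have "T \<le> \<rho> * (B * mseq M' (k j))"
      unfolding T_def using C gap by (intro mult_left_mono) auto
    also have "\<dots> \<le> \<rho> * (B * mseq M' ?n)"
      using C B mseq_mono[OF M(2) j(1)] by (intro mult_left_mono) auto
    finally have "T \<le> B * \<rho> * mseq M' ?n" by (simp add: mult_ac)
    then show ?thesis using C T by (intro mult_left_mono power_mono) simp_all
  qed
  finally show ?thesis .
qed

lemma lacunary_to_full_pointwise:
  fixes f :: "real^'n::finite \<Rightarrow> complex"
  assumes f: "smooth_on UNIV f" and k: "base_seq k" and l: "base_seq l"
    and M: "weight_seq M" "weight_seq M'" and C: "0 < C" "0 < \<rho>" "0 < \<sigma>"
    and gapk: "\<And>j. mseq M (k (Suc j)) \<le> B * mseq M' (k j)"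
    and gapl: "\<And>j. mseq M (l (Suc j)) \<le> B * mseq M' (l j)"
    and est: "S_lac_estimate k l f M C \<rho> \<sigma>"
  shows "\<bar>monomial \<alpha> x\<bar> * norm (f x) \<le> 2 * C * (B * \<rho> * mseq M' (mi_order \<alpha>)) ^ mi_order \<alpha>"
    and "norm (word_deriv w f x) \<le> 2 * C * (6 * B * \<sigma> * mseq M' (length w)) ^ length w"
proof -
  have B: "0 < B" by (rule gap_factor_pos[OF M gapk])
  have nn: "0 \<le> C * (B * \<rho> * mseq M' (mi_order \<alpha>)) ^ mi_order \<alpha>"
    using B C mseq_pos[OF M(2), of "mi_order \<alpha>"] by simp
  have "\<bar>monomial \<alpha> x\<bar> * norm (f x) \<le> C * (B * \<rho> * mseq M' (mi_order \<alpha>)) ^ mi_order \<alpha>"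
    by (rule lacunary_to_full_decay[OF k M C(1,2) gapk]) (use est in \<open>auto simp: S_lac_estimate_def\<close>)
  then show "\<bar>monomial \<alpha> x\<bar> * norm (f x) \<le> 2 * C * (B * \<rho> * mseq M' (mi_order \<alpha>)) ^ mi_order \<alpha>"
    using nn by linarith
  have cont: "continuous_on UNIV (word_deriv w f)" for w
    by (rule smooth_on_continuous_on[OF smooth_on_word_deriv[OF f]])
  have "Lp_estimate \<infinity> (range l) UNIV f M C \<sigma>"
    unfolding Lp_estimate_def
  proof (intro allI impI)
    fix \<beta> :: "'n \<Rightarrow> nat" assume "mi_order \<beta> \<in> range l"
    then obtain j where j: "mi_order \<beta> = l j" by blast
    have "norm (mderiv \<beta> f x) \<le> C * (\<sigma> * mseq M (l j)) ^ l j" for x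
      using est j unfolding S_lac_estimate_def by blast
    then show "Lp_norm \<infinity> UNIV (mderiv \<beta> f) \<le> ennreal (C * (\<sigma> * mseq M (mi_order \<beta>)) ^ mi_order \<beta>)"
      using cont[of "mi_word \<beta>"] unfolding mderiv_eq_word_deriv j
      by (subst Lp_norm_infinity_le_iff) (auto intro: ennreal_leI)
  qed
  then have "Lp_estimate \<infinity> UNIV UNIV f M' (2 * C) (6 * B * \<sigma>)"
    by (intro lacunary_to_full_Lp_estimate[OF _ f l M C(1,3) gapl]) simp_all
  then have "Lp_norm \<infinity> UNIV (word_deriv w f) \<le> ennreal (2 * C * (6 * B * \<sigma> * mseq M' (length w)) ^ length w)"
    by (subst (asm) Lp_estimate_iff_words[OF _ open_UNIV f open_UNIV subset_UNIV]) simp_all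
  then have "ennreal (norm (word_deriv w f x)) \<le> ennreal (2 * C * (6 * B * \<sigma> * mseq M' (length w)) ^ length w)"
    using Lp_norm_infinity_le_iff[OF open_UNIV cont] by blast
  then show "norm (word_deriv w f x) \<le> 2 * C * (6 * B * \<sigma> * mseq M' (length w)) ^ length w"
    using B C mseq_pos[OF M(2), of "length w"] by (subst (asm) ennreal_le_iff) simp_all
qed

text \<open>
  \<open>F\<close> bounds \<open>|f|\<close> on the ball of radius \<open>\<rho>\<close> about \<open>x\<close>. The choice of this radius lets the shift from \<open>x\<close>
  to a nearby point be absorbed: \<open>\<rho>^(2a)\<close> is at most \<open>(\<rho> m_(2a))^(2a)\<close>. The local inequality is balanced
  by \<open>h^(2b) = F / (C T^(2b))\<close>, that is \<open>h = \<theta> / T\<close>; the extra factor \<open>\<kappa>\<close> shortens the step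
  where its reach would exceed \<open>\<rho>\<close>.
\<close>

lemma mixed_decay_estimate:
  fixes f :: "real^'n::finite \<Rightarrow> complex"
  assumes f: "smooth_on UNIV f" and M: "weight_seq M" and C: "0 < C" "0 < \<rho>" "0 < \<sigma>"
    and decay: "\<And>\<alpha> x. \<bar>monomial \<alpha> x\<bar> * norm (f x) \<le> C * (\<rho> * mseq M (mi_order \<alpha>)) ^ mi_order \<alpha>"
    and deriv: "\<And>w x. norm (word_deriv w f x) \<le> C * (\<sigma> * mseq M (length w)) ^ length w"
    and b: "b = length w" "1 \<le> b"
    and \<kappa>: "0 < \<kappa>" "\<kappa> \<le> 1" "real CARD('n) * (real (2 * b) * (\<kappa> / (\<sigma> * mseq M (2 * b)))) \<le> \<rho>"
    and a: "a = mi_order \<alpha>"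
  shows "\<bar>monomial \<alpha> x\<bar> * norm (word_deriv w f x)
    \<le> 4 * C * (1 / \<kappa>) ^ b * (2 * \<rho> * mseq M (2 * a)) ^ a * (288 ^ (2 * CARD('n)) * \<sigma> * mseq M (2 * b)) ^ b"
proof (cases "monomial \<alpha> x = 0")
  case True
  then show ?thesis using C \<kappa> mseq_pos[OF M, of "2 * a"] mseq_pos[OF M, of "2 * b"] by simp
next
  case False
  define X where "X = \<bar>monomial \<alpha> x\<bar>"
  have X: "0 < X" using False by (simp add: X_def)
  define P where "P = (2 * \<rho> * mseq M (2 * a)) ^ a"
  have P: "0 < P" using C mseq_pos[OF M, of "2 * a"] by (simp add: P_def)
  \<comment> \<open>The two bounds for \<open>|f|\<close> near \<open>x\<close>: the trivial one and the decay; \<open>P\<close> is the claimed factor of order \<open>a\<close>.\<close>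
  define F where "F = min C (2 * C * P\<^sup>2 / X\<^sup>2)"
  have F: "0 < F" "F \<le> C" "X\<^sup>2 * F \<le> 2 * C * P\<^sup>2"
  proof -
    show "0 < F" using C P X by (simp add: F_def)
    have "X\<^sup>2 * F \<le> X\<^sup>2 * (2 * C * P\<^sup>2 / X\<^sup>2)" by (intro mult_left_mono) (auto simp: F_def)
    then show "X\<^sup>2 * F \<le> 2 * C * P\<^sup>2" using X by simp
  qed (simp add: F_def)
  have near: "norm (f (x + y)) \<le> F" if y: "norm y \<le> \<rho>" for y
  proof -
    have 1: "norm (f (x + y)) \<le> C" using deriv[of "[]" "x + y"] by simp
    obtain i where i: "\<And>l. \<bar>x $ l\<bar> \<le> \<bar>x $ i\<bar>" using max_coordinate by blast
    have XY: "X \<le> \<bar>x $ i\<bar> ^ a" unfolding X_def a by (rule abs_monomial_le_power[OF i])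
    define Z where "Z = \<bar>(x + y) $ i\<bar>"
    have "\<bar>x $ i\<bar> \<le> Z + \<rho>"
      using component_le_norm_cart[of y i] y by (simp add: Z_def)
    also have "\<dots> \<le> 2 * max Z \<rho>" by simp
    finally have x2: "\<bar>x $ i\<bar> \<le> 2 * max Z \<rho>" .
    have Z: "0 \<le> Z" by (simp add: Z_def)
    have "X\<^sup>2 \<le> (\<bar>x $ i\<bar> ^ a)\<^sup>2" using XY X by (intro power_mono) auto
    also have "\<dots> = \<bar>x $ i\<bar> ^ (2 * a)" by (simp add: power_mult[symmetric] mult.commute)
    also have "\<dots> \<le> (2 * max Z \<rho>) ^ (2 * a)" using x2 by (intro power_mono) auto
    also have "\<dots> = 2 ^ (2 * a) * max (Z ^ (2 * a)) (\<rho> ^ (2 * a))"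
      unfolding power_mult_distrib using Z C by (auto simp: max_def power_mono intro: antisym)
    also have "\<dots> \<le> 2 ^ (2 * a) * (Z ^ (2 * a) + \<rho> ^ (2 * a))"
      using Z C by (intro mult_left_mono) (auto simp: max_def)
    finally have "X\<^sup>2 * norm (f (x + y)) \<le> 2 ^ (2 * a) * (Z ^ (2 * a) + \<rho> ^ (2 * a)) * norm (f (x + y))"
      by (intro mult_right_mono) auto
    also have "\<dots> = 2 ^ (2 * a) * (Z ^ (2 * a) * norm (f (x + y)) + \<rho> ^ (2 * a) * norm (f (x + y)))"
      by (simp add: algebra_simps)
    also have "\<dots> \<le> 2 ^ (2 * a) * (C * (\<rho> * mseq M (2 * a)) ^ (2 * a) + (\<rho> * mseq M (2 * a)) ^ (2 * a) * C)"
    proof (rule mult_left_mono[OF add_mono])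
      show "Z ^ (2 * a) * norm (f (x + y)) \<le> C * (\<rho> * mseq M (2 * a)) ^ (2 * a)"
        using decay[of "mi_single i (2 * a)" "x + y"] 
        by (simp only: mi_order_single monomial_single Z_def power_abs)
      have "\<rho> * 1 \<le> \<rho> * mseq M (2 * a)" using mseq_ge_1[OF M] C by (intro mult_left_mono) auto
      then have "\<rho> ^ (2 * a) \<le> (\<rho> * mseq M (2 * a)) ^ (2 * a)" using C by (intro power_mono) auto
      then show "\<rho> ^ (2 * a) * norm (f (x + y)) \<le> (\<rho> * mseq M (2 * a)) ^ (2 * a) * C"
        using 1 C mseq_pos[OF M, of "2 * a"] by (intro mult_mono) auto
    qed simp
    also have "\<dots> = 2 * C * P\<^sup>2"
      by (simp add: P_def power_mult[symmetric] power_mult_distrib mult.commute[of a])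
    finally have "norm (f (x + y)) \<le> 2 * C * P\<^sup>2 / X\<^sup>2" using X by (simp add: field_simps)
    with 1 show ?thesis by (simp add: F_def)
  qed
  define T where "T = \<sigma> * mseq M (2 * b)"
  have T: "0 < T" using C mseq_pos[OF M] by (simp add: T_def)
  define \<theta> where "\<theta> = root (2 * b) (F / C)"
  have \<theta>: "0 < \<theta>" "\<theta> \<le> 1" "\<theta> ^ (2 * b) = F / C"
  proof -
    have b2: "0 < 2 * b" using b(2) by simp
    have FC: "0 < F / C" "F / C \<le> 1" using F C by auto
    show "0 < \<theta>" unfolding \<theta>_def using b2 FC(1) by (rule real_root_gt_zero)
    show "\<theta> \<le> 1" unfolding \<theta>_def using FC(2) by (simp only: real_root_le_1_iff[OF b2])
    show "\<theta> ^ (2 * b) = F / C" unfolding \<theta>_def using b2 FC(1) by (intro real_root_pow_pos2) auto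
  qed
  define h where "h = \<kappa> * \<theta> / T"
  have h: "0 < h" using \<kappa> \<theta> T by (simp add: h_def)
  have reach: "real CARD('n) * (real (2 * b) * h) \<le> \<rho>"
  proof -
    have "h \<le> \<kappa> / T" unfolding h_def using \<kappa> \<theta> T by (intro divide_right_mono) (auto simp: mult_left_le)
    then have "real CARD('n) * (real (2 * b) * h) \<le> real CARD('n) * (real (2 * b) * (\<kappa> / T))"
      by (intro mult_left_mono) auto
    then show ?thesis using \<kappa>(3) by (simp only: T_def)
  qed
  have "ennreal (norm (word_deriv w f x)) \<le> ennreal (288 ^ (2 * b * CARD('n)) * (F + h ^ (2 * b) * (C * T ^ (2 * b))) / h ^ length w)"
  proof (rule local_intermediate_derivative_le[OF fn_norm_point open_UNIV f h])
    show "ennreal (norm (f (x + y))) \<le> ennreal F" if "norm y \<le> real CARD('n) * (real (2 * b) * h)" for y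
      using near[OF order_trans[OF that reach]] by (rule ennreal_leI)
    show "ennreal (norm (word_deriv w' f (x + y))) \<le> ennreal (C * T ^ (2 * b))" if "length w' = 2 * b" for w' y
      using deriv[of w' "x + y"] that by (auto simp: T_def intro: ennreal_leI)
  qed (use b F C T in auto)
  also have "h ^ (2 * b) * (C * T ^ (2 * b)) = \<kappa> ^ (2 * b) * F"
    using T C by (simp add: h_def power_divide power_mult_distrib \<theta>(3))
  finally have "norm (word_deriv w f x) \<le> 288 ^ (2 * b * CARD('n)) * (F + \<kappa> ^ (2 * b) * F) / h ^ b"
    using F \<kappa> h b by (subst (asm) ennreal_le_iff) auto
  also have "\<dots> \<le> 288 ^ (2 * b * CARD('n)) * (2 * F) / h ^ b"
  proof -
    have "\<kappa> ^ (2 * b) * F \<le> 1 * F" using \<kappa> F by (intro mult_right_mono power_le_one) auto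
    then show ?thesis using h by (intro divide_right_mono mult_left_mono) auto
  qed
  also have "\<dots> = 2 * (C * \<theta> ^ b) * (1 / \<kappa>) ^ b * (288 ^ (2 * CARD('n)) * T) ^ b"
  proof -
    have "F = C * (\<theta> ^ b * \<theta> ^ b)" using \<theta>(3) C by (simp add: mult_2 power_add)
    moreover have "(288::real) ^ (2 * b * CARD('n)) = (288 ^ (2 * CARD('n))) ^ b"
      by (simp add: power_mult[symmetric] mult_ac)
    ultimately show ?thesis using \<theta> \<kappa> T
      by (simp add: h_def power_divide power_mult_distrib)
  qed
  finally have main: "X * norm (word_deriv w f x) \<le> X * (2 * (C * \<theta> ^ b) * (1 / \<kappa>) ^ b * (288 ^ (2 * CARD('n)) * T) ^ b)"
    using X by (intro mult_left_mono) auto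
  have "(X * (C * \<theta> ^ b))\<^sup>2 \<le> (2 * C * P)\<^sup>2"
  proof -
    have "(\<theta> ^ b)\<^sup>2 = F / C" using \<theta>(3) by (simp add: power_mult[symmetric] mult.commute)
    then have "(X * (C * \<theta> ^ b))\<^sup>2 = X\<^sup>2 * (C\<^sup>2 * (F / C))" by (simp only: power_mult_distrib)
    also have "\<dots> = C * (X\<^sup>2 * F)" using C by (simp add: power2_eq_square)
    also have "\<dots> \<le> C * (2 * C * P\<^sup>2)" using C F(3) by (intro mult_left_mono) auto
    also have "\<dots> \<le> (2 * C * P)\<^sup>2" using C by (simp add: power2_eq_square)
    finally show ?thesis .
  qed
  then have XP: "X * (C * \<theta> ^ b) \<le> 2 * C * P"
    by (rule power2_le_imp_le) (use C P in auto)
  have "X * norm (word_deriv w f x) \<le> 2 * (X * (C * \<theta> ^ b)) * ((1 / \<kappa>) ^ b * (288 ^ (2 * CARD('n)) * T) ^ b)"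
    using main by (simp only: mult_ac)
  also have "\<dots> \<le> 2 * (2 * C * P) * ((1 / \<kappa>) ^ b * (288 ^ (2 * CARD('n)) * T) ^ b)"
    using XP \<kappa> T by (intro mult_right_mono mult_left_mono mult_nonneg_nonneg) auto
  finally show ?thesis by (simp add: X_def P_def T_def mult_ac)
qed

text \<open>
  The shortening factor \<open>\<kappa> b\<close> equals 1 from \<open>b0\<close> on, so that its powers \<open>(1 / \<kappa> b)^b\<close> have a common bound \<open>Q\<close>
  and only enlarge the constant.
\<close>

lemma S_estimate_of_pointwise:
  fixes f :: "real^'n::finite \<Rightarrow> complex"
  assumes f: "smooth_on UNIV f" and M: "weight_seq M" "weight_seq M'" and C: "0 < C" "0 < \<rho>" "0 < \<sigma>"
    and decay: "\<And>\<alpha> x. \<bar>monomial \<alpha> x\<bar> * norm (f x) \<le> C * (\<rho> * mseq M (mi_order \<alpha>)) ^ mi_order \<alpha>"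
    and deriv: "\<And>w x. norm (word_deriv w f x) \<le> C * (\<sigma> * mseq M (length w)) ^ length w"
    and double: "\<And>a. mseq M (2 * a) \<le> c * mseq M' a"
    and small: "\<And>b. b0 \<le> b \<Longrightarrow> real CARD('n) * (real (2 * b) / (\<sigma> * mseq M (2 * b))) \<le> \<rho>"
  shows "\<exists>C'. S_estimate f M' C' (2 * \<rho> * c) (288 ^ (2 * CARD('n)) * \<sigma> * c)"
proof -
  let ?n = "real CARD('n)" and ?K = "288 ^ (2 * CARD('n)) :: real"
  have c: "0 < c" by (rule gap_factor_pos[OF M double])
  define t where "t b = ?n * (real (2 * b) / (\<sigma> * mseq M (2 * b)))" for b
  have t: "0 \<le> t b" for b
    using C mseq_pos[OF M(1), of "2 * b"] by (simp add: t_def)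
  define \<kappa> where "\<kappa> b = (if t b \<le> \<rho> then 1 else \<rho> / t b)" for b
  have \<kappa>: "0 < \<kappa> b" "\<kappa> b \<le> 1" "t b * \<kappa> b \<le> \<rho>" for b
    using t[of b] C by (auto simp: \<kappa>_def field_simps)
  define Q where "Q = 1 + (\<Sum>b<b0. (1 / \<kappa> b) ^ b)"
  have sum0: "0 \<le> (\<Sum>b<b0. (1 / \<kappa> b) ^ b)"
    using \<kappa>(1) by (intro sum_nonneg) (simp add: less_imp_le)
  have Q: "(1 / \<kappa> b) ^ b \<le> Q" for b
  proof (cases "b0 \<le> b")
    case True
    then have "\<kappa> b = 1" using small[of b] by (simp add: \<kappa>_def t_def)
    then show ?thesis using sum0 by (simp add: Q_def)
  next
    case False
    have "(1 / \<kappa> b) ^ b \<le> (\<Sum>b<b0. (1 / \<kappa> b) ^ b)"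
      using False \<kappa>(1) by (intro member_le_sum) (auto simp: less_imp_le)
    then show ?thesis by (simp add: Q_def)
  qed
  have "S_estimate f M' (4 * C * Q) (2 * \<rho> * c) (?K * \<sigma> * c)"
    unfolding S_estimate_def
  proof (intro allI)
    fix \<alpha> \<beta> :: "'n \<Rightarrow> nat" and x :: "real^'n"
    define w where "w = mi_word \<beta>"
    define a b where "a = mi_order \<alpha>" and "b = mi_order \<beta>"
    have b: "b = length w" by (simp add: b_def w_def length_mi_word)
    have ma: "0 < mseq M (2 * a)" "0 < mseq M' a" "0 < mseq M (2 * b)" "0 < mseq M' b"
      by (intro mseq_pos M)+
    have "\<bar>monomial \<alpha> x\<bar> * norm (word_deriv w f x)
        \<le> 4 * C * (1 / \<kappa> b) ^ b * (2 * \<rho> * mseq M (2 * a)) ^ a * (?K * \<sigma> * mseq M (2 * b)) ^ b"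
    proof (cases "b = 0")
      case True
      have "\<bar>monomial \<alpha> x\<bar> * norm (f x) \<le> C * (\<rho> * mseq M a) ^ a" using decay by (simp add: a_def)
      also have "\<dots> \<le> (4 * C) * (2 * \<rho> * mseq M (2 * a)) ^ a"
      proof (rule mult_mono[OF _ power_mono])
        show "\<rho> * mseq M a \<le> 2 * \<rho> * mseq M (2 * a)"
          using mseq_mono[OF M(1), of a "2 * a"] C mseq_pos[OF M(1), of a] by (intro mult_mono) auto
      qed (use C mseq_pos[OF M(1), of a] in auto)
      finally show ?thesis using True b by simp
    next
      case False
      have "t b * \<kappa> b = ?n * (real (2 * b) * (\<kappa> b / (\<sigma> * mseq M (2 * b))))" by (simp add: t_def)
      then have "?n * (real (2 * b) * (\<kappa> b / (\<sigma> * mseq M (2 * b)))) \<le> \<rho>" using \<kappa>(3)[of b] by simp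
      from mixed_decay_estimate[OF f M(1) C decay deriv b _ \<kappa>(1,2) this a_def]
      show ?thesis using False by simp
    qed
    also have "\<dots> \<le> (4 * C * Q) * (2 * \<rho> * c * mseq M' a) ^ a * (?K * \<sigma> * c * mseq M' b) ^ b"
    proof (rule mult_mono[OF mult_mono])
      show "4 * C * (1 / \<kappa> b) ^ b \<le> 4 * C * Q" using Q[of b] C by (intro mult_left_mono) auto
      show "(2 * \<rho> * mseq M (2 * a)) ^ a \<le> (2 * \<rho> * c * mseq M' a) ^ a"
        using double[of a] C ma by (intro power_mono) (simp_all add: mult.assoc)
      show "(?K * \<sigma> * mseq M (2 * b)) ^ b \<le> (?K * \<sigma> * c * mseq M' b) ^ b"
        using double[of b] C ma by (intro power_mono) (simp_all add: mult.assoc)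
      show "0 \<le> 4 * C * Q" using C sum0 by (simp add: Q_def)
      then show "0 \<le> 4 * C * Q * (2 * \<rho> * c * mseq M' a) ^ a" using C c ma by simp
    qed (use C ma in simp_all)
    finally have fin: "\<bar>monomial \<alpha> x\<bar> * norm (mderiv \<beta> f x)
        \<le> (4 * C * Q) * ((2 * \<rho> * c * mseq M' a) ^ a * (?K * \<sigma> * c * mseq M' b) ^ b)"
      by (simp only: mderiv_eq_word_deriv w_def[symmetric] mult.assoc)
    have "0 < (2 * \<rho> * c * mseq M' a) ^ a * (?K * \<sigma> * c * mseq M' b) ^ b"
      using C c ma by (intro mult_pos_pos zero_less_power) auto
    with fin show "\<bar>monomial \<alpha> x\<bar> * norm (mderiv \<beta> f x) /
        ((2 * \<rho> * c * mseq M' (mi_order \<alpha>)) ^ mi_order \<alpha> * (?K * \<sigma> * c * mseq M' (mi_order \<beta>)) ^ mi_order \<beta>)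
        \<le> 4 * C * Q"
      unfolding a_def[symmetric] b_def[symmetric] by (simp only: pos_divide_le_eq)
  qed
  then show ?thesis by blast
qed

lemma S_lac_estimate_of_S_estimate:
  fixes f :: "real^'n::finite \<Rightarrow> complex"
  assumes M: "weight_seq M" and \<rho>: "0 < \<rho>" "0 < \<sigma>" and est: "S_estimate f M C \<rho> \<sigma>"
  shows "S_lac_estimate k l f M (max 1 C) \<rho> \<sigma>"
proof -
  have e: "\<bar>monomial \<alpha> x\<bar> * norm (mderiv \<beta> f x)
      \<le> max 1 C * ((\<rho> * mseq M (mi_order \<alpha>)) ^ mi_order \<alpha> * (\<sigma> * mseq M (mi_order \<beta>)) ^ mi_order \<beta>)" for \<alpha> \<beta> x
  proof -
    have pos: "0 < (\<rho> * mseq M (mi_order \<alpha>)) ^ mi_order \<alpha> * (\<sigma> * mseq M (mi_order \<beta>)) ^ mi_order \<beta>"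
      using \<rho> mseq_pos[OF M] by (intro mult_pos_pos zero_less_power) auto
    have "\<bar>monomial \<alpha> x\<bar> * norm (mderiv \<beta> f x) /
        ((\<rho> * mseq M (mi_order \<alpha>)) ^ mi_order \<alpha> * (\<sigma> * mseq M (mi_order \<beta>)) ^ mi_order \<beta>) \<le> max 1 C"
      using est unfolding S_estimate_def by (meson max.coboundedI2)
    then show ?thesis by (simp only: pos_divide_le_eq[OF pos])
  qed
  have zero: "mi_order (\<lambda>_ :: 'n. 0) = 0" "monomial (\<lambda>_ :: 'n. 0) x = 1" for x :: "real^'n"
    by (auto simp: mi_order_def monomial_def)
  have "mderiv (\<lambda>_. 0) f = f"
    unfolding mderiv_eq_word_deriv using length_mi_word[of "\<lambda>_ :: 'n. 0"] by (simp add: zero)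
  then have "\<bar>monomial \<alpha> x\<bar> * norm (f x) \<le> max 1 C * (\<rho> * mseq M (mi_order \<alpha>)) ^ mi_order \<alpha>"
    "norm (mderiv \<beta> f x) \<le> max 1 C * (\<sigma> * mseq M (mi_order \<beta>)) ^ mi_order \<beta>" for \<alpha> \<beta> x
    using e[of \<alpha> x "\<lambda>_. 0"] e[of "\<lambda>_. 0" x \<beta>] by (simp_all add: zero)
  then show ?thesis
    unfolding S_lac_estimate_def by metis
qed

lemma totally_ordered_lower:
  assumes "totally_ordered \<MM>" "M \<in> \<MM>" "M' \<in> \<MM>"
  obtains N where "N \<in> \<MM>" "\<And>j. mseq N j \<le> mseq M j" "\<And>j. mseq N j \<le> mseq M' j"
  using assms mseq_le unfolding totally_ordered_def by (metis order_refl)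

lemma totally_ordered_upper:
  assumes "totally_ordered \<MM>" "M \<in> \<MM>" "M' \<in> \<MM>"
  obtains N where "N \<in> \<MM>" "\<And>j. mseq M j \<le> mseq N j" "\<And>j. mseq M' j \<le> mseq N j"
  using assms mseq_le unfolding totally_ordered_def by (metis order_refl)

text \<open>
  Three weights occur: \<open>M\<close> in the lacunary estimates, \<open>N\<close> in the separate estimates at all orders, and
  \<open>M'\<close> in the mixed estimates.
\<close>

lemma S_estimate_of_S_lac_estimate:
  fixes f :: "real^'n::finite \<Rightarrow> complex"
  assumes f: "smooth_on UNIV f" and k: "base_seq k" and l: "base_seq l"
    and M: "weight_seq M" "weight_seq N" "weight_seq M'" and C: "0 < C" "0 < \<rho>" "0 < \<sigma>"
    and gap: "\<And>j. mseq M (k (Suc j)) \<le> B * mseq N (k j)" "\<And>j. mseq M (l (Suc j)) \<le> B * mseq N (l j)"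
    and est: "S_lac_estimate k l f M C \<rho> \<sigma>"
    and growth: "0 < c" "\<forall>j k. N (j + k) \<le> c ^ (j + k) * M' j * M' k"
    and \<sigma>': "6 * B * \<sigma> \<le> \<sigma>'"
    and small: "\<And>b. b0 \<le> b \<Longrightarrow> real (2 * b) / mseq N (2 * b) \<le> B * \<rho> * \<sigma>' / real CARD('n)"
  shows "\<exists>C'. S_estimate f M' C' (2 * (B * \<rho>) * max 1 c) (288 ^ (2 * CARD('n)) * \<sigma>' * max 1 c)"
proof (rule S_estimate_of_pointwise[OF f M(2,3)])
  note full = lacunary_to_full_pointwise[OF f k l M(1,2) C gap est]
  have B: "0 < B" by (rule gap_factor_pos[OF M(1,2) gap(1)])
  show pos: "0 < 2 * C" "0 < B * \<rho>" "0 < \<sigma>'"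
    using B C less_le_trans[OF _ \<sigma>'] by simp_all
  show "\<bar>monomial \<alpha> x\<bar> * norm (f x) \<le> 2 * C * (B * \<rho> * mseq N (mi_order \<alpha>)) ^ mi_order \<alpha>" for \<alpha> x
    by (rule full(1))
  show "norm (word_deriv w f x) \<le> 2 * C * (\<sigma>' * mseq N (length w)) ^ length w" for w x
  proof (rule order_trans[OF full(2)])
    show "2 * C * (6 * B * \<sigma> * mseq N (length w)) ^ length w \<le> 2 * C * (\<sigma>' * mseq N (length w)) ^ length w"
      using \<sigma>' B C mseq_pos[OF M(2), of "length w"]
      by (intro mult_left_mono power_mono mult_right_mono) simp_all
  qed
  show "mseq N (2 * a) \<le> max 1 c * mseq M' a" for a
    by (rule mseq_double_le[OF M(2,3) growth])
  fix b assume b: "b0 \<le> b"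
  let ?n = "real CARD('n)"
  have "?n * (real (2 * b) / (\<sigma>' * mseq N (2 * b))) = ?n * (real (2 * b) / mseq N (2 * b)) / \<sigma>'" by simp
  also have "\<dots> \<le> ?n * (B * \<rho> * \<sigma>' / ?n) / \<sigma>'"
    using small[OF b] pos(3) by (intro divide_right_mono mult_left_mono) auto
  also have "\<dots> = B * \<rho>" using pos(3) by simp
  finally show "?n * (real (2 * b) / (\<sigma>' * mseq N (2 * b))) \<le> B * \<rho>" .
qed

text \<open>
  The weights obtained from the two gap conditions are replaced by the larger (Roumieu) or the smaller
  (Beurling) of them, which is where the total order of the family enters.
\<close>

theorem class_S_lacunary:
  assumes k: "base_seq k" and l: "base_seq l" and M: "\<And>M. M \<in> \<MM> \<Longrightarrow> weight_seq M"
    and ord: "totally_ordered \<MM>" and gapk: "gap_condition \<tau> \<MM> k" and gapl: "gap_condition \<tau> \<MM> l"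
    and fac: "factorial_condition \<tau> \<MM>" and mg: "moderate_growth \<tau> \<MM>"
  shows "(class_S_lac \<tau> \<MM> k l :: (real^'n::finite \<Rightarrow> complex) set) = class_S \<tau> \<MM>"
proof
  show "(class_S \<tau> \<MM> :: (real^'n \<Rightarrow> complex) set) \<subseteq> class_S_lac \<tau> \<MM> k l"
  proof
    fix f :: "real^'n \<Rightarrow> complex" assume f: "f \<in> class_S \<tau> \<MM>"
    have pos: "0 < max 1 C" for C :: real by simp
    note to_lac = S_lac_estimate_of_S_estimate[OF M]
    show "f \<in> class_S_lac \<tau> \<MM> k l"
      using f by (cases \<tau>) (simp_all only: class_S.simps class_S_lac.simps mem_Collect_eq, (meson to_lac pos)+)
  qed
  let ?n = "real CARD('n)" and ?K = "288 ^ (2 * CARD('n)) :: real"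
  show "(class_S_lac \<tau> \<MM> k l :: (real^'n \<Rightarrow> complex) set) \<subseteq> class_S \<tau> \<MM>"
  proof
    fix f :: "real^'n \<Rightarrow> complex" assume f: "f \<in> class_S_lac \<tau> \<MM> k l"
    then have sm: "smooth_on UNIV f" by (cases \<tau>) auto
    have widen: "mseq N (q (Suc j)) \<le> B * mseq N' (q j)"
      if "\<forall>j. mseq M1 (q (Suc j)) / mseq M2 (q j) \<le> B'" "weight_seq M2" "max 1 B' \<le> B"
        "\<And>j. mseq N j \<le> mseq M1 j" "\<And>j. mseq M2 j \<le> mseq N' j" for N M1 M2 N' q B B' j
    proof -
      have "mseq N (q (Suc j)) \<le> max 1 B' * mseq M2 (q j)"
        using that(4) gap_quotient_bound[OF that(2,1)] by (rule order_trans)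
      also have "\<dots> \<le> B * mseq N' (q j)"
        using that(3) that(5)[of "q j"] mseq_pos[OF that(2), of "q j"] by (intro mult_mono) auto
      finally show ?thesis .
    qed
    show "f \<in> class_S \<tau> \<MM>"
    proof (cases \<tau>)
      case Roumieu
      obtain M0 C \<rho> \<sigma> where M0: "M0 \<in> \<MM>" "0 < C" "0 < \<rho>" "0 < \<sigma>" "S_lac_estimate k l f M0 C \<rho> \<sigma>"
        using f unfolding Roumieu class_S_lac.simps mem_Collect_eq by blast
      obtain M1 B1 where M1: "M1 \<in> \<MM>" "\<forall>j. mseq M0 (k (Suc j)) / mseq M1 (k j) \<le> B1"
        using gapk M0(1) unfolding Roumieu gap_condition.simps by blast
      obtain M2 B2 where M2: "M2 \<in> \<MM>" "\<forall>j. mseq M0 (l (Suc j)) / mseq M2 (l j) \<le> B2"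
        using gapl M0(1) unfolding Roumieu gap_condition.simps by blast
      obtain N where N: "N \<in> \<MM>" "\<And>j. mseq M1 j \<le> mseq N j" "\<And>j. mseq M2 j \<le> mseq N j"
        using totally_ordered_upper[OF ord M1(1) M2(1)] by blast
      define B where "B = max (max 1 B1) (max 1 B2)"
      have B: "max 1 B1 \<le> B" "max 1 B2 \<le> B" "0 < B" by (simp_all add: B_def)
      obtain M' c where M': "M' \<in> \<MM>" "0 < c" "\<forall>j k. N (j + k) \<le> c ^ (j + k) * M' j * M' k"
        using mg N(1) unfolding Roumieu moderate_growth.simps by blast
      obtain H where H: "\<forall>j. real j / mseq N j \<le> H"
        using fac N(1) unfolding Roumieu factorial_condition.simps by blast
      \<comment> \<open>Large enough for the step of the local inequality to stay within reach \<open>B \<rho>\<close> at every order.\<close>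
      define \<sigma>' where "\<sigma>' = max (6 * B * \<sigma>) (?n * H / (B * \<rho>))"
      have pos: "0 < B * \<rho>" "0 < \<sigma>'"
        using mult_pos_pos[OF B(3) M0(3)] mult_pos_pos[OF B(3) M0(4)] by (auto simp: \<sigma>'_def less_max_iff_disj)
      have "?n * H / (B * \<rho>) \<le> \<sigma>'" by (simp add: \<sigma>'_def)
      then have "?n * H \<le> B * \<rho> * \<sigma>'" by (simp only: pos_divide_le_eq[OF pos(1)] mult.commute)
      then have H': "H \<le> B * \<rho> * \<sigma>' / ?n" by (simp add: pos_le_divide_eq mult.commute)
      have "\<exists>C'. S_estimate f M' C' (2 * (B * \<rho>) * max 1 c) (?K * \<sigma>' * max 1 c)"
      proof (rule S_estimate_of_S_lac_estimate[OF sm k l M[OF M0(1)] M[OF N(1)] M[OF M'(1)] M0(2-4) _ _ M0(5) M'(2,3)])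
        show "mseq M0 (k (Suc j)) \<le> B * mseq N (k j)" "mseq M0 (l (Suc j)) \<le> B * mseq N (l j)" for j
          by (rule widen[OF M1(2) M[OF M1(1)] B(1) order_refl N(2)], rule widen[OF M2(2) M[OF M2(1)] B(2) order_refl N(3)])
        show "6 * B * \<sigma> \<le> \<sigma>'" by (simp add: \<sigma>'_def)
        show "real (2 * b) / mseq N (2 * b) \<le> B * \<rho> * \<sigma>' / ?n" for b
          using spec[OF H, of "2 * b"] H' by (rule order_trans)
      qed
      moreover have "0 < 2 * (B * \<rho>) * max 1 c" "0 < ?K * \<sigma>' * max 1 c"
        using pos by (auto intro!: mult_pos_pos)
      ultimately show ?thesis
        using sm M'(1) unfolding Roumieu class_S.simps mem_Collect_eq by blast
    next
      case Beurling
      have "\<exists>C. S_estimate f M0 C \<rho> \<sigma>" if M0: "M0 \<in> \<MM>" and \<rho>: "0 < \<rho>" and \<sigma>: "0 < \<sigma>" for M0 \<rho> \<sigma>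
      proof -
        obtain M' c where M': "M' \<in> \<MM>" "0 < c" "\<forall>j k. M' (j + k) \<le> c ^ (j + k) * M0 j * M0 k"
          using mg M0 unfolding Beurling moderate_growth.simps by blast
        obtain M1 B1 where M1: "M1 \<in> \<MM>" "\<forall>j. mseq M1 (k (Suc j)) / mseq M' (k j) \<le> B1"
          using gapk M'(1) unfolding Beurling gap_condition.simps by blast
        obtain M2 B2 where M2: "M2 \<in> \<MM>" "\<forall>j. mseq M2 (l (Suc j)) / mseq M' (l j) \<le> B2"
          using gapl M'(1) unfolding Beurling gap_condition.simps by blast
        obtain N where N: "N \<in> \<MM>" "\<And>j. mseq N j \<le> mseq M1 j" "\<And>j. mseq N j \<le> mseq M2 j"
          using totally_ordered_lower[OF ord M1(1) M2(1)] by blast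
        define B where "B = max (max 1 B1) (max 1 B2)"
        have B: "max 1 B1 \<le> B" "max 1 B2 \<le> B" "0 < B" by (simp_all add: B_def)
        define \<rho>' \<sigma>' where "\<rho>' = \<rho> / (2 * B * max 1 c)" and "\<sigma>' = \<sigma> / (?K * max 1 c)"
        have pos: "0 < \<rho>'" "0 < \<sigma>'" "0 < \<sigma>' / (6 * B)" using \<rho> \<sigma> B(3) unfolding \<rho>'_def \<sigma>'_def
          by (auto intro!: divide_pos_pos mult_pos_pos)
        obtain C where C: "0 < C" "S_lac_estimate k l f N C \<rho>' (\<sigma>' / (6 * B))"
          using f N(1) pos unfolding Beurling class_S_lac.simps mem_Collect_eq by meson
        have "(\<lambda>j. real j / mseq M' j) \<longlonglongrightarrow> 0" using fac M'(1) Beurling by simp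
        then have "(\<lambda>b. real (2 * b) / mseq M' (2 * b)) \<longlonglongrightarrow> 0"
          using LIMSEQ_subseq_LIMSEQ[of "\<lambda>j. real j / mseq M' j" 0 "\<lambda>b. 2 * b"] by (simp add: o_def strict_mono_def)
        then have "\<forall>\<^sub>F b in sequentially. real (2 * b) / mseq M' (2 * b) < B * \<rho>' * \<sigma>' / ?n"
          using pos B(3) by (intro order_tendstoD(2)[OF _ divide_pos_pos]) auto
        then obtain b0 where b0: "\<And>b. b0 \<le> b \<Longrightarrow> real (2 * b) / mseq M' (2 * b) < B * \<rho>' * \<sigma>' / ?n"
          unfolding eventually_sequentially by blast
        have "\<exists>C'. S_estimate f M0 C' (2 * (B * \<rho>') * max 1 c) (?K * \<sigma>' * max 1 c)"
        proof (rule S_estimate_of_S_lac_estimate[OF sm k l M[OF N(1)] M[OF M'(1)] M[OF M0] C(1) pos(1,3) _ _ C(2) M'(2,3)])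
          show "mseq N (k (Suc j)) \<le> B * mseq M' (k j)" "mseq N (l (Suc j)) \<le> B * mseq M' (l j)" for j
            by (rule widen[OF M1(2) M[OF M'(1)] B(1) N(2) order_refl], rule widen[OF M2(2) M[OF M'(1)] B(2) N(3) order_refl])
          show "6 * B * (\<sigma>' / (6 * B)) \<le> \<sigma>'" using B(3) by simp
          show "real (2 * b) / mseq M' (2 * b) \<le> B * \<rho>' * \<sigma>' / ?n" if "b0 \<le> b" for b
            using b0[OF that] by simp
        qed
        moreover have "2 * (B * \<rho>') * max 1 c = \<rho>" "?K * \<sigma>' * max 1 c = \<sigma>"
          using B(3) by (simp_all add: \<rho>'_def \<sigma>'_def)
        ultimately show ?thesis by simp
      qed
      then show ?thesis using sm unfolding Beurling class_S.simps mem_Collect_eq by blast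
    qed
  qed
qed

theorem theorem5p3:
  fixes p :: ennreal and k l :: "nat \<Rightarrow> nat" and \<MM> :: "(nat \<Rightarrow> real) set" and \<tau> :: utype
  assumes "1 \<le> p"
    and "base_seq k" and "base_seq l"
    and "\<And>M. M \<in> \<MM> \<Longrightarrow> weight_seq M"
    and "totally_ordered \<MM>"
    and "gap_condition \<tau> \<MM> k"
  shows "(class_B \<tau> \<MM> p (range k) :: (real^'n \<Rightarrow> complex) set) = class_B \<tau> \<MM> p UNIV
    \<and> (class_D \<tau> \<MM> (range k) :: (real^'n \<Rightarrow> complex) set) = class_D \<tau> \<MM> UNIV
    \<and> (factorial_condition \<tau> \<MM> \<longrightarrow>
         (special k \<longrightarrow>
           (\<forall>U :: (real^'n) set. open U \<longrightarrow> class_E \<tau> \<MM> p (range k) U = class_E \<tau> \<MM> p UNIV U))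
       \<and> (moderate_growth \<tau> \<MM> \<and> gap_condition \<tau> \<MM> l \<longrightarrow>
           (class_S_lac \<tau> \<MM> k l :: (real^'n \<Rightarrow> complex) set) = class_S \<tau> \<MM>))"
proof (intro conjI impI allI)
  show "(class_B \<tau> \<MM> p (range k) :: (real^'n \<Rightarrow> complex) set) = class_B \<tau> \<MM> p UNIV"
    by (rule class_B_lacunary[OF assms(1,2,4,6)])
  have "(class_B \<tau> \<MM> \<infinity> (range k) :: (real^'n \<Rightarrow> complex) set) = class_B \<tau> \<MM> \<infinity> UNIV"
    by (rule class_B_lacunary[OF _ assms(2,4,6)]) simp
  then show "(class_D \<tau> \<MM> (range k) :: (real^'n \<Rightarrow> complex) set) = class_D \<tau> \<MM> UNIV"
    by (simp only: class_D_def)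
next
  fix U :: "(real^'n) set"
  assume "factorial_condition \<tau> \<MM>" "special k" "open U"
  then show "class_E \<tau> \<MM> p (range k) U = class_E \<tau> \<MM> p UNIV U"
    by (intro class_E_lacunary assms)
next
  assume "factorial_condition \<tau> \<MM>" "moderate_growth \<tau> \<MM> \<and> gap_condition \<tau> \<MM> l"
  then show "(class_S_lac \<tau> \<MM> k l :: (real^'n \<Rightarrow> complex) set) = class_S \<tau> \<MM>"
    by (intro class_S_lacunary assms) auto
qed

end
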